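(* The category $\mathcal{ESLCBS}$ of étale spaces over locally compact Boolean spaces, whose morphisms are étale space cohomomorphisms over continuous proper maps, is equivalent to the category $\mathcal{LSBA}$ of left-handed skew Boolean algebras, whose morphisms are proper skew Boolean algebra homomorphisms.
   Context: **Skew Boolean algebras.** A skew lattice is an algebra $(S;\wedge,\vee)$ with associative idempotent binary operations satisfying $x\wedge(x\vee y)=x=x\vee(x\wedge y)$ and $(y\vee x)\wedge x=x=(y\wedge x)\vee x$. Its natural partial order is: $x\le y$ iff $x\wedge y=y\wedge x=x$ (equivalently $x\vee y=y\vee x=y$). It is symmetric if, for all $x,y$, $x\vee y=y\vee x$ iff $x\wedge y=y\wedge x$. A zero is an element $0$ with $x\wedge 0=0\wedge x=0$ for all $x$. It is Boolean if it is symmetric, has a zero, and for every $x$ the subalgebra $\lceil x\rceil=\{u\in S:u\le x\}=x\wedge S\wedge x$ is a Boolean lattice. In that case $a\setminus b$ denotes the complement of $a\wedge b\wedge a$ in $\lceil a\rceil$. A skew Boolean algebra is an algebra $(S;\wedge,\vee,\setminus,0)$ arising from a Boolean skew lattice in this way; homomorphisms preserve $\wedge,\vee,\setminus,0$. It is left-handed if $x\wedge y\wedge x=x\wedge y$ and $x\vee y\vee x=y\vee x$ for all $x,y$. The relation $\mathcal D$ is defined by $x\,\mathcal D\,y$ iff $x\wedge y\wedge x=x$ and $y\wedge x\wedge y=y$; it is a congruence, and $S/\mathcal D$ is the maximal generalized Boolean algebra image of $S$ (a generalized Boolean algebra is a relatively complemented distributive lattice with zero). A homomorphism $f:S_1\to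 S_2$ induces a homomorphism $\overline f:S_1/\mathcal D\to S_2/\mathcal D$. A homomorphism $h:B_1\to B_2$ of generalized Boolean algebras is proper if for every $c\in B_2$ there is $b\in B_1$ with $h(b)\ge c$; $f$ is proper if $\overline f$ is proper. **Étale spaces.** A locally compact Boolean space is a locally compact Hausdorff space in which the clopen sets form a base. A continuous map is proper if preimages of compact sets are compact. An étale space over $X$ is a triple $(E,\pi,X)$ with $\pi:E\to X$ a surjective local homeomorphism. The stalk over $x$ is $E_x=\pi^{-1}(x)$. For open $U\subseteq X$, $E(U)$ is the set of sections over $U$, i.e. continuous maps $s:U\to E$ with $\pi s=\mathrm{id}_U$ (identified with their images). Let $(\mathcal A,g,X)$, $(\mathcal B,h,Y)$ be étale spaces and $f:X\to Y$ continuous. An $f$-cohomomorphism $k:\mathcal B\rightsquigarrow\mathcal A$ is a collection of maps $k_x:\mathcal B_{f(x)}\to\mathcal A_x$, $x\in X$, such that for every open $U\subseteq Y$ and every section $s\in\mathcal B(U)$ the function $x\mapsto k_x(s(f(x)))$ is a section of $\mathcal A$ over $f^{-1}(U)$. In $\mathcal{ESLCBS}$ a morphism from $\mathcal B$ to $\mathcal A$ is an $f$-cohomomorphism $k:\mathcal B\rightsquigarrow\mathcal A$ over some continuous proper map $f:X\to Y$. If $k:\mathcal B\rightsquigarrow\mathcal A$ is over $f:X\to Y$ and $l:\mathcal A\rightsquigarrow\mathcal C$ is over $e:W\to X$, the composite $\mathcal B\rightsquigarrow\mathcal C$ is over $f\circ e$ and has components $l_w\circ k_{e(w)}$, $w\in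 W$. *)

theory Defs
  imports "HOL-Analysis.Analysis"
begin

text \<open>
  Hom-sets need not be disjoint, so composition and the action of a functor on morphisms
  take the objects involved as arguments.  For \<open>f \<in> Hom C a b\<close> and \<open>g \<in> Hom C b c\<close> the composite
  ``first f, then g'' is \<open>Cmp C a b c g f\<close>.
\<close>

record ('o, 'm) precategory =
  Obj :: "'o set"
  Hom :: "'o \<Rightarrow> 'o \<Rightarrow> 'm set"
  Idt :: "'o \<Rightarrow> 'm"
  Cmp :: "'o \<Rightarrow> 'o \<Rightarrow> 'o \<Rightarrow> 'm \<Rightarrow> 'm \<Rightarrow> 'm"

locale category =
  fixes C :: "('o, 'm) precategory"
  assumes Idt_in_Hom: "a \<in> Obj C \<Longrightarrow> Idt C a \<in> Hom C a a"
    and Cmp_in_Hom: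
      "\<lbrakk>a \<in> Obj C; b \<in> Obj C; c \<in> Obj C; f \<in> Hom C a b; g \<in> Hom C b c\<rbrakk>
        \<Longrightarrow> Cmp C a b c g f \<in> Hom C a c"
    and Cmp_Idt_right:
      "\<lbrakk>a \<in> Obj C; b \<in> Obj C; f \<in> Hom C a b\<rbrakk> \<Longrightarrow> Cmp C a a b f (Idt C a) = f"
    and Cmp_Idt_left:
      "\<lbrakk>a \<in> Obj C; b \<in> Obj C; f \<in> Hom C a b\<rbrakk> \<Longrightarrow> Cmp C a b b (Idt C b) f = f"
    and Cmp_assoc:
      "\<lbrakk>a \<in> Obj C; b \<in> Obj C; c \<in> Obj C; d \<in> Obj C;
        f \<in> Hom C a b; g \<in> Hom C b c; h \<in> Hom C c d\<rbrakk>
        \<Longrightarrow> Cmp C a b d (Cmp C b c d h g) f = Cmp C a c d h (Cmp C a b c g f)"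

definition iso_in :: "('o, 'm) precategory \<Rightarrow> 'o \<Rightarrow> 'o \<Rightarrow> 'm \<Rightarrow> bool" where
  "iso_in C a b f \<longleftrightarrow>
     f \<in> Hom C a b \<and>
     (\<exists>g \<in> Hom C b a. Cmp C a b a g f = Idt C a \<and> Cmp C b a b f g = Idt C b)"

record ('o, 'm, 'p, 'n) prefunctor =
  omap :: "'o \<Rightarrow> 'p"
  mmap :: "'o \<Rightarrow> 'o \<Rightarrow> 'm \<Rightarrow> 'n"

locale category_functor = C: category C + D: category D
  for C :: "('o, 'm) precategory" and D :: "('p, 'n) precategory" +
  fixes F :: "('o, 'm, 'p, 'n) prefunctor"
  assumes omap_Obj: "a \<in> Obj C \<Longrightarrow> omap F a \<in> Obj D"
    and mmap_Hom:
      "\<lbrakk>a \<in> Obj C; b \<in> Obj C; f \<in> Hom C a b\<rbrakk>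
        \<Longrightarrow> mmap F a b f \<in> Hom D (omap F a) (omap F b)"
    and mmap_Idt: "a \<in> Obj C \<Longrightarrow> mmap F a a (Idt C a) = Idt D (omap F a)"
    and mmap_Cmp:
      "\<lbrakk>a \<in> Obj C; b \<in> Obj C; c \<in> Obj C; f \<in> Hom C a b; g \<in> Hom C b c\<rbrakk>
        \<Longrightarrow> mmap F a c (Cmp C a b c g f)
          = Cmp D (omap F a) (omap F b) (omap F c) (mmap F b c g) (mmap F a b f)"

definition id_functor :: "('o, 'm, 'o, 'm) prefunctor" where
  "id_functor = \<lparr>omap = (\<lambda>a. a), mmap = (\<lambda>a b f. f)\<rparr>"

definition comp_functor ::
  "('p, 'n, 'q, 'l) prefunctor \<Rightarrow> ('o, 'm, 'p, 'n) prefunctor \<Rightarrow> ('o, 'm, 'q, 'l) prefunctor" where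
  "comp_functor G F =
     \<lparr>omap = (\<lambda>a. omap G (omap F a)),
      mmap = (\<lambda>a b f. mmap G (omap F a) (omap F b) (mmap F a b f))\<rparr>"

definition natural_iso ::
  "('o, 'm) precategory \<Rightarrow> ('p, 'n) precategory \<Rightarrow>
   ('o, 'm, 'p, 'n) prefunctor \<Rightarrow> ('o, 'm, 'p, 'n) prefunctor \<Rightarrow> ('o \<Rightarrow> 'n) \<Rightarrow> bool" where
  "natural_iso C D F G \<eta> \<longleftrightarrow>
     (\<forall>a \<in> Obj C. iso_in D (omap F a) (omap G a) (\<eta> a)) \<and>
     (\<forall>a \<in> Obj C. \<forall>b \<in> Obj C. \<forall>f \<in> Hom C a b.
        Cmp D (omap F a) (omap F b) (omap G b) (\<eta> b) (mmap F a b f)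
        = Cmp D (omap F a) (omap G a) (omap G b) (mmap G a b f) (\<eta> a))"

definition equivalent_categories ::
  "('o, 'm) precategory \<Rightarrow> ('p, 'n) precategory \<Rightarrow> bool" where
  "equivalent_categories C D \<longleftrightarrow>
     (\<exists>F G. category_functor C D F \<and> category_functor D C G \<and>
        (\<exists>\<eta>. natural_iso C C id_functor (comp_functor G F) \<eta>) \<and>
        (\<exists>\<epsilon>. natural_iso D D (comp_functor F G) id_functor \<epsilon>))"

record 'a skew_alg =
  carr :: "'a set"
  meet :: "'a \<Rightarrow> 'a \<Rightarrow> 'a"
  join :: "'a \<Rightarrow> 'a \<Rightarrow> 'a"
  diff :: "'a \<Rightarrow> 'a \<Rightarrow> 'a"
  zero :: "'a"

locale skew_lattice =
  fixes S :: "'a skew_alg"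
  assumes meet_closed: "\<lbrakk>x \<in> carr S; y \<in> carr S\<rbrakk> \<Longrightarrow> meet S x y \<in> carr S"
    and join_closed: "\<lbrakk>x \<in> carr S; y \<in> carr S\<rbrakk> \<Longrightarrow> join S x y \<in> carr S"
    and meet_assoc: "\<lbrakk>x \<in> carr S; y \<in> carr S; z \<in> carr S\<rbrakk>
      \<Longrightarrow> meet S (meet S x y) z = meet S x (meet S y z)"
    and join_assoc: "\<lbrakk>x \<in> carr S; y \<in> carr S; z \<in> carr S\<rbrakk>
      \<Longrightarrow> join S (join S x y) z = join S x (join S y z)"
    and meet_idem: "x \<in> carr S \<Longrightarrow> meet S x x = x"
    and join_idem: "x \<in> carr S \<Longrightarrow> join S x x = x"
    and absorb1: "\<lbrakk>x \<in> carr S; y \<in> carr S\<rbrakk> \<Longrightarrow> meet S x (join S x y) = x"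
    and absorb2: "\<lbrakk>x \<in> carr S; y \<in> carr S\<rbrakk> \<Longrightarrow> join S x (meet S x y) = x"
    and absorb3: "\<lbrakk>x \<in> carr S; y \<in> carr S\<rbrakk> \<Longrightarrow> meet S (join S y x) x = x"
    and absorb4: "\<lbrakk>x \<in> carr S; y \<in> carr S\<rbrakk> \<Longrightarrow> join S (meet S y x) x = x"

definition natural_le :: "'a skew_alg \<Rightarrow> 'a \<Rightarrow> 'a \<Rightarrow> bool" where
  "natural_le S x y \<longleftrightarrow> meet S x y = x \<and> meet S y x = x"

definition down_set :: "'a skew_alg \<Rightarrow> 'a \<Rightarrow> 'a set" where
  "down_set S x = {u \<in> carr S. natural_le S u x}"

definition boolean_lattice_on ::
  "'a set \<Rightarrow> ('a \<Rightarrow> 'a \<Rightarrow> 'a) \<Rightarrow> ('a \<Rightarrow> 'a \<Rightarrow> 'a) \<Rightarrow> 'a \<Rightarrow> 'a \<Rightarrow> bool" where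
  "boolean_lattice_on A m j bt tp \<longleftrightarrow>
     bt \<in> A \<and> tp \<in> A \<and>
     (\<forall>x \<in> A. \<forall>y \<in> A. m x y \<in> A \<and> j x y \<in> A) \<and>
     (\<forall>x \<in> A. \<forall>y \<in> A. m x y = m y x \<and> j x y = j y x) \<and>
     (\<forall>x \<in> A. \<forall>y \<in> A. \<forall>z \<in> A. m (m x y) z = m x (m y z) \<and> j (j x y) z = j x (j y z)) \<and>
     (\<forall>x \<in> A. \<forall>y \<in> A. m x (j x y) = x \<and> j x (m x y) = x) \<and>
     (\<forall>x \<in> A. \<forall>y \<in> A. \<forall>z \<in> A. m x (j y z) = j (m x y) (m x z)) \<and>
     (\<forall>x \<in> A. m bt x = bt \<and> m x tp = x) \<and>
     (\<forall>x \<in> A. \<exists>y \<in> A. m x y = bt \<and> j x y = tp)"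

locale skew_boolean_algebra = skew_lattice +
  assumes symmetric: "\<lbrakk>x \<in> carr S; y \<in> carr S\<rbrakk>
      \<Longrightarrow> join S x y = join S y x \<longleftrightarrow> meet S x y = meet S y x"
    and zero_closed: "zero S \<in> carr S"
    and zero_meet: "x \<in> carr S \<Longrightarrow> meet S x (zero S) = zero S \<and> meet S (zero S) x = zero S"
    and down_set_boolean:
      "x \<in> carr S \<Longrightarrow> boolean_lattice_on (down_set S x) (meet S) (join S) (zero S) x"
    and diff_in_down_set: "\<lbrakk>x \<in> carr S; y \<in> carr S\<rbrakk> \<Longrightarrow> diff S x y \<in> down_set S x"
    and diff_complement: "\<lbrakk>x \<in> carr S; y \<in> carr S\<rbrakk>
      \<Longrightarrow> meet S (meet S (meet S x y) x) (diff S x y) = zero S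
        \<and> join S (meet S (meet S x y) x) (diff S x y) = x"

locale left_handed_skew_boolean_algebra = skew_boolean_algebra +
  assumes left_handed_meet:
      "\<lbrakk>x \<in> carr S; y \<in> carr S\<rbrakk> \<Longrightarrow> meet S (meet S x y) x = meet S x y"
    and left_handed_join:
      "\<lbrakk>x \<in> carr S; y \<in> carr S\<rbrakk> \<Longrightarrow> join S (join S x y) x = join S y x"

definition skew_hom :: "'a skew_alg \<Rightarrow> 'b skew_alg \<Rightarrow> ('a \<Rightarrow> 'b) set" where
  "skew_hom S T =
     {f \<in> carr S \<rightarrow>\<^sub>E carr T.
        (\<forall>x \<in> carr S. \<forall>y \<in> carr S.
           f (meet S x y) = meet T (f x) (f y) \<and>
           f (join S x y) = join T (f x) (f y) \<and>
           f (diff S x y) = diff T (f x) (f y)) \<and>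
        f (zero S) = zero T}"

definition D_rel :: "'a skew_alg \<Rightarrow> ('a \<times> 'a) set" where
  "D_rel S = {(x, y). x \<in> carr S \<and> y \<in> carr S \<and>
                meet S (meet S x y) x = x \<and> meet S (meet S y x) y = y}"

definition D_quotient :: "'a skew_alg \<Rightarrow> 'a set skew_alg" where
  "D_quotient S =
     \<lparr>carr = carr S // D_rel S,
      meet = (\<lambda>X Y. \<Union>x\<in>X. \<Union>y\<in>Y. D_rel S `` {meet S x y}),
      join = (\<lambda>X Y. \<Union>x\<in>X. \<Union>y\<in>Y. D_rel S `` {join S x y}),
      diff = (\<lambda>X Y. \<Union>x\<in>X. \<Union>y\<in>Y. D_rel S `` {diff S x y}),
      zero = D_rel S `` {zero S}\<rparr>"

definition D_induced :: "'b skew_alg \<Rightarrow> ('a \<Rightarrow> 'b) \<Rightarrow> 'a set \<Rightarrow> 'b set" where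
  "D_induced T f X = (\<Union>x\<in>X. D_rel T `` {f x})"

text \<open>
  The quotients by \<open>D_rel\<close> are generalized Boolean algebras, on which \<open>natural_le\<close>
  is the lattice order.
\<close>

definition proper_gba_hom :: "'a skew_alg \<Rightarrow> 'b skew_alg \<Rightarrow> ('a \<Rightarrow> 'b) \<Rightarrow> bool" where
  "proper_gba_hom A B h \<longleftrightarrow> (\<forall>c \<in> carr B. \<exists>b \<in> carr A. natural_le B c (h b))"

definition proper_skew_hom :: "'a skew_alg \<Rightarrow> 'b skew_alg \<Rightarrow> ('a \<Rightarrow> 'b) set" where
  "proper_skew_hom S T =
     {f \<in> skew_hom S T. proper_gba_hom (D_quotient S) (D_quotient T) (D_induced T f)}"

definition locally_compact_boolean_space :: "'x topology \<Rightarrow> bool" where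
  "locally_compact_boolean_space X \<longleftrightarrow>
     locally_compact_space X \<and> Hausdorff_space X \<and>
     openin X = arbitrary union_of (\<lambda>U. openin X U \<and> closedin X U)"

text \<open>
  \<open>proper_map\<close> of the library means ``closed with compact fibres''; here properness is
  compactness of preimages of compact sets.
\<close>

definition continuous_proper_map :: "'x topology \<Rightarrow> 'y topology \<Rightarrow> ('x \<Rightarrow> 'y) \<Rightarrow> bool" where
  "continuous_proper_map X Y f \<longleftrightarrow>
     continuous_map X Y f \<and>
     (\<forall>K. compactin Y K \<longrightarrow> compactin X {x \<in> topspace X. f x \<in> K})"

definition local_homeomorphism :: "'e topology \<Rightarrow> 'x topology \<Rightarrow> ('e \<Rightarrow> 'x) \<Rightarrow> bool" where
  "local_homeomorphism E X p \<longleftrightarrow>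
     continuous_map E X p \<and>
     (\<forall>e \<in> topspace E. \<exists>U. openin E U \<and> e \<in> U \<and> openin X (p ` U) \<and>
        homeomorphic_map (subtopology E U) (subtopology X (p ` U)) p)"

record ('e, 'x) etale =
  total :: "'e topology"
  base :: "'x topology"
  proj :: "'e \<Rightarrow> 'x"

definition etale_space :: "('e, 'x) etale \<Rightarrow> bool" where
  "etale_space A \<longleftrightarrow>
     local_homeomorphism (total A) (base A) (proj A) \<and>
     proj A ` topspace (total A) = topspace (base A)"

definition stalk :: "('e, 'x) etale \<Rightarrow> 'x \<Rightarrow> 'e set" where
  "stalk A x = {e \<in> topspace (total A). proj A e = x}"

definition is_section :: "('e, 'x) etale \<Rightarrow> 'x set \<Rightarrow> ('x \<Rightarrow> 'e) \<Rightarrow> bool" where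
  "is_section A U s \<longleftrightarrow>
     openin (base A) U \<and>
     continuous_map (subtopology (base A) U) (total A) s \<and>
     (\<forall>x \<in> U. proj A (s x) = x)"

text \<open>
  Note the direction: a cohomomorphism from \<open>B\<close> to \<open>A\<close> lies over a map from the base of
  \<open>A\<close> to the base of \<open>B\<close>.
\<close>

definition cohomomorphism ::
  "('e, 'x) etale \<Rightarrow> ('d, 'y) etale \<Rightarrow> ('y \<Rightarrow> 'x) \<Rightarrow> ('y \<Rightarrow> 'e \<Rightarrow> 'd) \<Rightarrow> bool" where
  "cohomomorphism B A f k \<longleftrightarrow>
     k \<in> (\<Pi>\<^sub>E x \<in> topspace (base A). stalk B (f x) \<rightarrow>\<^sub>E stalk A x) \<and>
     (\<forall>U s. is_section B U s \<longrightarrow>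
        is_section A {x \<in> topspace (base A). f x \<in> U} (\<lambda>x. k x (s (f x))))"

definition etale_hom ::
  "('e, 'x) etale \<Rightarrow> ('d, 'y) etale \<Rightarrow> (('y \<Rightarrow> 'x) \<times> ('y \<Rightarrow> 'e \<Rightarrow> 'd)) set" where
  "etale_hom B A =
     {(f, k). f \<in> extensional (topspace (base A)) \<and>
        continuous_proper_map (base A) (base B) f \<and> cohomomorphism B A f k}"

text \<open>
  As usual for large categories, the objects are restricted to a universe.  It is given by a
  type \<open>'u\<close>: a cardinality is small if it is smaller than that of \<open>'u\<close>.  The algebras are those
  with a small carrier contained in \<open>'u\<close>.  The size of a topological space is measured by its
  weight: the spaces are those with a small base and with points in \<open>'u set\<close>, a type
  large enough to contain a copy of every $T_0$ space with a small base.  (If the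
  cardinality of \<open>'u\<close> is a strong limit, in particular for a Grothendieck universe, a $T_0$
  space has a small base iff it has a small set of points.)  Every algebra and every etale
  space has an isomorphic copy in these categories once \<open>'u\<close> is chosen large enough.
\<close>

definition small_base :: "'u itself \<Rightarrow> 'x topology \<Rightarrow> bool" where
  "small_base _ X \<longleftrightarrow>
     (\<exists>\<B>. \<B> \<prec> (UNIV :: 'u set) \<and> openin X = arbitrary union_of (\<lambda>U. U \<in> \<B>))"

definition ESLCBS ::
  "(('u set, 'u set) etale,
    ('u set \<Rightarrow> 'u set) \<times> ('u set \<Rightarrow> 'u set \<Rightarrow> 'u set)) precategory" where
  "ESLCBS =
     \<lparr>Obj = {A. etale_space A \<and> locally_compact_boolean_space (base A) \<and>
               small_base TYPE('u) (total A) \<and> small_base TYPE('u) (base A)},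
      Hom = etale_hom,
      Idt = (\<lambda>A. (\<lambda>x \<in> topspace (base A). x,
                  \<lambda>x \<in> topspace (base A). \<lambda>a \<in> stalk A x. a)),
      Cmp = (\<lambda>B A C (e, l) (f, k).
               (compose (topspace (base C)) f e,
                \<lambda>w \<in> topspace (base C). compose (stalk B (f (e w))) (l w) (k (e w))))\<rparr>"

definition LSBA :: "('u skew_alg, 'u \<Rightarrow> 'u) precategory" where
  "LSBA =
     \<lparr>Obj = {S. left_handed_skew_boolean_algebra S \<and> carr S \<prec> (UNIV :: 'u set)},
      Hom = proper_skew_hom,
      Idt = (\<lambda>S. \<lambda>x \<in> carr S. x),
      Cmp = (\<lambda>S T R g f. compose (carr S) g f)\<rparr>"

end

theory Submission
  imports Defs
begin

text \<open>
  An etale space \<open>A\<close> over a locally compact Boolean space is sent to the algebra of its sections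
  over compact open sets: \<open>s \<and> t\<close> restricts \<open>s\<close> to the domain of \<open>t\<close>, and \<open>s \<or> t\<close>
  is \<open>t\<close> extended by \<open>s\<close>.  A cohomomorphism \<open>k\<close> over \<open>f\<close> pushes a section over \<open>U\<close> to
  one over the preimage of \<open>U\<close>.  This functor is fully faithful: given a proper homomorphism
  \<open>\<phi>\<close>, compactness yields for each \<open>x\<close> a unique point \<open>f x\<close> such that \<open>x\<close> lies in the domain of
  \<open>\<phi> s\<close> iff \<open>f x\<close> lies in the domain of \<open>s\<close>, and \<open>k\<close> maps the value of \<open>s\<close> at \<open>f x\<close> to the
  value of \<open>\<phi> s\<close> at \<open>x\<close>.  It is essentially surjective: an algebra is isomorphic to the
  sections of the etale space of germs of its elements at its ultrafilters.  The points of that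
  space are subsets of the algebra, so it lives in the prescribed universe; conversely a compact
  open set is a finite union of basic ones, so the section algebra is small.
\<close>

section \<open>Equivalences from fully faithful functors\<close>

text \<open>Sections are treated as open sets on which the projection is injective; functions on the
  base occur only in the translation between the two views. A cohomomorphism then acts by the map
  \<open>push\<close> on sets, which commutes with unions, and compact sections form a base of the
  total space, so that everything can be tested on them. In a section algebra the preorder \<preceq>
  compares only domains. Ultrafilters therefore see an element just up to D, and germs must recover
  the rest. The link between the two is that D-related elements lying below a common element in the
  natural order are equal. There is a mismatch of types: points of the spaces are in
  \<open>'u set\<close>, so the section algebra has its carrier in \<open>'u set set\<close>,
  whereas objects of \<open>LSBA\<close> have elements in \<open>'u\<close>. Full faithfulness is
  proved for the algebras of sets and then conjugated by injections into \<open>'u\<close>. That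
  such injections exist for every object is where the infinite universe is used.\<close>

locale fully_faithful_surjective_functor = category_functor C D F
  for C :: "('o, 'm) precategory" and D :: "('p, 'n) precategory"
    and F :: "('o, 'm, 'p, 'n) prefunctor" +
  assumes mmap_bij:
      "\<lbrakk>a \<in> Obj C; b \<in> Obj C\<rbrakk>
        \<Longrightarrow> bij_betw (mmap F a b) (Hom C a b) (Hom D (omap F a) (omap F b))"
    and surjective: "d \<in> Obj D \<Longrightarrow> \<exists>a \<in> Obj C. \<exists>h. iso_in D d (omap F a) h"
begin

definition lift :: "'o \<Rightarrow> 'o \<Rightarrow> 'n \<Rightarrow> 'm" where
  "lift a b h = inv_into (Hom C a b) (mmap F a b) h"

lemma lift:
  assumes "a \<in> Obj C" "b \<in> Obj C" "h \<in> Hom D (omap F a) (omap F b)"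
  shows "lift a b h \<in> Hom C a b" "mmap F a b (lift a b h) = h"
  using mmap_bij[OF assms(1,2)] assms(3) unfolding lift_def
  by (auto simp: bij_betw_def inv_into_into f_inv_into_f)

lemma faithful:
  assumes "a \<in> Obj C" "b \<in> Obj C" "f \<in> Hom C a b" "g \<in> Hom C a b"
    and "mmap F a b f = mmap F a b g"
  shows "f = g"
  using mmap_bij[OF assms(1,2)] assms(3-5) by (auto simp: bij_betw_def inj_on_def)

text \<open>Choice fixes for every \<open>d\<close> an object \<open>r d\<close> and mutually
  inverse maps \<open>\<delta> d\<close> and \<open>\<epsilon> d\<close> between \<open>d\<close>
  and the image of \<open>r d\<close>. The inverse functor conjugates a morphism by these and lifts
  the result along \<open>F\<close>; every equation in \<open>C\<close> is tested after applying
  \<open>F\<close>.\<close>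

theorem equivalent: "equivalent_categories C D"
proof -
  note dc = D.Cmp_in_Hom and da = D.Cmp_assoc
  have "\<forall>d. \<exists>a h h'. d \<in> Obj D \<longrightarrow> a \<in> Obj C \<and> h \<in> Hom D d (omap F a) \<and> h' \<in> Hom D (omap F a) d \<and>
      Cmp D d (omap F a) d h' h = Idt D d \<and>
      Cmp D (omap F a) d (omap F a) h h' = Idt D (omap F a)"
    using surjective unfolding iso_in_def by meson
  then obtain r \<delta> \<epsilon> where r0: "\<And>d. d \<in> Obj D \<longrightarrow> r d \<in> Obj C \<and> \<delta> d \<in> Hom D d (omap F (r d)) \<and>
      \<epsilon> d \<in> Hom D (omap F (r d)) d \<and>
      Cmp D d (omap F (r d)) d (\<epsilon> d) (\<delta> d) = Idt D d \<and>
      Cmp D (omap F (r d)) d (omap F (r d)) (\<delta> d) (\<epsilon> d) = Idt D (omap F (r d))"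
    by metis
  have r [simp]: "r d \<in> Obj C"
    and \<delta> [simp]: "\<delta> d \<in> Hom D d (omap F (r d))"
    and \<epsilon> [simp]: "\<epsilon> d \<in> Hom D (omap F (r d)) d"
    and \<epsilon>\<delta>: "Cmp D d (omap F (r d)) d (\<epsilon> d) (\<delta> d) = Idt D d"
    and \<delta>\<epsilon>: "Cmp D (omap F (r d)) d (omap F (r d)) (\<delta> d) (\<epsilon> d) = Idt D (omap F (r d))"
    if "d \<in> Obj D" for d
    using r0 that by auto
  have [simp]: "omap F a \<in> Obj D" if "a \<in> Obj C" for a using that omap_Obj by simp
  define conj where "conj d d' h =
    Cmp D (omap F (r d)) d' (omap F (r d')) (\<delta> d') (Cmp D (omap F (r d)) d d' h (\<epsilon> d))" for d d' h
  have conj [simp]: "conj d d' h \<in> Hom D (omap F (r d)) (omap F (r d'))"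
    if "d \<in> Obj D" "d' \<in> Obj D" "h \<in> Hom D d d'" for d d' h
    unfolding conj_def using that by (intro dc) auto
  have conj_Idt: "conj d d (Idt D d) = Idt D (omap F (r d))" if "d \<in> Obj D" for d
    unfolding conj_def using that by (simp add: D.Cmp_Idt_left \<delta>\<epsilon>)
  \<comment> \<open>This and \<open>conj_\<delta>\<close> are the naturality squares of the two
    families. The second also yields \<open>conj_Cmp\<close>, because \<open>conj d1 d2 k\<close>
    ends with \<open>\<delta> d2\<close>.\<close>
  have \<epsilon>_conj: "Cmp D (omap F (r d)) (omap F (r d')) d' (\<epsilon> d') (conj d d' h)
      = Cmp D (omap F (r d)) d d' h (\<epsilon> d)"
    if h: "d \<in> Obj D" "d' \<in> Obj D" "h \<in> Hom D d d'" for d d' h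
  proof -
    have 1: "Cmp D (omap F (r d)) d d' h (\<epsilon> d) \<in> Hom D (omap F (r d)) d'"
      using h by (intro dc) auto
    show ?thesis
      unfolding conj_def using h 1
      by (subst da[symmetric, where d = d']) (auto simp: \<epsilon>\<delta> D.Cmp_Idt_left)
  qed
  have conj_\<delta>: "Cmp D d (omap F (r d)) (omap F (r d')) (conj d d' h) (\<delta> d)
      = Cmp D d d' (omap F (r d')) (\<delta> d') h"
    if h: "d \<in> Obj D" "d' \<in> Obj D" "h \<in> Hom D d d'" for d d' h
  proof -
    have 1: "Cmp D (omap F (r d)) d d' h (\<epsilon> d) \<in> Hom D (omap F (r d)) d'"
      using h by (intro dc) auto
    have "Cmp D d (omap F (r d)) (omap F (r d')) (conj d d' h) (\<delta> d)
      = Cmp D d d' (omap F (r d')) (\<delta> d')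
          (Cmp D d (omap F (r d)) d' (Cmp D (omap F (r d)) d d' h (\<epsilon> d)) (\<delta> d))"
      unfolding conj_def using h 1 by (subst da) auto
    also have "Cmp D d (omap F (r d)) d' (Cmp D (omap F (r d)) d d' h (\<epsilon> d)) (\<delta> d) = h"
      using h by (subst da) (auto simp: \<epsilon>\<delta> D.Cmp_Idt_right)
    finally show ?thesis .
  qed
  have conj_Cmp: "conj d1 d3 (Cmp D d1 d2 d3 h k) =
      Cmp D (omap F (r d1)) (omap F (r d2)) (omap F (r d3)) (conj d2 d3 h) (conj d1 d2 k)"
    if h: "d1 \<in> Obj D" "d2 \<in> Obj D" "d3 \<in> Obj D" "k \<in> Hom D d1 d2" "h \<in> Hom D d2 d3"
    for d1 d2 d3 h k
  proof -
    have k1: "Cmp D (omap F (r d1)) d1 d2 k (\<epsilon> d1) \<in> Hom D (omap F (r d1)) d2"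
      using h by (intro dc) auto
    have "Cmp D (omap F (r d1)) (omap F (r d2)) (omap F (r d3)) (conj d2 d3 h) (conj d1 d2 k)
      = Cmp D (omap F (r d1)) d2 (omap F (r d3))
         (Cmp D d2 (omap F (r d2)) (omap F (r d3)) (conj d2 d3 h) (\<delta> d2))
         (Cmp D (omap F (r d1)) d1 d2 k (\<epsilon> d1))"
      using h k1 by (subst da) (auto simp: conj_def[of d1 d2 k])
    also have "\<dots> = Cmp D (omap F (r d1)) d3 (omap F (r d3)) (\<delta> d3)
         (Cmp D (omap F (r d1)) d2 d3 h (Cmp D (omap F (r d1)) d1 d2 k (\<epsilon> d1)))"
      using h k1 by (subst conj_\<delta>) (auto intro!: da)
    also have "Cmp D (omap F (r d1)) d2 d3 h (Cmp D (omap F (r d1)) d1 d2 k (\<epsilon> d1))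
      = Cmp D (omap F (r d1)) d1 d3 (Cmp D d1 d2 d3 h k) (\<epsilon> d1)"
      using h by (subst da) auto
    finally show ?thesis unfolding conj_def by simp
  qed
  define G where "G = \<lparr>omap = r, mmap = (\<lambda>d d' h. lift (r d) (r d') (conj d d' h))\<rparr>"
  have G [simp]: "omap G = r" "mmap G = (\<lambda>d d' h. lift (r d) (r d') (conj d d' h))"
    by (auto simp: G_def)
  have "category_functor D C G"
  proof (unfold_locales, goal_cases)
    case (1 d) then show ?case by simp
  next
    case (2 d d' h) then show ?case by (simp add: lift)
  next
    case (3 d)
    then show ?case
      by (intro faithful[of "r d" "r d"])
        (auto simp: lift conj_Idt mmap_Idt C.Idt_in_Hom D.Idt_in_Hom)
  next
    case (4 d1 d2 d3 k h)
    then have "Cmp D d1 d2 d3 h k \<in> Hom D d1 d3"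
      and "Cmp D (omap F (r d1)) (omap F (r d2)) (omap F (r d3)) (conj d2 d3 h) (conj d1 d2 k)
        \<in> Hom D (omap F (r d1)) (omap F (r d3))"
      by (auto intro!: dc)
    with 4 show ?case
      by (intro faithful[of "r d1" "r d3"])
        (auto simp: lift conj_Cmp mmap_Cmp intro!: C.Cmp_in_Hom dc)
  qed
  moreover have "natural_iso D D (comp_functor F G) id_functor \<epsilon>"
    unfolding natural_iso_def comp_functor_def id_functor_def iso_in_def
  proof (intro conjI ballI; simp add: lift \<epsilon>_conj)
    fix d assume "d \<in> Obj D"
    then show "\<exists>g\<in>Hom D d (omap F (r d)).
            Cmp D (omap F (r d)) d (omap F (r d)) g (\<epsilon> d) = Idt D (omap F (r d)) \<and>
            Cmp D d (omap F (r d)) d (\<epsilon> d) g = Idt D d"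
      by (intro bexI[of _ "\<delta> d"]) (auto simp: \<epsilon>\<delta> \<delta>\<epsilon>)
  qed
  \<comment> \<open>The unit at \<open>a\<close> is the lift of \<open>\<delta>\<close> at the image
    of \<open>a\<close>; the lift of \<open>\<epsilon>\<close> is its inverse.\<close>
  moreover have "natural_iso C C id_functor (comp_functor G F)
      (\<lambda>a. lift a (r (omap F a)) (\<delta> (omap F a)))"
    unfolding natural_iso_def comp_functor_def id_functor_def iso_in_def
  proof (intro conjI ballI; simp add: lift)
    fix a assume a: "a \<in> Obj C"
    let ?\<eta> = "lift a (r (omap F a)) (\<delta> (omap F a))"
    let ?\<theta> = "lift (r (omap F a)) a (\<epsilon> (omap F a))"
    have "?\<theta> \<in> Hom C (r (omap F a)) a" using a by (simp add: lift)
    moreover have "Cmp C a (r (omap F a)) a ?\<theta> ?\<eta> = Idt C a"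
      using a by (intro faithful[of a a])
        (auto simp: lift C.Idt_in_Hom mmap_Cmp mmap_Idt \<epsilon>\<delta> intro!: C.Cmp_in_Hom)
    moreover have "Cmp C (r (omap F a)) a (r (omap F a)) ?\<eta> ?\<theta> = Idt C (r (omap F a))"
      using a by (intro faithful[of "r (omap F a)" "r (omap F a)"])
        (auto simp: lift C.Idt_in_Hom mmap_Cmp mmap_Idt \<delta>\<epsilon> intro!: C.Cmp_in_Hom)
    ultimately show "\<exists>g\<in>Hom C (r (omap F a)) a.
            Cmp C a (r (omap F a)) a g ?\<eta> = Idt C a \<and>
            Cmp C (r (omap F a)) a (r (omap F a)) ?\<eta> g = Idt C (r (omap F a))"
      by blast
  next
    fix a b f
    assume f: "a \<in> Obj C" "b \<in> Obj C" "f \<in> Hom C a b"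
    then have [simp]: "mmap F a b f \<in> Hom D (omap F a) (omap F b)" by (simp add: mmap_Hom)
    show "Cmp C a b (r (omap F b)) (lift b (r (omap F b)) (\<delta> (omap F b))) f =
        Cmp C a (r (omap F a)) (r (omap F b))
          (lift (r (omap F a)) (r (omap F b)) (conj (omap F a) (omap F b) (mmap F a b f)))
          (lift a (r (omap F a)) (\<delta> (omap F a)))"
      using f by (intro faithful[of a "r (omap F b)"])
        (auto simp: lift mmap_Cmp conj_\<delta> intro!: C.Cmp_in_Hom)
  qed
  ultimately show ?thesis
    using category_functor_axioms unfolding equivalent_categories_def by blast
qed

end

section \<open>Left-handed skew Boolean algebras\<close>

context left_handed_skew_boolean_algebra
begin

abbreviation meet_syntax (infixl "\<sqinter>" 70) where "x \<sqinter> y \<equiv> meet S x y"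
abbreviation join_syntax (infixl "\<squnion>" 65) where "x \<squnion> y \<equiv> join S x y"
abbreviation diff_syntax (infixl "\<ominus>" 65) where "x \<ominus> y \<equiv> diff S x y"
abbreviation zero_syntax ("\<zero>") where "\<zero> \<equiv> zero S"

text \<open>The preorder whose induced equivalence relation is \<open>D_rel S\<close>.\<close>

abbreviation preceq (infix "\<preceq>" 50) where "x \<preceq> y \<equiv> meet S x y = x"

declare meet_closed [simp] join_closed [simp] zero_closed [simp]
  meet_idem [simp] join_idem [simp]

lemma diff_closed [simp]: "x \<in> carr S \<Longrightarrow> y \<in> carr S \<Longrightarrow> x \<ominus> y \<in> carr S"
  using diff_in_down_set by (auto simp: down_set_def)

lemma meet_zero [simp]: "x \<in> carr S \<Longrightarrow> x \<sqinter> \<zero> = \<zero>" "x \<in> carr S \<Longrightarrow> \<zero> \<sqinter> x = \<zero>"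
  using zero_meet by auto

lemma down_set_iff: "x \<in> down_set S z \<longleftrightarrow> x \<in> carr S \<and> x \<sqinter> z = x \<and> z \<sqinter> x = x"
  by (auto simp: down_set_def natural_le_def)

lemma down_set_commute:
  assumes "z \<in> carr S" "x \<in> down_set S z" "y \<in> down_set S z"
  shows "x \<sqinter> y = y \<sqinter> x" "x \<squnion> y = y \<squnion> x"
  using down_set_boolean[OF assms(1)] assms(2,3) unfolding boolean_lattice_on_def by blast+

lemma down_set_closed:
  assumes "z \<in> carr S" "x \<in> down_set S z" "y \<in> down_set S z"
  shows "x \<sqinter> y \<in> down_set S z" "x \<squnion> y \<in> down_set S z"
  using down_set_boolean[OF assms(1)] assms(2,3) unfolding boolean_lattice_on_def by blast+

lemma down_set_distrib:
  assumes "z \<in> carr S" "w \<in> down_set S z" "x \<in> down_set S z" "y \<in> down_set S z"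
  shows "w \<sqinter> (x \<squnion> y) = (w \<sqinter> x) \<squnion> (w \<sqinter> y)"
  using down_set_boolean[OF assms(1)] assms(2-4) unfolding boolean_lattice_on_def by blast

lemma meet_meet_same [simp]: "x \<in> carr S \<Longrightarrow> y \<in> carr S \<Longrightarrow> x \<sqinter> (x \<sqinter> y) = x \<sqinter> y"
  using meet_assoc[of x x y] by simp

text \<open>Left-handedness enters here: it supplies one half of the natural order, so every
  \<open>x \<sqinter> y\<close> lies in the Boolean lattice below \<open>x\<close>.\<close>

lemma meet_in_down_set: "x \<in> carr S \<Longrightarrow> y \<in> carr S \<Longrightarrow> x \<sqinter> y \<in> down_set S x"
  by (simp add: down_set_iff left_handed_meet)

text \<open>Both \<open>x \<sqinter> y\<close> and \<open>x \<sqinter> z\<close> lie below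
  \<open>x\<close>, where meets commute, and their two products are the two sides. This left
  normality takes the place of commutativity from here on.\<close>

lemma meet_right_commute:
  assumes "x \<in> carr S" "y \<in> carr S" "z \<in> carr S"
  shows "x \<sqinter> y \<sqinter> z = x \<sqinter> z \<sqinter> y"
proof -
  have "(x \<sqinter> y) \<sqinter> (x \<sqinter> z) = (x \<sqinter> z) \<sqinter> (x \<sqinter> y)"
    using assms by (intro down_set_commute[of x]) (auto intro: meet_in_down_set)
  moreover have "(x \<sqinter> y) \<sqinter> (x \<sqinter> z) = x \<sqinter> y \<sqinter> z"
    if "y \<in> carr S" "z \<in> carr S" for y z
    using that assms left_handed_meet[of x y] by (simp flip: meet_assoc)
  ultimately show ?thesis using assms by metis
qed

lemma meet_right_same [simp]: "x \<in> carr S \<Longrightarrow> y \<in> carr S \<Longrightarrow> x \<sqinter> y \<sqinter> y = x \<sqinter> y"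
  by (simp add: meet_assoc)

lemma meet_left_same [simp]: "x \<in> carr S \<Longrightarrow> y \<in> carr S \<Longrightarrow> x \<sqinter> (y \<sqinter> x) = x \<sqinter> y"
  by (metis left_handed_meet meet_assoc)

lemma join_left_same [simp]: "x \<in> carr S \<Longrightarrow> y \<in> carr S \<Longrightarrow> x \<squnion> (y \<squnion> x) = y \<squnion> x"
  by (metis left_handed_join join_assoc)

lemma preceq_trans:
  assumes "x \<preceq> y" "y \<preceq> z" "x \<in> carr S" "y \<in> carr S" "z \<in> carr S"
  shows "x \<preceq> z"
  using assms meet_assoc[of x y z] by simp

lemma meet_preceq1 [simp]: "x \<in> carr S \<Longrightarrow> y \<in> carr S \<Longrightarrow> x \<sqinter> y \<preceq> x"
  by (simp add: left_handed_meet)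

text \<open>Right commutation brings \<open>x'\<close> next to \<open>x\<close>. This is what makes
  the meet well defined on D-classes.\<close>

lemma meet_preceq_mono:
  assumes "x \<preceq> x'" "y \<preceq> y'" "x \<in> carr S" "y \<in> carr S" "x' \<in> carr S" "y' \<in> carr S"
  shows "x \<sqinter> y \<preceq> x' \<sqinter> y'"
proof -
  have "x \<sqinter> y \<sqinter> (x' \<sqinter> y') = x \<sqinter> x' \<sqinter> (y \<sqinter> y')"
    using assms(3-6) by (simp flip: meet_assoc add: meet_right_commute)
  then show ?thesis using assms by simp
qed

section \<open>The relation D and the order on its quotient\<close>

lemma D_rel_iff:
  "(x, y) \<in> D_rel S \<longleftrightarrow> x \<in> carr S \<and> y \<in> carr S \<and> x \<preceq> y \<and> y \<preceq> x"
  by (auto simp: D_rel_def left_handed_meet)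

lemma equiv_D_rel: "equiv (carr S) (D_rel S)"
proof (rule equivI)
  show "D_rel S \<subseteq> carr S \<times> carr S" "refl_on (carr S) (D_rel S)" "sym (D_rel S)"
    by (auto simp: D_rel_iff refl_on_def sym_def)
  show "trans (D_rel S)"
    by (rule transI) (use preceq_trans in \<open>auto simp: D_rel_iff\<close>)
qed

lemma meet_D_quotient:
  assumes "x \<in> carr S" "y \<in> carr S"
  shows "meet (D_quotient S) (D_rel S `` {x}) (D_rel S `` {y}) = D_rel S `` {x \<sqinter> y}"
proof -
  have "congruent2 (D_rel S) (D_rel S) (\<lambda>x y. D_rel S `` {x \<sqinter> y})"
    unfolding congruent2_def
    by (auto intro!: equiv_class_eq[OF equiv_D_rel] simp: D_rel_iff meet_preceq_mono)
  then show ?thesis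
    using UN_equiv_class2[OF equiv_D_rel equiv_D_rel, of "\<lambda>x y. D_rel S `` {x \<sqinter> y}" x y] assms
    by (simp add: D_quotient_def)
qed

text \<open>If \<open>x\<close> is D-related to \<open>x \<sqinter> y\<close>, then already
  \<open>x = x \<sqinter> y\<close>, since multiplying \<open>x \<sqinter> y\<close> by
  \<open>x\<close> on the left changes nothing. So properness, stated with classes, can be expressed
  by elements.\<close>

lemma natural_le_D_quotient_iff:
  assumes "x \<in> carr S" "y \<in> carr S"
  shows "natural_le (D_quotient S) (D_rel S `` {x}) (D_rel S `` {y}) \<longleftrightarrow> x \<preceq> y"
  using assms
  by (auto simp: natural_le_def meet_D_quotient eq_equiv_class_iff[OF equiv_D_rel]
      D_rel_iff meet_assoc)

section \<open>Joins and differences\<close>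

lemma preceq_join_eq: "x \<preceq> y \<Longrightarrow> x \<in> carr S \<Longrightarrow> y \<in> carr S \<Longrightarrow> x \<squnion> y = y"
  using absorb4[of y x] by simp

lemma join_eq_preceq: "x \<squnion> y = y \<Longrightarrow> x \<in> carr S \<Longrightarrow> y \<in> carr S \<Longrightarrow> x \<preceq> y"
  using absorb1[of x y] by simp

lemma preceq_join1: "x \<in> carr S \<Longrightarrow> y \<in> carr S \<Longrightarrow> x \<preceq> x \<squnion> y"
  by (rule absorb1)

lemma join_meet_right: "x \<in> carr S \<Longrightarrow> y \<in> carr S \<Longrightarrow> (x \<squnion> y) \<sqinter> y = y"
  by (rule absorb3)

lemma preceq_join2:
  assumes "x \<in> carr S" "y \<in> carr S"
  shows "y \<preceq> x \<squnion> y"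
  using meet_left_same[of y "x \<squnion> y"] assms by (simp add: join_meet_right)

lemma meet_eq_zero_commute:
  "x \<sqinter> y = \<zero> \<Longrightarrow> x \<in> carr S \<Longrightarrow> y \<in> carr S \<Longrightarrow> y \<sqinter> x = \<zero>"
  using meet_left_same[of y x] by simp

lemma diff_le:
  assumes "x \<in> carr S" "y \<in> carr S"
  shows "(x \<ominus> y) \<sqinter> x = x \<ominus> y" "x \<sqinter> (x \<ominus> y) = x \<ominus> y"
  using diff_in_down_set[OF assms] by (auto simp: down_set_iff)

lemma meet_join_diff:
  assumes "x \<in> carr S" "y \<in> carr S"
  shows "(x \<sqinter> y) \<squnion> (x \<ominus> y) = x"
  using diff_complement[OF assms] left_handed_meet[OF assms] by simp

lemma diff_meet:
  assumes "x \<in> carr S" "y \<in> carr S"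
  shows "(x \<ominus> y) \<sqinter> y = \<zero>" "y \<sqinter> (x \<ominus> y) = \<zero>"
proof -
  have "(x \<ominus> y) \<sqinter> y = (x \<ominus> y) \<sqinter> (x \<sqinter> y)"
    using assms diff_le[of x y] by (simp flip: meet_assoc)
  also have "\<dots> = (x \<sqinter> y) \<sqinter> (x \<ominus> y)"
    using assms by (intro down_set_commute) (auto intro: meet_in_down_set diff_in_down_set)
  also have "\<dots> = \<zero>"
    using diff_complement[OF assms] left_handed_meet[OF assms] by simp
  finally show "(x \<ominus> y) \<sqinter> y = \<zero>" .
  then show "y \<sqinter> (x \<ominus> y) = \<zero>" by (rule meet_eq_zero_commute) (use assms in auto)
qed

lemma diff_eq_zero_imp_preceq:
  assumes "x \<ominus> y = \<zero>" "x \<in> carr S" "y \<in> carr S"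
  shows "x \<preceq> y"
  using meet_join_diff[OF assms(2,3)] absorb2[of "x \<sqinter> y" \<zero>] assms by simp

text \<open>Multiplying by \<open>q\<close> reduces this to distributivity in the Boolean algebra below \<open>x\<close>.\<close>

lemma preceq_diff:
  assumes "q \<preceq> x" "q \<sqinter> y = \<zero>" and [simp]: "q \<in> carr S" "x \<in> carr S" "y \<in> carr S"
  shows "q \<preceq> x \<ominus> y"
proof -
  have "x \<sqinter> q = (x \<sqinter> q) \<sqinter> ((x \<sqinter> y) \<squnion> (x \<ominus> y))"
    by (simp add: meet_join_diff left_handed_meet)
  also have "\<dots> = ((x \<sqinter> q) \<sqinter> (x \<sqinter> y)) \<squnion> ((x \<sqinter> q) \<sqinter> (x \<ominus> y))"
    by (rule down_set_distrib[of x]) (auto intro: meet_in_down_set diff_in_down_set)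
  also have "(x \<sqinter> q) \<sqinter> (x \<sqinter> y) = \<zero>"
    using assms(2) left_handed_meet[of x q]
    by (simp flip: meet_assoc) (simp add: meet_assoc)
  also have "\<zero> \<squnion> ((x \<sqinter> q) \<sqinter> (x \<ominus> y)) = (x \<sqinter> q) \<sqinter> (x \<ominus> y)"
    by (rule preceq_join_eq) auto
  finally have "q \<sqinter> (x \<sqinter> q) = q \<sqinter> ((x \<sqinter> q) \<sqinter> (x \<ominus> y))" by simp
  then show ?thesis using assms(1) by (simp flip: meet_assoc)
qed

text \<open>With \<open>z = x \<squnion> y\<close>, the element \<open>y\<close> is below
  \<open>z\<close> in the natural order, but \<open>x\<close> only satisfies
  \<open>x \<preceq> z\<close>. Replacing \<open>x\<close> by \<open>z \<sqinter> x\<close> keeps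
  its D-class and puts both parts into the Boolean lattice below \<open>z\<close>, where
  distributivity is available.\<close>

lemma preceq_join_cases:
  assumes "u \<preceq> x \<squnion> y" "u \<sqinter> x = \<zero>" and [simp]: "u \<in> carr S" "x \<in> carr S" "y \<in> carr S"
  shows "u \<preceq> y"
proof -
  define z where "z = x \<squnion> y"
  have [simp]: "z \<in> carr S" by (simp add: z_def)
  have zy: "z \<sqinter> y = y" by (simp add: z_def join_meet_right)
  have xz: "x \<sqinter> z = x" by (simp add: z_def preceq_join1)
  have down: "z \<sqinter> u \<in> down_set S z" "z \<sqinter> x \<in> down_set S z" "y \<in> down_set S z"
    using meet_in_down_set[of z u] meet_in_down_set[of z x] meet_in_down_set[of z y] zy by auto
  define w where "w = (z \<sqinter> x) \<squnion> y"
  have w: "w \<in> down_set S z" unfolding w_def using down by (intro down_set_closed(2)) auto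
  then have [simp]: "w \<in> carr S" by (simp add: down_set_iff)
  \<comment> \<open>The aim is \<open>z = w\<close>: \<open>w\<close> absorbs both \<open>x\<close>
    and \<open>y\<close> from the left, so \<open>z \<preceq> w\<close>, while \<open>w\<close> lies
    below \<open>z\<close>.\<close>
  have "z \<squnion> w = x \<squnion> (y \<squnion> w)" by (simp add: z_def join_assoc)
  also have "y \<squnion> w = w" unfolding w_def by (intro preceq_join_eq preceq_join2) auto
  also have "x \<squnion> w = x \<squnion> (z \<sqinter> x) \<squnion> y" by (simp add: w_def join_assoc)
  also have "x \<squnion> (z \<sqinter> x) = z \<sqinter> x"
    using xz by (intro preceq_join_eq) (auto simp flip: meet_assoc)
  finally have "z \<squnion> w = w" by (simp add: w_def)
  then have "z \<preceq> w" by (intro join_eq_preceq) auto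
  then have "z = w" using w by (simp add: down_set_iff)
  then have "z \<sqinter> u = (z \<sqinter> u) \<sqinter> ((z \<sqinter> x) \<squnion> y)"
    unfolding w_def using left_handed_meet[of z u] by simp
  also have "\<dots> = ((z \<sqinter> u) \<sqinter> (z \<sqinter> x)) \<squnion> ((z \<sqinter> u) \<sqinter> y)"
    by (rule down_set_distrib[of z]) (use down in auto)
  also have "(z \<sqinter> u) \<sqinter> (z \<sqinter> x) = \<zero>"
    using assms(2) left_handed_meet[of z u]
    by (simp flip: meet_assoc) (simp add: meet_assoc)
  also have "\<zero> \<squnion> ((z \<sqinter> u) \<sqinter> y) = (z \<sqinter> u) \<sqinter> y"
    by (rule preceq_join_eq) auto
  \<comment> \<open>Multiplying by \<open>u\<close> on the left turns \<open>z \<sqinter> u\<close>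
    into \<open>u\<close>, because \<open>u \<preceq> z\<close>.\<close>
  finally have "u \<sqinter> (z \<sqinter> u) = u \<sqinter> ((z \<sqinter> u) \<sqinter> y)" by simp
  then show ?thesis using assms(1) by (simp flip: meet_assoc z_def)
qed

end

section \<open>Homomorphisms and the category of algebras\<close>

lemma skew_homD:
  assumes "f \<in> skew_hom S T"
  shows "x \<in> carr S \<Longrightarrow> f x \<in> carr T"
    and "x \<in> carr S \<Longrightarrow> y \<in> carr S \<Longrightarrow> f (meet S x y) = meet T (f x) (f y)"
    and "x \<in> carr S \<Longrightarrow> y \<in> carr S \<Longrightarrow> f (join S x y) = join T (f x) (f y)"
    and "x \<in> carr S \<Longrightarrow> y \<in> carr S \<Longrightarrow> f (diff S x y) = diff T (f x) (f y)"
    and "f (zero S) = zero T"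
    and "f \<in> extensional (carr S)"
  using assms by (auto simp: skew_hom_def PiE_def)

lemma carr_D_quotient: "carr (D_quotient S) = (\<lambda>x. D_rel S `` {x}) ` carr S"
  by (auto simp: D_quotient_def quotient_def)

text \<open>The induced map sends the class of \<open>b\<close> to the class of \<open>f b\<close>,
  and the order of classes is \<preceq> on representatives.\<close>

lemma proper_skew_hom_iff:
  assumes "left_handed_skew_boolean_algebra S" "left_handed_skew_boolean_algebra T"
  shows "f \<in> proper_skew_hom S T \<longleftrightarrow>
    f \<in> skew_hom S T \<and> (\<forall>c \<in> carr T. \<exists>b \<in> carr S. meet T c (f b) = c)"
proof -
  interpret S: left_handed_skew_boolean_algebra S by fact
  interpret T: left_handed_skew_boolean_algebra T by fact
  have "proper_gba_hom (D_quotient S) (D_quotient T) (D_induced T f) \<longleftrightarrow>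
      (\<forall>c \<in> carr T. \<exists>b \<in> carr S. meet T c (f b) = c)" if f: "f \<in> skew_hom S T"
  proof -
    note h = skew_homD[OF f]
    have ind: "D_induced T f (D_rel S `` {b}) = D_rel T `` {f b}" if b: "b \<in> carr S" for b
    proof -
      have "D_rel T `` {f x} = D_rel T `` {f b}" if "x \<in> D_rel S `` {b}" for x
      proof (rule equiv_class_eq[OF T.equiv_D_rel])
        have "b \<in> carr S" "x \<in> carr S" "f (meet S b x) = f b" "f (meet S x b) = f x"
          using that by (auto simp: S.D_rel_iff)
        then show "(f x, f b) \<in> D_rel T" by (auto simp: T.D_rel_iff h)
      qed
      moreover have "b \<in> D_rel S `` {b}" using b by (simp add: S.D_rel_iff)
      ultimately show ?thesis unfolding D_induced_def by blast
    qed
    show ?thesis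
      by (simp add: proper_gba_hom_def carr_D_quotient ind h T.natural_le_D_quotient_iff)
  qed
  then show ?thesis by (auto simp: proper_skew_hom_def)
qed

lemma compose_skew_hom:
  assumes S: "left_handed_skew_boolean_algebra S"
    and f: "f \<in> skew_hom S T" and g: "g \<in> skew_hom T R"
  shows "compose (carr S) g f \<in> skew_hom S R"
proof -
  interpret S: left_handed_skew_boolean_algebra S by fact
  show ?thesis
    using skew_homD[OF f] skew_homD[OF g] by (auto simp: skew_hom_def compose_def)
qed

lemma compose_proper_skew_hom:
  assumes S: "left_handed_skew_boolean_algebra S" and T: "left_handed_skew_boolean_algebra T"
    and R: "left_handed_skew_boolean_algebra R"
    and f: "f \<in> proper_skew_hom S T" and g: "g \<in> proper_skew_hom T R"
  shows "compose (carr S) g f \<in> proper_skew_hom S R"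
proof -
  interpret R: left_handed_skew_boolean_algebra R by fact
  have f': "f \<in> skew_hom S T" "\<forall>c \<in> carr T. \<exists>b \<in> carr S. meet T c (f b) = c"
    using f by (auto simp: proper_skew_hom_iff[OF S T])
  have g': "g \<in> skew_hom T R" "\<forall>c \<in> carr R. \<exists>b \<in> carr T. meet R c (g b) = c"
    using g by (auto simp: proper_skew_hom_iff[OF T R])
  note hf = skew_homD[OF f'(1)] and hg = skew_homD[OF g'(1)]
  have "\<exists>b \<in> carr S. meet R c (compose (carr S) g f b) = c" if c: "c \<in> carr R" for c
  proof -
    obtain t where t: "t \<in> carr T" "meet R c (g t) = c" using g' c by blast
    obtain s where s: "s \<in> carr S" "meet T t (f s) = t" using f' t by blast
    have "meet R (g t) (g (f s)) = g t" using s t hf hg by metis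
    then have "meet R c (g (f s)) = c"
      using R.preceq_trans[of c "g t" "g (f s)"] s t c hf hg by simp
    then show ?thesis using s by (auto simp: compose_def)
  qed
  then show ?thesis
    using compose_skew_hom[OF S f'(1) g'(1)] by (simp add: proper_skew_hom_iff[OF S R])
qed

lemma surj_imp_proper_skew_hom:
  assumes "left_handed_skew_boolean_algebra S" "left_handed_skew_boolean_algebra T"
    and "f \<in> skew_hom S T" "f ` carr S = carr T"
  shows "f \<in> proper_skew_hom S T"
proof -
  interpret T: left_handed_skew_boolean_algebra T by fact
  have "\<exists>b \<in> carr S. meet T c (f b) = c" if c: "c \<in> carr T" for c
  proof -
    obtain b where "b \<in> carr S" "c = f b" using c assms(4) by blast
    then show ?thesis using c by (intro bexI[of _ b]) auto
  qed
  then show ?thesis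
    using assms by (simp add: proper_skew_hom_iff)
qed

lemma inv_skew_hom:
  assumes S: "left_handed_skew_boolean_algebra S"
    and f: "f \<in> skew_hom S T" and bij: "bij_betw f (carr S) (carr T)"
  shows "restrict (inv_into (carr S) f) (carr T) \<in> skew_hom T S"
proof -
  interpret S: left_handed_skew_boolean_algebra S by fact
  note h = skew_homD[OF f]
  let ?g = "inv_into (carr S) f"
  have inv: "?g (f x) = x" if "x \<in> carr S" for x
    using bij that by (simp add: bij_betw_def)
  have surj: "\<exists>y \<in> carr S. x = f y" if "x \<in> carr T" for x
    using bij that by (auto simp: bij_betw_def)
  have ops: "?g (meet T (f x) (f y)) = meet S x y \<and> ?g (join T (f x) (f y)) = join S x y
      \<and> ?g (diff T (f x) (f y)) = diff S x y
      \<and> meet T (f x) (f y) \<in> carr T \<and> join T (f x) (f y) \<in> carr T \<and> diff T (f x) (f y) \<in> carr T"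
    if "x \<in> carr S" "y \<in> carr S" for x y
    using that h(1) by (simp flip: h(2-4) add: inv)
  have "?g (zero T) = zero S" "zero T \<in> carr T"
    using h(1) by (simp_all flip: h(5) add: inv)
  moreover have "restrict ?g (carr T) \<in> carr T \<rightarrow>\<^sub>E carr S"
    using surj inv by (force simp: PiE_iff)
  moreover have "?g (meet T x y) = meet S (?g x) (?g y) \<and> ?g (join T x y) = join S (?g x) (?g y) \<and>
      ?g (diff T x y) = diff S (?g x) (?g y) \<and>
      meet T x y \<in> carr T \<and> join T x y \<in> carr T \<and> diff T x y \<in> carr T"
    if xy: "x \<in> carr T" "y \<in> carr T" for x y
  proof -
    obtain a b where "a \<in> carr S" "b \<in> carr S" "x = f a" "y = f b"
      using surj xy by blast
    then show ?thesis using ops[of a b] inv by simp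
  qed
  ultimately show ?thesis by (simp add: skew_hom_def)
qed

lemma LSBA_simps [simp]:
  "Obj (LSBA :: ('u skew_alg, 'u \<Rightarrow> 'u) precategory)
    = {S. left_handed_skew_boolean_algebra S \<and> carr S \<prec> (UNIV :: 'u set)}"
  "Hom LSBA = proper_skew_hom" "Idt LSBA = (\<lambda>S. \<lambda>x \<in> carr S. x)"
  "Cmp LSBA = (\<lambda>S T R g f. compose (carr S) g f)"
  by (simp_all add: LSBA_def)

lemma id_proper_skew_hom:
  assumes "left_handed_skew_boolean_algebra S"
  shows "(\<lambda>x \<in> carr S. x) \<in> proper_skew_hom S S"
proof -
  interpret S: left_handed_skew_boolean_algebra S by fact
  show ?thesis
    using assms by (intro surj_imp_proper_skew_hom) (auto simp: skew_hom_def)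
qed

lemma skew_hom_funcset: "f \<in> proper_skew_hom S T \<Longrightarrow> f \<in> carr S \<rightarrow>\<^sub>E carr T"
  by (auto simp: proper_skew_hom_def skew_hom_def)

lemma category_LSBA: "category (LSBA :: ('u skew_alg, 'u \<Rightarrow> 'u) precategory)"
proof (unfold_locales, goal_cases)
  case (1 a)
  then show ?case by (simp add: id_proper_skew_hom)
next
  case (2 a b c f g)
  then show ?case using compose_proper_skew_hom[of a b c] by simp
next
  case (3 a b f)
  then have "f \<in> carr a \<rightarrow>\<^sub>E carr b" by (simp add: skew_hom_funcset)
  then show ?case by (auto simp: compose_def fun_eq_iff PiE_def extensional_def)
next
  case (4 a b f)
  then have "f \<in> carr a \<rightarrow>\<^sub>E carr b" by (simp add: skew_hom_funcset)
  then show ?case by (auto simp: compose_def fun_eq_iff PiE_def extensional_def)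
next
  case (5 a b c d f g h)
  then have "f \<in> carr a \<rightarrow>\<^sub>E carr b" by (simp add: skew_hom_funcset)
  then show ?case by (auto simp: compose_def fun_eq_iff PiE_def)
qed

section \<open>Transport of an algebra along an injection\<close>

definition transport :: "('a \<Rightarrow> 'b) \<Rightarrow> 'a skew_alg \<Rightarrow> 'b skew_alg" where
  "transport \<iota> S = (let \<kappa> = inv_into (carr S) \<iota> in
     \<lparr>carr = \<iota> ` carr S,
      meet = (\<lambda>x y. \<iota> (meet S (\<kappa> x) (\<kappa> y))),
      join = (\<lambda>x y. \<iota> (join S (\<kappa> x) (\<kappa> y))),
      diff = (\<lambda>x y. \<iota> (diff S (\<kappa> x) (\<kappa> y))),
      zero = \<iota> (zero S)\<rparr>)"

text \<open>It serves to move section algebras, whose elements are sets of points, into the universe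
  type of the objects of \<open>LSBA\<close>.\<close>

locale transported_algebra = left_handed_skew_boolean_algebra S for S :: "'a skew_alg" +
  fixes \<iota> :: "'a \<Rightarrow> 'b"
  assumes inj: "inj_on \<iota> (carr S)"
begin

abbreviation "T \<equiv> transport \<iota> S"

lemma T_simps [simp]:
  "carr T = \<iota> ` carr S"
  "x \<in> carr S \<Longrightarrow> y \<in> carr S \<Longrightarrow> meet T (\<iota> x) (\<iota> y) = \<iota> (x \<sqinter> y)"
  "x \<in> carr S \<Longrightarrow> y \<in> carr S \<Longrightarrow> join T (\<iota> x) (\<iota> y) = \<iota> (x \<squnion> y)"
  "x \<in> carr S \<Longrightarrow> y \<in> carr S \<Longrightarrow> diff T (\<iota> x) (\<iota> y) = \<iota> (x \<ominus> y)"
  "zero T = \<iota> \<zero>"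
  using inj by (auto simp: transport_def Let_def)

lemma inj_iff [simp]: "x \<in> carr S \<Longrightarrow> y \<in> carr S \<Longrightarrow> \<iota> x = \<iota> y \<longleftrightarrow> x = y"
  using inj by (auto simp: inj_on_def)

lemma down_set_T: "x \<in> carr S \<Longrightarrow> down_set T (\<iota> x) = \<iota> ` down_set S x"
  by (auto simp: down_set_def natural_le_def image_iff)

lemma boolean_lattice_on_T:
  assumes x: "x \<in> carr S"
  shows "boolean_lattice_on (\<iota> ` down_set S x) (meet T) (join T) (\<iota> \<zero>) (\<iota> x)"
proof -
  have u: "u \<in> carr S" if "u \<in> down_set S x" for u using that by (auto simp: down_set_def)
  have mem: "\<iota> u \<in> \<iota> ` down_set S x \<longleftrightarrow> u \<in> down_set S x" if "u \<in> carr S" for u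
    using that u by force
  \<comment> \<open>Bounded quantifiers over the image are pulled back to
    \<open>down_set S x\<close>; each clause then becomes the corresponding clause for
    \<open>S\<close>.\<close>
  have "?thesis \<longleftrightarrow> boolean_lattice_on (down_set S x) (meet S) (join S) \<zero> x"
    unfolding boolean_lattice_on_def ball_simps bex_simps
    by (simp add: mem u x cong: ball_cong bex_cong)
  then show ?thesis using down_set_boolean[OF x] by simp
qed

lemma left_handed_skew_boolean_algebra_T: "left_handed_skew_boolean_algebra T"
  by unfold_locales
    (auto simp: meet_assoc join_assoc absorb1 absorb2 absorb3 absorb4 symmetric
      diff_meet meet_join_diff down_set_T diff_in_down_set boolean_lattice_on_T)

lemma transport_hom: "restrict \<iota> (carr S) \<in> skew_hom S T"
  by (auto simp: skew_hom_def)

lemma transport_bij: "bij_betw (restrict \<iota> (carr S)) (carr S) (carr T)"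
  using inj by (auto simp: bij_betw_def)

end

section \<open>Compact open sections of an etale space\<close>

text \<open>These are exactly the images of continuous sections over open sets, by
  \<open>is_section_imp_open_section\<close> and \<open>open_section_imp_is_section\<close>. Images,
  unlike functions, carry no arbitrary values outside the domain.\<close>

definition open_section :: "('e, 'x) etale \<Rightarrow> 'e set \<Rightarrow> bool" where
  "open_section A W \<longleftrightarrow> openin (total A) W \<and> inj_on (proj A) W"

definition compact_section :: "('e, 'x) etale \<Rightarrow> 'e set \<Rightarrow> bool" where
  "compact_section A W \<longleftrightarrow> openin (total A) W \<and> compactin (total A) W \<and> inj_on (proj A) W"

text \<open>A section over a compact open set is identified with its image.\<close>

definition section_algebra :: "('e, 'x) etale \<Rightarrow> 'e set skew_alg" where
  "section_algebra A =
     \<lparr>carr = {W. compact_section A W},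
      meet = (\<lambda>V W. {e \<in> V. proj A e \<in> proj A ` W}),
      join = (\<lambda>V W. W \<union> {e \<in> V. proj A e \<notin> proj A ` W}),
      diff = (\<lambda>V W. {e \<in> V. proj A e \<notin> proj A ` W}),
      zero = {}\<rparr>"

lemma section_algebra_simps [simp]:
  "W \<in> carr (section_algebra A) \<longleftrightarrow> compact_section A W"
  "meet (section_algebra A) V W = {e \<in> V. proj A e \<in> proj A ` W}"
  "join (section_algebra A) V W = W \<union> {e \<in> V. proj A e \<notin> proj A ` W}"
  "diff (section_algebra A) V W = {e \<in> V. proj A e \<notin> proj A ` W}"
  "zero (section_algebra A) = {}"
  by (simp_all add: section_algebra_def)

lemma image_section_meet: "p ` {e \<in> V. p e \<in> p ` W} = p ` V \<inter> p ` W"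
  by auto

lemma image_section_diff: "p ` {e \<in> V. p e \<notin> p ` W} = p ` V - p ` W"
  by auto

lemma image_section_join: "p ` (W \<union> {e \<in> V. p e \<notin> p ` W}) = p ` V \<union> p ` W"
  by auto

lemmas image_section = image_section_meet image_section_diff image_section_join

text \<open>Whether a point of the union belongs to \<open>W\<close> can be read off from its
  projection, so two points with the same projection come from the same piece.\<close>

lemma inj_on_section_join:
  assumes V: "inj_on p V" and W: "inj_on p W"
  shows "inj_on p (W \<union> {e \<in> V. p e \<notin> p ` W})"
proof (rule inj_onI)
  fix x y
  assume x: "x \<in> W \<union> {e \<in> V. p e \<notin> p ` W}" and y: "y \<in> W \<union> {e \<in> V. p e \<notin> p ` W}"
    and eq: "p x = p y"
  have "x \<in> W \<longleftrightarrow> p x \<in> p ` W" "y \<in> W \<longleftrightarrow> p y \<in> p ` W" using x y by blast+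
  then show "x = y" using x y eq inj_onD[OF V eq] inj_onD[OF W eq] by auto
qed

lemma compact_section_empty [simp]: "compact_section A {}"
  by (simp add: compact_section_def)

section \<open>Continuous sections as open sets\<close>

locale etale =
  fixes A :: "('e, 'x) etale"
  assumes etale: "etale_space A"
begin

lemma proj_continuous: "continuous_map (total A) (base A) (proj A)"
  using etale by (simp add: etale_space_def local_homeomorphism_def)

lemma proj_surj: "proj A ` topspace (total A) = topspace (base A)"
  using etale by (simp add: etale_space_def)

lemma section_nbhd:
  assumes "e \<in> topspace (total A)"
  obtains N where "open_section A N" "e \<in> N"
    "\<And>V. openin (total A) V \<Longrightarrow> V \<subseteq> N \<Longrightarrow> openin (base A) (proj A ` V)"
proof -
  obtain N where N: "openin (total A) N" "e \<in> N" "openin (base A) (proj A ` N)"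
      "homeomorphic_map (subtopology (total A) N) (subtopology (base A) (proj A ` N)) (proj A)"
    using etale assms unfolding etale_space_def local_homeomorphism_def by blast
  have sub: "N \<subseteq> topspace (total A)" using N openin_subset by blast
  then have inj: "inj_on (proj A) N"
    using homeomorphic_imp_injective_map[OF N(4)] by (simp add: inf.absorb2)
  have "openin (base A) (proj A ` V)" if V: "openin (total A) V" "V \<subseteq> N" for V
  proof -
    have "openin (subtopology (total A) N) V"
      using V N(1) by (simp add: openin_open_subtopology)
    then have "openin (subtopology (base A) (proj A ` N)) (proj A ` V)"
      using homeomorphic_imp_open_map[OF N(4)] unfolding open_map_def by blast
    then show ?thesis using N(3) by (simp add: openin_open_subtopology)
  qed
  then show thesis using that N inj by (auto simp: open_section_def)
qed

lemma open_image:
  assumes U: "openin (total A) U"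
  shows "openin (base A) (proj A ` U)"
proof (subst openin_subopen, intro ballI)
  fix x assume "x \<in> proj A ` U"
  then obtain e where e: "e \<in> U" "x = proj A e" by auto
  then obtain N where N: "open_section A N" "e \<in> N"
    "\<And>V. openin (total A) V \<Longrightarrow> V \<subseteq> N \<Longrightarrow> openin (base A) (proj A ` V)"
    using section_nbhd U openin_subset by (metis subsetD)
  then have "openin (base A) (proj A ` (N \<inter> U))"
    using U by (intro N(3)) (auto simp: open_section_def)
  then show "\<exists>T. openin (base A) T \<and> x \<in> T \<and> T \<subseteq> proj A ` U"
    using e N(2) by blast
qed

lemma openin_vimage:
  "openin (base A) U \<Longrightarrow> openin (total A) {e \<in> topspace (total A). proj A e \<in> U}"
  using proj_continuous by (simp add: continuous_map)

lemma closedin_vimage: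
  "closedin (base A) U \<Longrightarrow> closedin (total A) {e \<in> topspace (total A). proj A e \<in> U}"
  using proj_continuous closedin_continuous_map_preimage by blast

text \<open>Around \<open>s x\<close> take a sheet \<open>N\<close>. For a point \<open>e'\<close>
  of \<open>N\<close> over a base point that \<open>s\<close> sends into \<open>N\<close>, both
  \<open>e'\<close> and \<open>s (proj A e')\<close> lie in \<open>N\<close> with the same
  projection, so they coincide. This open part of \<open>N\<close> is thus contained in the
  image.\<close>

lemma is_section_imp_open_section:
  assumes s: "is_section A U s"
  shows "open_section A (s ` U)"
proof -
  have U: "openin (base A) U" "U \<subseteq> topspace (base A)"
    and cont: "continuous_map (subtopology (base A) U) (total A) s"
    and ps: "\<And>x. x \<in> U \<Longrightarrow> proj A (s x) = x"
    using s openin_subset by (auto simp: is_section_def)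
  have "openin (total A) (s ` U)"
  proof (subst openin_subopen, intro ballI)
    fix e assume "e \<in> s ` U"
    then obtain x where x: "x \<in> U" "e = s x" by auto
    then have "e \<in> topspace (total A)"
      using cont U by (auto simp: continuous_map_def)
    then obtain N where N: "openin (total A) N" "inj_on (proj A) N" "e \<in> N"
      by (rule section_nbhd) (auto simp: open_section_def)
    have "openin (subtopology (base A) U) {x \<in> topspace (subtopology (base A) U). s x \<in> N}"
      using cont N(1) by (simp add: continuous_map)
    then have "openin (base A) {x \<in> U. s x \<in> N}"
      using U by (simp add: openin_open_subtopology inf.absorb2)
    then have "openin (total A) (N \<inter> {e \<in> topspace (total A). proj A e \<in> {x \<in> U. s x \<in> N}})"
      using N(1) openin_vimage by blast
    moreover have "N \<inter> {e \<in> topspace (total A). proj A e \<in> {x \<in> U. s x \<in> N}} \<subseteq> s ` U"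
    proof clarify
      fix e' assume e': "e' \<in> N" "proj A e' \<in> U" "s (proj A e') \<in> N"
      then have "s (proj A e') = e'" using N(2) ps by (auto simp: inj_on_def)
      then show "e' \<in> s ` U" using e'(2) by (metis imageI)
    qed
    moreover have "e \<in> N \<inter> {e \<in> topspace (total A). proj A e \<in> {x \<in> U. s x \<in> N}}"
      using x N(3) ps \<open>e \<in> topspace (total A)\<close> by simp
    ultimately show "\<exists>T. openin (total A) T \<and> e \<in> T \<and> T \<subseteq> s ` U"
      by blast
  qed
  moreover have "inj_on (proj A) (s ` U)" using ps by (auto simp: inj_on_def)
  ultimately show ?thesis by (simp add: open_section_def)
qed

text \<open>Continuity comes from openness of the projection: the preimage of \<open>T\<close> is
  the projection of the part of the image of \<open>s\<close> lying in \<open>T\<close>.\<close>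

lemma is_sectionI:
  assumes U: "openin (base A) U" and W: "openin (total A) (s ` U)"
    and ps: "\<And>x. x \<in> U \<Longrightarrow> proj A (s x) = x"
  shows "is_section A U s"
proof -
  have sub: "U \<subseteq> topspace (base A)" using U openin_subset by blast
  have "openin (base A) {x \<in> U. s x \<in> T}" if T: "openin (total A) T" for T
  proof -
    have "{x \<in> U. s x \<in> T} = proj A ` (s ` U \<inter> T)" using ps by force
    then show ?thesis by (simp add: open_image openin_Int W T)
  qed
  then have "continuous_map (subtopology (base A) U) (total A) s"
    using U sub openin_subset[OF W]
    by (auto simp: continuous_map openin_open_subtopology inf.absorb2)
  then show ?thesis using assms by (simp add: is_section_def)
qed

lemma open_section_imp_is_section:
  assumes "open_section A W"
  shows "is_section A (proj A ` W) (inv_into W (proj A))"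
proof (rule is_sectionI)
  show "openin (base A) (proj A ` W)" using assms open_image by (simp add: open_section_def)
  have "inv_into W (proj A) ` proj A ` W = W"
    using assms by (simp add: open_section_def inv_into_image_cancel)
  then show "openin (total A) (inv_into W (proj A) ` proj A ` W)"
    using assms by (simp add: open_section_def)
qed (simp add: f_inv_into_f)

text \<open>The continuous section inverse to the projection carries a compact domain back onto
  \<open>W\<close>.\<close>

lemma compactin_open_section_iff:
  assumes W: "open_section A W"
  shows "compactin (total A) W \<longleftrightarrow> compactin (base A) (proj A ` W)"
proof
  assume "compactin (total A) W"
  then show "compactin (base A) (proj A ` W)"
    using proj_continuous by (rule image_compactin)
next
  assume K: "compactin (base A) (proj A ` W)"
  have "continuous_map (subtopology (base A) (proj A ` W)) (total A) (inv_into W (proj A))"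
    using open_section_imp_is_section[OF W] by (simp add: is_section_def)
  moreover have "compactin (subtopology (base A) (proj A ` W)) (proj A ` W)"
    using K by (simp add: compactin_subtopology)
  ultimately have "compactin (total A) (inv_into W (proj A) ` proj A ` W)"
    using image_compactin by blast
  then show "compactin (total A) W"
    using W by (simp add: open_section_def inv_into_image_cancel)
qed

lemma compact_section_iff:
  "compact_section A W \<longleftrightarrow> open_section A W \<and> compactin (base A) (proj A ` W)"
  using compactin_open_section_iff[of W] by (auto simp: compact_section_def open_section_def)

lemma compact_section_subset: "compact_section A W \<Longrightarrow> W \<subseteq> topspace (total A)"
  by (auto simp: compact_section_def dest: openin_subset)

end

text \<open>A clopen set inside a compact neighbourhood is a closed subset of a compact set, hence
  compact.\<close>

lemma locally_compact_boolean_space_nbhd: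
  assumes X: "locally_compact_boolean_space X" and U: "openin X U" "x \<in> U"
  obtains V where "openin X V" "compactin X V" "x \<in> V" "V \<subseteq> U"
proof -
  have "x \<in> topspace X" using U openin_subset by blast
  then obtain O' K where K: "openin X O'" "compactin X K" "x \<in> O'" "O' \<subseteq> K"
    using X unfolding locally_compact_boolean_space_def locally_compact_space_def by blast
  have "openin X = arbitrary union_of (\<lambda>U. openin X U \<and> closedin X U)"
    using X by (simp add: locally_compact_boolean_space_def)
  then have base: "\<And>U x. openin X U \<Longrightarrow> x \<in> U \<Longrightarrow> \<exists>V. (openin X V \<and> closedin X V) \<and> x \<in> V \<and> V \<subseteq> U"
    unfolding openin_topology_base_unique by blast
  have "openin X (O' \<inter> U)" using K U by auto
  then obtain V where V: "openin X V" "closedin X V" "x \<in> V" "V \<subseteq> O' \<inter> U"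
    using base[of "O' \<inter> U" x] K U by blast
  then have "compactin X V" using K closed_compactin[of X K V] by blast
  then show thesis using that V by auto
qed

section \<open>Compact sections over a Boolean base\<close>

locale boolean_etale = etale +
  assumes base_boolean: "locally_compact_boolean_space (base A)"
begin

lemma base_Hausdorff: "Hausdorff_space (base A)"
  using base_boolean by (simp add: locally_compact_boolean_space_def)

lemma compact_section_image:
  assumes "compact_section A W"
  shows "openin (base A) (proj A ` W)" "compactin (base A) (proj A ` W)"
    "closedin (base A) (proj A ` W)"
proof -
  show "openin (base A) (proj A ` W)"
    using assms open_image by (simp add: compact_section_def)
  show "compactin (base A) (proj A ` W)" using assms by (simp add: compact_section_iff)
  then show "closedin (base A) (proj A ` W)"
    using base_Hausdorff compactin_imp_closedin by blast
qed

text \<open>Meet and difference are both of this form, since the domain of a compact section is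
  clopen in the Hausdorff base.\<close>

lemma compact_section_restrict:
  assumes W: "compact_section A W" and V: "openin (base A) V" "closedin (base A) V"
  shows "compact_section A {e \<in> W. proj A e \<in> V}"
proof -
  have eq: "{e \<in> W. proj A e \<in> V} = W \<inter> {e \<in> topspace (total A). proj A e \<in> V}"
    using compact_section_subset[OF W] by blast
  have "openin (total A) {e \<in> W. proj A e \<in> V}"
    unfolding eq using W openin_vimage[OF V(1)] by (auto simp: compact_section_def)
  moreover have "compactin (total A) {e \<in> W. proj A e \<in> V}"
    unfolding eq using W closedin_vimage[OF V(2)]
    by (intro compact_Int_closedin) (auto simp: compact_section_def)
  moreover have "inj_on (proj A) {e \<in> W. proj A e \<in> V}"
    using W by (auto simp: compact_section_def inj_on_def)
  ultimately show ?thesis by (simp add: compact_section_def)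
qed

lemma compact_section_meet:
  assumes "compact_section A V" "compact_section A W"
  shows "compact_section A {e \<in> V. proj A e \<in> proj A ` W}"
  using assms by (intro compact_section_restrict compact_section_image)

lemma compact_section_diff:
  assumes V: "compact_section A V" and W: "compact_section A W"
  shows "compact_section A {e \<in> V. proj A e \<notin> proj A ` W}"
proof -
  have "{e \<in> V. proj A e \<notin> proj A ` W}
      = {e \<in> V. proj A e \<in> topspace (base A) - proj A ` W}"
    using compact_section_subset[OF V] proj_surj by blast
  then show ?thesis
    using compact_section_image[OF W] compact_section_restrict[OF V, of "topspace (base A) - proj A ` W"]
    by auto
qed

lemma compact_section_Un:
  assumes "compact_section A V" "compact_section A W" "inj_on (proj A) (V \<union> W)"
  shows "compact_section A (V \<union> W)"
  using assms by (auto simp: compact_section_def intro: compactin_Un)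

lemma compact_section_join:
  assumes V: "compact_section A V" and W: "compact_section A W"
  shows "compact_section A (W \<union> {e \<in> V. proj A e \<notin> proj A ` W})"
proof (rule compact_section_Un)
  show "inj_on (proj A) (W \<union> {e \<in> V. proj A e \<notin> proj A ` W})"
    using V W by (intro inj_on_section_join) (auto simp: compact_section_def)
qed (use W compact_section_diff[OF V W] in auto)

text \<open>A sheet inside \<open>U\<close> is shrunk to the part over a compact open neighbourhood
  of \<open>proj A e\<close>. Hence compact sections form a base of the total space, and a
  cohomomorphism is determined by its action on them.\<close>

lemma compact_section_nbhd:
  assumes U: "openin (total A) U" "e \<in> U"
  obtains W where "compact_section A W" "e \<in> W" "W \<subseteq> U"
proof -
  have "e \<in> topspace (total A)" using U openin_subset by blast
  then obtain N where N: "openin (total A) N" "inj_on (proj A) N" "e \<in> N"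
    by (rule section_nbhd) (auto simp: open_section_def)
  have NU: "openin (total A) (N \<inter> U)" using N U by auto
  obtain V where V: "openin (base A) V" "compactin (base A) V" "proj A e \<in> V"
      "V \<subseteq> proj A ` (N \<inter> U)"
    using locally_compact_boolean_space_nbhd[OF base_boolean open_image[OF NU], of "proj A e"]
      N U by blast
  let ?W = "(N \<inter> U) \<inter> {e \<in> topspace (total A). proj A e \<in> V}"
  have "open_section A ?W"
    using NU openin_vimage[OF V(1)] N(2) by (auto simp: open_section_def inj_on_def)
  moreover have "proj A ` ?W = V"
    using V(4) openin_subset[OF NU] by blast
  ultimately have "compact_section A ?W" using V by (simp add: compact_section_iff)
  then show thesis
    using that[of ?W] V N U \<open>e \<in> topspace (total A)\<close> by blast
qed

lemma down_set_section_algebra: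
  assumes "compact_section A W"
  shows "down_set (section_algebra A) W
    = {V. compact_section A V \<and> V = {e \<in> W. proj A e \<in> proj A ` V}}"
  by (auto simp: down_set_def natural_le_def)

sublocale section_algebra: left_handed_skew_boolean_algebra "section_algebra A"
proof (unfold_locales; simp only: section_algebra_simps image_section mem_Collect_eq)
  fix W assume W: "compact_section A W"
  \<comment> \<open>\<open>D\<close> is the down set of \<open>W\<close>, consisting of the
    restrictions of \<open>W\<close> to compact open parts of its domain. On \<open>D\<close> meet
    and join are plain intersection and union and the complement of \<open>V\<close> is
    \<open>W - V\<close>, so the Boolean laws are those of sets.\<close>
  define D where "D = {V. compact_section A V \<and> V = {e \<in> W. proj A e \<in> proj A ` V}}"
  have D_iff: "V \<in> D \<longleftrightarrow>
      compact_section A V \<and> V \<subseteq> W \<and> (\<forall>e \<in> W. \<forall>e' \<in> V. proj A e = proj A e' \<longrightarrow> e \<in> V)" for V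
    unfolding D_def by (auto simp: image_iff)
  have meet: "{e \<in> V. proj A e \<in> proj A ` V'} = V \<inter> V'"
    and join: "V' \<union> {e \<in> V. proj A e \<notin> proj A ` V'} = V \<union> V'"
    if "V \<in> D" "V' \<in> D" for V V'
    using that unfolding D_iff by auto
  have D_sub: "V \<subseteq> W" if "V \<in> D" for V using that by (simp add: D_iff)
  have top: "W \<in> D" using W by (simp add: D_iff)
  have closed: "V \<inter> V' \<in> D" "V \<union> V' \<in> D" "W - V \<in> D"
    if V: "V \<in> D" "V' \<in> D" for V V'
  proof -
    have "compact_section A (V \<inter> V')"
      using compact_section_meet[of V V'] V meet[OF V] by (simp add: D_iff)
    moreover have "compact_section A (V \<union> V')"
      using compact_section_join[of V V'] V join[OF V] by (simp add: D_iff)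
    moreover have "{e \<in> W. proj A e \<notin> proj A ` V} = W - V"
      using V unfolding D_iff by auto
    then have "compact_section A (W - V)"
      using compact_section_diff[OF W, of V] V by (simp add: D_iff)
    ultimately show "V \<inter> V' \<in> D" "V \<union> V' \<in> D" "W - V \<in> D"
      using V by (simp_all add: D_iff le_infI1) (metis IntD1 IntD2 UnE DiffE subsetD)+
  qed
  have bot: "{} \<in> D" by (simp add: D_iff)
  show "boolean_lattice_on (down_set (section_algebra A) W) (meet (section_algebra A))
      (join (section_algebra A)) {} W"
    unfolding down_set_section_algebra[OF W] boolean_lattice_on_def section_algebra_simps
      D_def[symmetric]
  proof (intro conjI ballI)
    fix V assume V: "V \<in> D"
    show "\<exists>y \<in> D. {e \<in> V. proj A e \<in> proj A ` y} = {} \<and> y \<union> {e \<in> V. proj A e \<notin> proj A ` y} = W"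
      using V D_iff[of V] closed[OF V V] meet[OF V closed(3)[OF V V]] join[OF V closed(3)[OF V V]]
      by (intro bexI[of _ "W - V"]) auto
    qed (use top bot D_sub in \<open>(simp only: meet join closed(1,2); blast)+\<close>)
next
  fix V W assume "compact_section A V" "compact_section A W"
  then show "{e \<in> V. proj A e \<notin> proj A ` W} \<in> down_set (section_algebra A) V"
    by (simp only: down_set_section_algebra mem_Collect_eq image_section_diff compact_section_diff)
      blast
qed (auto simp: compact_section_meet compact_section_join)

end

section \<open>Cohomomorphisms acting on sections\<close>

text \<open>If \<open>W\<close> is the image of a section \<open>s\<close>, this is the image of the
  section with values \<open>k x (s (f x))\<close>. Avoiding \<open>s\<close> makes the formula
  meaningful for every set \<open>W\<close> and compatible with unions.\<close>

definition push ::
  "('d, 'y) etale \<Rightarrow> ('e, 'x) etale \<Rightarrow> ('y \<Rightarrow> 'x) \<times> ('y \<Rightarrow> 'e \<Rightarrow> 'd) \<Rightarrow> 'e set \<Rightarrow> 'd set" where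
  "push A B = (\<lambda>(f, k) W. {k x e | x e. x \<in> topspace (base A) \<and> e \<in> W \<and> proj B e = f x})"

lemma pushI:
  "x \<in> topspace (base A) \<Longrightarrow> e \<in> W \<Longrightarrow> proj B e = f x \<Longrightarrow> k x e \<in> push A B (f, k) W"
  by (auto simp: push_def)

text \<open>A section with image \<open>W\<close> is sent to one with image
  \<open>push A B (f, k) W\<close>. That values lie in the right stalks is part of the condition on
  \<open>k\<close>, so by \<open>is_sectionI\<close> only the openness of this image
  remains.\<close>

lemma cohomomorphism_iff:
  assumes B: "etale_space B" and A: "etale_space A"
    and f: "continuous_map (base A) (base B) f"
  shows "cohomomorphism B A f k \<longleftrightarrow>
    k \<in> (\<Pi>\<^sub>E x \<in> topspace (base A). stalk B (f x) \<rightarrow>\<^sub>E stalk A x) \<and>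
    (\<forall>W. open_section B W \<longrightarrow> openin (total A) (push A B (f, k) W))"
proof -
  interpret A: etale A by (rule etale.intro) fact
  interpret B: etale B by (rule etale.intro) fact
  have "openin (total A) (push A B (f, k) W)"
    if k: "cohomomorphism B A f k" and W: "open_section B W" for W
  proof -
    let ?s = "inv_into W (proj B)" and ?U = "{x \<in> topspace (base A). f x \<in> proj B ` W}"
    have "is_section A ?U (\<lambda>x. k x (?s (f x)))"
      using k B.open_section_imp_is_section[OF W] unfolding cohomomorphism_def by blast
    then have "openin (total A) ((\<lambda>x. k x (?s (f x))) ` ?U)"
      using A.is_section_imp_open_section by (auto simp: open_section_def)
    also have "(\<lambda>x. k x (?s (f x))) ` ?U = push A B (f, k) W"
    proof (intro equalityI subsetI)
      fix a assume "a \<in> (\<lambda>x. k x (?s (f x))) ` ?U"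
      then obtain x e where x: "x \<in> topspace (base A)" "e \<in> W" "f x = proj B e"
        "a = k x (?s (f x))" by auto
      then have "a = k x e" using W by (simp add: open_section_def)
      then show "a \<in> push A B (f, k) W" using x by (simp add: pushI)
    next
      fix a assume "a \<in> push A B (f, k) W"
      then obtain x e where x: "x \<in> topspace (base A)" "e \<in> W" "proj B e = f x" "a = k x e"
        by (auto simp: push_def)
      then have "a = k x (?s (f x))" using W by (simp add: open_section_def flip: x(3))
      moreover have "x \<in> ?U" using x by (metis (mono_tags, lifting) imageI mem_Collect_eq)
      ultimately show "a \<in> (\<lambda>x. k x (?s (f x))) ` ?U" by blast
    qed
    finally show ?thesis .
  qed
  moreover have "is_section A {x \<in> topspace (base A). f x \<in> U} (\<lambda>x. k x (s (f x)))"
    if k: "k \<in> (\<Pi>\<^sub>E x \<in> topspace (base A). stalk B (f x) \<rightarrow>\<^sub>E stalk A x)"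
      and opn: "\<forall>W. open_section B W \<longrightarrow> openin (total A) (push A B (f, k) W)"
      and s: "is_section B U s" for U s
  proof (rule A.is_sectionI)
    have U: "openin (base B) U" "U \<subseteq> topspace (base B)"
      and "continuous_map (subtopology (base B) U) (total B) s"
      and ps: "\<And>y. y \<in> U \<Longrightarrow> proj B (s y) = y"
      using s openin_subset by (auto simp: is_section_def)
    then have s_top: "s y \<in> topspace (total B)" if "y \<in> U" for y
      using that by (auto simp: continuous_map_def)
    show "openin (base A) {x \<in> topspace (base A). f x \<in> U}"
      using f U by (simp add: continuous_map)
    show "proj A (k x (s (f x))) = x" if "x \<in> {x \<in> topspace (base A). f x \<in> U}" for x
    proof -
      have "k x \<in> stalk B (f x) \<rightarrow>\<^sub>E stalk A x" using k that by auto
      moreover have "s (f x) \<in> stalk B (f x)" using that s_top ps by (simp add: stalk_def)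
      ultimately show ?thesis by (auto simp: stalk_def)
    qed
    have "(\<lambda>x. k x (s (f x))) ` {x \<in> topspace (base A). f x \<in> U} = push A B (f, k) (s ` U)"
      using ps by (fastforce simp: push_def)
    then show "openin (total A) ((\<lambda>x. k x (s (f x))) ` {x \<in> topspace (base A). f x \<in> U})"
      using opn B.is_section_imp_open_section[OF s] by simp
  qed
  ultimately show ?thesis by (auto simp: cohomomorphism_def)
qed

lemma etale_hom_iff:
  assumes "etale_space B" "etale_space A"
  shows "(f, k) \<in> etale_hom B A \<longleftrightarrow>
    f \<in> extensional (topspace (base A)) \<and>
    continuous_proper_map (base A) (base B) f \<and>
    k \<in> (\<Pi>\<^sub>E x \<in> topspace (base A). stalk B (f x) \<rightarrow>\<^sub>E stalk A x) \<and>
    (\<forall>W. open_section B W \<longrightarrow> openin (total A) (push A B (f, k) W))"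
  using cohomomorphism_iff[OF assms, of f k]
  by (auto simp: etale_hom_def continuous_proper_map_def)

lemma image_push:
  assumes B: "etale_space B" and A: "etale_space A" and h: "(f, k) \<in> etale_hom B A"
    and W: "W \<subseteq> topspace (total B)"
  shows "proj A ` push A B (f, k) W = {x \<in> topspace (base A). f x \<in> proj B ` W}"
proof -
  have "proj A (k x e) = x" if "x \<in> topspace (base A)" "e \<in> W" "proj B e = f x" for x e
  proof -
    have "k x \<in> stalk B (f x) \<rightarrow>\<^sub>E stalk A x" using h that by (auto simp: etale_hom_iff[OF B A])
    then show ?thesis using that W by (auto simp: stalk_def)
  qed
  note pk = this
  show ?thesis
  proof (intro equalityI subsetI)
    fix x assume "x \<in> proj A ` push A B (f, k) W"
    then show "x \<in> {x \<in> topspace (base A). f x \<in> proj B ` W}"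
      by (auto simp: push_def pk) (metis imageI)
  next
    fix x assume "x \<in> {x \<in> topspace (base A). f x \<in> proj B ` W}"
    then obtain e where e: "x \<in> topspace (base A)" "e \<in> W" "proj B e = f x" by auto
    then have "k x e \<in> push A B (f, k) W" by (auto simp: push_def)
    then show "x \<in> proj A ` push A B (f, k) W" using pk[OF e] by (metis imageI)
  qed
qed

text \<open>The projection of \<open>k x e\<close> is \<open>x\<close>, and \<open>e\<close> is the
  only point of \<open>W\<close> over \<open>f x\<close>.\<close>

lemma open_section_push:
  assumes B: "etale_space B" and A: "etale_space A" and h: "(f, k) \<in> etale_hom B A"
    and W: "open_section B W"
  shows "open_section A (push A B (f, k) W)"
proof -
  have sub: "W \<subseteq> topspace (total B)"
    using W openin_subset by (auto simp: open_section_def)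
  have "inj_on (proj A) (push A B (f, k) W)"
  proof (rule inj_onI)
    fix a a' assume "a \<in> push A B (f, k) W" "a' \<in> push A B (f, k) W" and eq: "proj A a = proj A a'"
    then obtain x e x' e' where x: "x \<in> topspace (base A)" "e \<in> W" "proj B e = f x" "a = k x e"
      "x' \<in> topspace (base A)" "e' \<in> W" "proj B e' = f x'" "a' = k x' e'"
      by (auto simp: push_def)
    have "k x \<in> stalk B (f x) \<rightarrow>\<^sub>E stalk A x" "k x' \<in> stalk B (f x') \<rightarrow>\<^sub>E stalk A x'"
      using h x by (auto simp: etale_hom_iff[OF B A])
    then have "proj A a = x" "proj A a' = x'" using x sub by (auto simp: stalk_def)
    then have "x = x'" using eq by simp
    moreover have "inj_on (proj B) W" using W by (simp add: open_section_def)
    ultimately have "e = e'" using x by (metis inj_onD)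
    then show "a = a'" using x \<open>x = x'\<close> by simp
  qed
  then show ?thesis using h W by (simp add: etale_hom_iff[OF B A] open_section_def)
qed

text \<open>Properness of the base map enters here: the domain of the pushed section is the preimage
  of the compact domain of \<open>W\<close>.\<close>

lemma compact_section_push:
  assumes B: "etale_space B" and A: "etale_space A" and h: "(f, k) \<in> etale_hom B A"
    and W: "compact_section B W"
  shows "compact_section A (push A B (f, k) W)"
proof -
  interpret A: etale A by (rule etale.intro) fact
  interpret B: etale B by (rule etale.intro) fact
  have "open_section B W" "compactin (base B) (proj B ` W)"
    using W by (auto simp: B.compact_section_iff)
  moreover have "continuous_proper_map (base A) (base B) f"
    using h by (simp add: etale_hom_iff[OF B A])
  ultimately show ?thesis
    using W h unfolding A.compact_section_iff
    by (simp add: open_section_push[OF B A h] image_push[OF B A h] B.compact_section_subset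
        continuous_proper_map_def)
qed

text \<open>The law for \<open>push\<close> is proved first, because the openness required of the
  composite then follows by applying \<open>open_section_push\<close> twice. The same law later
  gives functoriality.\<close>

lemma etale_hom_compose:
  assumes B: "etale_space B" and A: "etale_space A" and C: "etale_space C"
    and h: "(f, k) \<in> etale_hom B A" and g: "(e, l) \<in> etale_hom A C"
  defines "fe \<equiv> compose (topspace (base C)) f e"
    and "lk \<equiv> \<lambda>w \<in> topspace (base C). compose (stalk B (f (e w))) (l w) (k (e w))"
  shows "W \<subseteq> topspace (total B) \<Longrightarrow> push C B (fe, lk) W = push C A (e, l) (push A B (f, k) W)"
    and "(fe, lk) \<in> etale_hom B C"
proof -
  note H = h[unfolded etale_hom_iff[OF B A]] and G = g[unfolded etale_hom_iff[OF A C]]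
  have e_top: "e w \<in> topspace (base A)" if "w \<in> topspace (base C)" for w
    using G that by (auto simp: continuous_proper_map_def continuous_map_def)
  have k: "k x a \<in> stalk A x" if "x \<in> topspace (base A)" "a \<in> stalk B (f x)" for x a
  proof -
    have "k x \<in> stalk B (f x) \<rightarrow>\<^sub>E stalk A x" using H that by auto
    then show ?thesis using that by auto
  qed
  have l: "l x a \<in> stalk C x" if "x \<in> topspace (base C)" "a \<in> stalk A (e x)" for x a
  proof -
    have "l x \<in> stalk A (e x) \<rightarrow>\<^sub>E stalk C x" using G that by auto
    then show ?thesis using that by auto
  qed
  have fe [simp]: "fe w = f (e w)" if "w \<in> topspace (base C)" for w
    using that by (simp add: fe_def compose_def)
  have lk [simp]: "lk w a = l w (k (e w) a)"
    if "w \<in> topspace (base C)" "a \<in> stalk B (f (e w))" for w a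
    using that by (simp add: lk_def compose_def)
  show push: "push C B (fe, lk) W = push C A (e, l) (push A B (f, k) W)"
    if W: "W \<subseteq> topspace (total B)" for W
  proof (intro equalityI subsetI)
    fix c assume "c \<in> push C B (fe, lk) W"
    then obtain w b where w: "w \<in> topspace (base C)" "b \<in> W" "proj B b = f (e w)" "c = lk w b"
      by (auto simp: push_def)
    then have b: "b \<in> stalk B (f (e w))" using W by (auto simp: stalk_def)
    have "k (e w) b \<in> push A B (f, k) W" using w e_top by (auto simp: push_def)
    moreover have "proj A (k (e w) b) = e w" using k[OF e_top[OF w(1)] b] by (simp add: stalk_def)
    ultimately show "c \<in> push C A (e, l) (push A B (f, k) W)"
      unfolding push_def[of C A] using w b by auto
  next
    fix c assume "c \<in> push C A (e, l) (push A B (f, k) W)"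
    then obtain w x b where w: "w \<in> topspace (base C)" "x \<in> topspace (base A)" "b \<in> W"
      "proj B b = f x" "proj A (k x b) = e w" "c = l w (k x b)"
      by (auto simp: push_def)
    then have b: "b \<in> stalk B (f x)" using W by (auto simp: stalk_def)
    \<comment> \<open>The point \<open>k x b\<close> lies over \<open>x\<close>, but it belongs to
      the stalk over \<open>e w\<close>, where \<open>l w\<close> is applied.\<close>
    then have "x = e w" using k[OF w(2) b] w by (simp add: stalk_def)
    then have "c = lk w b" "proj B b = fe w" using w b by auto
    then show "c \<in> push C B (fe, lk) W" using w(1,3) by (simp add: pushI)
  qed
  have "openin (total C) (push C B (fe, lk) W)" if W: "open_section B W" for W
  proof -
    have "W \<subseteq> topspace (total B)" using W openin_subset by (auto simp: open_section_def)
    then show ?thesis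
      using open_section_push[OF A C g open_section_push[OF B A h W]]
      by (simp add: push open_section_def)
  qed
  moreover have "continuous_proper_map (base C) (base B) fe"
    unfolding continuous_proper_map_def
  proof (intro conjI allI impI)
    have "continuous_map (base C) (base B) (f \<circ> e)"
      using H G by (auto simp: continuous_proper_map_def intro: continuous_map_compose)
    then show "continuous_map (base C) (base B) fe"
      by (rule continuous_map_eq) auto
    fix K assume "compactin (base B) K"
    then have "compactin (base C) {w \<in> topspace (base C). e w \<in> {x \<in> topspace (base A). f x \<in> K}}"
      using H G by (simp add: continuous_proper_map_def del: mem_Collect_eq)
    also have "\<dots> = {w \<in> topspace (base C). fe w \<in> K}" using e_top by auto
    finally show "compactin (base C) {w \<in> topspace (base C). fe w \<in> K}" .
  qed
  moreover have "lk \<in> (\<Pi>\<^sub>E w \<in> topspace (base C). stalk B (fe w) \<rightarrow>\<^sub>E stalk C w)"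
    using k l e_top unfolding lk_def
    by (auto simp: PiE_iff compose_def)
  moreover have "fe \<in> extensional (topspace (base C))" by (simp add: fe_def compose_def)
  ultimately show "(fe, lk) \<in> etale_hom B C" by (simp add: etale_hom_iff[OF B C])
qed

lemma etale_hom_id:
  assumes A: "etale_space A"
  defines "i \<equiv> (\<lambda>x \<in> topspace (base A). x, \<lambda>x \<in> topspace (base A). \<lambda>a \<in> stalk A x. a)"
  shows "W \<subseteq> topspace (total A) \<Longrightarrow> push A A i W = W"
    and "i \<in> etale_hom A A"
proof -
  interpret A: etale A by (rule etale.intro) fact
  show push: "push A A i W = W" if W: "W \<subseteq> topspace (total A)" for W
  proof -
    have "proj A e \<in> topspace (base A)" "e \<in> stalk A (proj A e)" if "e \<in> W" for e
      using W that A.proj_surj by (auto simp: stalk_def)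
    then show ?thesis by (fastforce simp: push_def i_def stalk_def)
  qed
  have "openin (total A) (push A A i W)" if "open_section A W" for W
    using that push[of W] openin_subset[of "total A" W] by (simp add: open_section_def)
  moreover have "continuous_proper_map (base A) (base A) (fst i)"
    unfolding continuous_proper_map_def
  proof (intro conjI allI impI)
    show "continuous_map (base A) (base A) (fst i)"
      by (rule continuous_map_eq[OF continuous_map_id]) (simp add: i_def)
    fix K assume K: "compactin (base A) K"
    then have "{x \<in> topspace (base A). fst i x \<in> K} = K"
      by (auto simp: i_def compactin_def)
    then show "compactin (base A) {x \<in> topspace (base A). fst i x \<in> K}" using K by simp
  qed
  ultimately show "i \<in> etale_hom A A"
    by (simp add: i_def etale_hom_iff[OF A A] PiE_iff)
qed

section \<open>The category of etale spaces\<close>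

lemma ESLCBS_simps [simp]:
  "Obj (ESLCBS :: (('u set, 'u set) etale,
      ('u set \<Rightarrow> 'u set) \<times> ('u set \<Rightarrow> 'u set \<Rightarrow> 'u set)) precategory)
    = {A. etale_space A \<and> locally_compact_boolean_space (base A) \<and>
        small_base TYPE('u) (total A) \<and> small_base TYPE('u) (base A)}"
  "Hom ESLCBS = etale_hom"
  "Idt ESLCBS = (\<lambda>A. (\<lambda>x \<in> topspace (base A). x,
                  \<lambda>x \<in> topspace (base A). \<lambda>a \<in> stalk A x. a))"
  "Cmp ESLCBS = (\<lambda>B A C (e, l) (f, k).
               (compose (topspace (base C)) f e,
                \<lambda>w \<in> topspace (base C). compose (stalk B (f (e w))) (l w) (k (e w))))"
  by (simp_all add: ESLCBS_def)

lemma etale_homE: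
  assumes "h \<in> etale_hom B A"
  obtains f k where "h = (f, k)" "f \<in> topspace (base A) \<rightarrow>\<^sub>E topspace (base B)"
    "k \<in> (\<Pi>\<^sub>E x \<in> topspace (base A). stalk B (f x) \<rightarrow>\<^sub>E stalk A x)"
  using assms
  by (auto simp: etale_hom_def cohomomorphism_def continuous_proper_map_def continuous_map_def PiE_def)

lemma category_ESLCBS:
  "category (ESLCBS :: (('u set, 'u set) etale,
      ('u set \<Rightarrow> 'u set) \<times> ('u set \<Rightarrow> 'u set \<Rightarrow> 'u set)) precategory)"
proof (unfold_locales, goal_cases)
  case (1 a)
  then show ?case by (simp add: etale_hom_id)
next
  case (2 a b c f g)
  then show ?case
    using etale_hom_compose(2)[of a b c] by (cases f; cases g) simp
next
  case (3 a b h)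
  then have "h \<in> etale_hom a b" by simp
  then show ?case
  proof (cases rule: etale_homE)
    case (1 f k)
    have k: "k x \<in> stalk a (f x) \<rightarrow>\<^sub>E stalk b x" if "x \<in> topspace (base b)" for x
      using 1 that by auto
    have "(\<lambda>w \<in> topspace (base b). compose (stalk a ((\<lambda>x \<in> topspace (base a). x) (f w))) (k w)
        ((\<lambda>x \<in> topspace (base a). \<lambda>e \<in> stalk a x. e) (f w))) = k"
    proof
      fix w
      show "(\<lambda>w \<in> topspace (base b). compose (stalk a ((\<lambda>x \<in> topspace (base a). x) (f w))) (k w)
        ((\<lambda>x \<in> topspace (base a). \<lambda>e \<in> stalk a x. e) (f w))) w = k w"
      proof (cases "w \<in> topspace (base b)")
        case True
        then have "f w \<in> topspace (base a)" using 1 by auto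
        then show ?thesis using True k[OF True] by (auto simp: compose_def fun_eq_iff PiE_def extensional_def)
      qed (use 1 in \<open>auto simp: PiE_def extensional_def\<close>)
    qed
    moreover have "compose (topspace (base b)) (\<lambda>x \<in> topspace (base a). x) f = f"
      using 1 by (auto simp: compose_def fun_eq_iff PiE_def extensional_def)
    ultimately show ?thesis by (simp add: 1(1))
  qed
next
  case (4 a b h)
  then have "h \<in> etale_hom a b" by simp
  then show ?case
  proof (cases rule: etale_homE)
    case (1 f k)
    have k: "k x \<in> stalk a (f x) \<rightarrow>\<^sub>E stalk b x" if "x \<in> topspace (base b)" for x
      using 1 that by auto
    have "(\<lambda>w \<in> topspace (base b). compose (stalk a (f w)) (\<lambda>e \<in> stalk b w. e) (k w)) = k"
    proof
      fix w show "(\<lambda>w \<in> topspace (base b). compose (stalk a (f w)) (\<lambda>e \<in> stalk b w. e) (k w)) w = k w"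
      proof (cases "w \<in> topspace (base b)")
        case True
        then show ?thesis using k[OF True] by (auto simp: compose_def fun_eq_iff PiE_def extensional_def)
      qed (use 1 in \<open>auto simp: PiE_def extensional_def\<close>)
    qed
    moreover have "compose (topspace (base b)) f (\<lambda>x \<in> topspace (base b). x) = f"
      using 1 by (auto simp: compose_def fun_eq_iff PiE_def extensional_def)
    ultimately show ?thesis using 1 by (auto cong: restrict_cong)
  qed
next
  case (5 a b c d f g h)
  then have "f \<in> etale_hom a b" "g \<in> etale_hom b c" "h \<in> etale_hom c d" by simp_all
  then obtain f1 f2 g1 g2 h1 h2 where f: "f = (f1, f2)" "f1 \<in> topspace (base b) \<rightarrow>\<^sub>E topspace (base a)"
    "f2 \<in> (\<Pi>\<^sub>E x \<in> topspace (base b). stalk a (f1 x) \<rightarrow>\<^sub>E stalk b x)"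
    and g: "g = (g1, g2)" "g1 \<in> topspace (base c) \<rightarrow>\<^sub>E topspace (base b)"
    and h: "h = (h1, h2)" "h1 \<in> topspace (base d) \<rightarrow>\<^sub>E topspace (base c)"
    by (elim etale_homE)
  have h1: "h1 x \<in> topspace (base c)" if "x \<in> topspace (base d)" for x using h that by auto
  have g1: "g1 x \<in> topspace (base b)" if "x \<in> topspace (base c)" for x using g that by auto
  have f2: "f2 x u \<in> stalk b x" if "x \<in> topspace (base b)" "u \<in> stalk a (f1 x)" for x u
  proof -
    have "f2 x \<in> stalk a (f1 x) \<rightarrow>\<^sub>E stalk b x" using f that by auto
    then show ?thesis using that by auto
  qed
  show ?case
    by (auto simp: f(1) g(1) h(1) compose_def fun_eq_iff restrict_def h1 g1 f2)
qed

section \<open>The section functor is fully faithful\<close>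

lemma push_Un: "push A B h (V \<union> W) = push A B h V \<union> push A B h W"
  by (auto simp: push_def split: prod.split)

lemma push_UN: "push A B h (\<Union>\<W>) = (\<Union>W \<in> \<W>. push A B h W)"
  by (cases h) (auto simp: push_def)

context etale
begin

lemma proj_in_base: "e \<in> topspace (total A) \<Longrightarrow> proj A e \<in> topspace (base A)"
  using proj_surj by blast

lemma stalk_nonempty:
  assumes "x \<in> topspace (base A)"
  obtains e where "e \<in> topspace (total A)" "proj A e = x"
  using assms unfolding proj_surj[symmetric] by auto

end

context boolean_etale
begin

text \<open>Sections may disagree where their domains overlap, so their union need not be a section;
  an iterated join has the desired domain.\<close>

lemma compact_section_Union:
  assumes "finite \<W>" "\<And>W. W \<in> \<W> \<Longrightarrow> compact_section A W"
  shows "\<exists>V. compact_section A V \<and> proj A ` V = (\<Union>W \<in> \<W>. proj A ` W)"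
  using assms
proof (induction \<W> rule: finite_induct)
  case empty
  show ?case by (intro exI[of _ "{}"]) simp
next
  case (insert W \<W>)
  then obtain V where V: "compact_section A V" "proj A ` V = (\<Union>W \<in> \<W>. proj A ` W)" by blast
  have img: "proj A ` (V \<union> {e \<in> W. proj A e \<notin> proj A ` V}) = (\<Union>W \<in> insert W \<W>. proj A ` W)"
    unfolding image_section_join by (simp add: V(2) Un_commute)
  have cs: "compact_section A (V \<union> {e \<in> W. proj A e \<notin> proj A ` V})"
    using insert.prems V(1) by (intro compact_section_join) auto
  show ?case by (rule exI) (rule conjI[OF cs img])
qed

lemma compact_section_over:
  assumes "x \<in> topspace (base A)"
  obtains W where "compact_section A W" "x \<in> proj A ` W"
proof -
  obtain e where "e \<in> topspace (total A)" "proj A e = x" using assms by (rule stalk_nonempty)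
  then show thesis using compact_section_nbhd[of "topspace (total A)" e] that by blast
qed

text \<open>Domains of compact sections cover \<open>K\<close>, and a finite subcover is merged by
  \<open>compact_section_Union\<close>. Having a single section defined on all of \<open>K\<close>
  is what properness arguments need on both sides.\<close>

lemma compact_subset_section:
  assumes K: "compactin (base A) K"
  obtains V where "compact_section A V" "K \<subseteq> proj A ` V"
proof -
  have "\<exists>\<F>. finite \<F> \<and> \<F> \<subseteq> (`) (proj A) ` {W. compact_section A W} \<and> K \<subseteq> \<Union>\<F>"
  proof (rule compactinD[OF K])
    show "\<And>U. U \<in> (`) (proj A) ` {W. compact_section A W} \<Longrightarrow> openin (base A) U"
      using compact_section_image by auto
    show "K \<subseteq> \<Union>((`) (proj A) ` {W. compact_section A W})"
    proof
      fix x assume "x \<in> K"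
      then have "x \<in> topspace (base A)" using K compactin_subset_topspace by blast
      then show "x \<in> \<Union>((`) (proj A) ` {W. compact_section A W})"
        by (rule compact_section_over) auto
    qed
  qed
  then obtain \<F> where \<F>: "finite \<F>" "\<F> \<subseteq> (`) (proj A) ` {W. compact_section A W}" "K \<subseteq> \<Union>\<F>"
    by blast
  obtain \<W> where \<W>: "\<W> \<subseteq> {W. compact_section A W}" "finite \<W>" "\<F> = (`) (proj A) ` \<W>"
    using finite_subset_image[OF \<F>(1,2)] by blast
  obtain V where "compact_section A V" "proj A ` V = (\<Union>W \<in> \<W>. proj A ` W)"
    using compact_section_Union[of \<W>] \<W>(1,2) by blast
  then show thesis using that[of V] \<F>(3) \<W>(3) by simp
qed

text \<open>The complement of \<open>y\<close> is open in the Hausdorff base, so a compact section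
  through a point over \<open>x\<close> can be chosen to avoid the stalk at
  \<open>y\<close>.\<close>

lemma compact_section_separates:
  assumes x: "x \<in> topspace (base A)" and y: "y \<in> topspace (base A)"
    and le: "\<And>W. compact_section A W \<Longrightarrow> x \<in> proj A ` W \<Longrightarrow> y \<in> proj A ` W"
  shows "x = y"
proof (rule ccontr)
  assume ne: "x \<noteq> y"
  obtain e where e: "e \<in> topspace (total A)" "proj A e = x" using x by (rule stalk_nonempty)
  have "closedin (base A) {y}"
    using base_Hausdorff y by (simp add: closedin_Hausdorff_singleton)
  then have "openin (base A) (topspace (base A) - {y})" by blast
  then have "openin (total A) {e \<in> topspace (total A). proj A e \<in> topspace (base A) - {y}}"
    by (rule openin_vimage)
  then obtain W where "compact_section A W" "e \<in> W"
      "W \<subseteq> {e \<in> topspace (total A). proj A e \<in> topspace (base A) - {y}}"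
    using compact_section_nbhd[of _ e] e ne x by blast
  then show False using le[of W] e by blast
qed

end

section \<open>Cohomomorphisms versus homomorphisms of section algebras\<close>

locale boolean_etale_pair = B: boolean_etale B + A: boolean_etale A
  for B :: "('e, 'x) etale" and A :: "('d, 'y) etale"
begin

abbreviation "SB \<equiv> section_algebra B"
abbreviation "SA \<equiv> section_algebra A"

text \<open>With \<open>Q\<close> the domain of a section, or the complement of that domain, this
  gives compatibility of \<open>push\<close> with meet and with difference.\<close>

lemma push_restrict:
  assumes h: "(f, k) \<in> etale_hom B A" and V: "V \<subseteq> topspace (total B)"
  shows "push A B (f, k) {e \<in> V. proj B e \<in> Q} = {a \<in> push A B (f, k) V. f (proj A a) \<in> Q}"
proof -
  have "proj A (k x e) = x" if "x \<in> topspace (base A)" "e \<in> V" "proj B e = f x" for x e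
  proof -
    have "k x \<in> stalk B (f x) \<rightarrow>\<^sub>E stalk A x"
      using h that by (auto simp: etale_hom_iff[OF B.etale A.etale])
    then show ?thesis using that V by (auto simp: stalk_def)
  qed
  note pk = this
  show ?thesis
  proof (intro equalityI subsetI)
    fix a assume "a \<in> push A B (f, k) {e \<in> V. proj B e \<in> Q}"
    then obtain x e where x: "x \<in> topspace (base A)" "e \<in> V" "proj B e \<in> Q" "proj B e = f x" "a = k x e"
      by (auto simp: push_def)
    then show "a \<in> {a \<in> push A B (f, k) V. f (proj A a) \<in> Q}" by (simp add: pk pushI)
  next
    fix a assume a: "a \<in> {a \<in> push A B (f, k) V. f (proj A a) \<in> Q}"
    then obtain x e where x: "x \<in> topspace (base A)" "e \<in> V" "proj B e = f x" "a = k x e"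
      by (auto simp: push_def)
    then show "a \<in> push A B (f, k) {e \<in> V. proj B e \<in> Q}" using a by (simp add: pk pushI)
  qed
qed

lemma push_proper_hom:
  assumes h: "h \<in> etale_hom B A"
  shows "restrict (push A B h) (carr SB) \<in> proper_skew_hom SB SA"
proof -
  obtain f k where fk: "h = (f, k)" by (cases h)
  note H = h[unfolded fk] and E = B.etale A.etale
  have cs: "compact_section A (push A B h W)" if "compact_section B W" for W
    using compact_section_push[OF E H that] fk by simp
  have image: "proj A ` push A B h W = {x \<in> topspace (base A). f x \<in> proj B ` W}"
    if "compact_section B W" for W
    using image_push[OF E H B.compact_section_subset[OF that]] fk by simp
  have top: "proj A a \<in> topspace (base A)" if "compact_section B W" "a \<in> push A B h W" for a W
    using A.compact_section_subset[OF cs[OF that(1)]] that(2) A.proj_in_base by blast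
  have meet: "push A B h {e \<in> V. proj B e \<in> proj B ` W}
      = {a \<in> push A B h V. proj A a \<in> proj A ` push A B h W}"
    if VW: "compact_section B V" "compact_section B W" for V W
    using push_restrict[OF H B.compact_section_subset[OF VW(1)], of "proj B ` W"] top[OF VW(1)]
    unfolding image[OF VW(2)] unfolding fk by auto
  have diff: "push A B h {e \<in> V. proj B e \<notin> proj B ` W}
      = {a \<in> push A B h V. proj A a \<notin> proj A ` push A B h W}"
    if VW: "compact_section B V" "compact_section B W" for V W
    using push_restrict[OF H B.compact_section_subset[OF VW(1)], of "- proj B ` W"] top[OF VW(1)]
    unfolding image[OF VW(2)] unfolding fk by auto
  have "restrict (push A B h) (carr SB) \<in> skew_hom SB SA"
    by (auto simp: skew_hom_def cs push_Un meet diff B.compact_section_meet B.compact_section_join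
        B.compact_section_diff simp del: UnCI)
      (simp add: push_def fk)
  moreover have "\<exists>W \<in> carr SB. meet SA c (restrict (push A B h) (carr SB) W) = c"
    if c: "c \<in> carr SA" for c
  proof -
    have f: "continuous_map (base A) (base B) f"
      using H by (simp add: etale_hom_iff[OF E] continuous_proper_map_def)
    \<comment> \<open>Properness: the image under \<open>f\<close> of the domain of \<open>c\<close>
      is compact, so one section \<open>W\<close> is defined on all of it, and its push is defined
      on the whole domain of \<open>c\<close>.\<close>
    have "compactin (base B) (f ` proj A ` c)"
      using image_compactin[OF A.compact_section_image(2) f] c by simp
    then obtain W where W: "compact_section B W" "f ` proj A ` c \<subseteq> proj B ` W"
      by (rule B.compact_subset_section)
    have "proj A e \<in> topspace (base A)" if "e \<in> c" for e
      using that c A.compact_section_subset A.proj_in_base by auto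
    then have "meet SA c (push A B h W) = c"
      using W by (auto simp: image)
    then show ?thesis using W by (intro bexI[of _ W]) auto
  qed
  ultimately show ?thesis
    by (simp add: proper_skew_hom_iff[OF B.section_algebra.left_handed_skew_boolean_algebra_axioms
          A.section_algebra.left_handed_skew_boolean_algebra_axioms])
qed

text \<open>The domains of pushed sections determine \<open>f x\<close>, because compact sections
  separate points. Then \<open>k x e\<close> is the unique point over \<open>x\<close> in the push
  of any compact section through \<open>e\<close>.\<close>

lemma push_inj:
  assumes h: "h \<in> etale_hom B A" and h': "h' \<in> etale_hom B A"
    and eq: "\<And>W. compact_section B W \<Longrightarrow> push A B h W = push A B h' W"
  shows "h = h'"
proof -
  note E = B.etale A.etale
  obtain f k where fk: "h = (f, k)" "f \<in> topspace (base A) \<rightarrow>\<^sub>E topspace (base B)"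
    "k \<in> (\<Pi>\<^sub>E x \<in> topspace (base A). stalk B (f x) \<rightarrow>\<^sub>E stalk A x)"
    using h by (rule etale_homE)
  obtain f' k' where fk': "h' = (f', k')" "f' \<in> topspace (base A) \<rightarrow>\<^sub>E topspace (base B)"
    "k' \<in> (\<Pi>\<^sub>E x \<in> topspace (base A). stalk B (f' x) \<rightarrow>\<^sub>E stalk A x)"
    using h' by (rule etale_homE)
  have "f x = f' x" if x: "x \<in> topspace (base A)" for x
  proof (rule B.compact_section_separates)
    fix W assume W: "compact_section B W" "f x \<in> proj B ` W"
    then have "x \<in> proj A ` push A B h W"
      using image_push[OF E, of f k W] h x fk(1) B.compact_section_subset by simp
    then have "x \<in> proj A ` push A B h' W" using eq W by simp
    then show "f' x \<in> proj B ` W"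
      using image_push[OF E, of f' k' W] h' x fk'(1) W B.compact_section_subset by simp
  qed (use x fk fk' in auto)
  then have f: "f = f'"
    using fk(2) fk'(2) by (intro extensionalityI[of f "topspace (base A)"]) (auto simp: PiE_def)
  have "k x e = k' x e" if x: "x \<in> topspace (base A)" and e: "e \<in> stalk B (f x)" for x e
  proof -
    obtain W where W: "compact_section B W" "e \<in> W"
      using B.compact_section_nbhd[of "topspace (total B)" e] e by (auto simp: stalk_def)
    have "proj B e = f x" using e by (simp add: stalk_def)
    then have 1: "k x e \<in> push A B h W" "k' x e \<in> push A B h W"
      using pushI[of x A e W B f k] pushI[of x A e W B f' k'] x W eq fk(1) fk'(1) f by auto
    have "k x \<in> stalk B (f x) \<rightarrow>\<^sub>E stalk A x" "k' x \<in> stalk B (f x) \<rightarrow>\<^sub>E stalk A x"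
      using fk(3) fk'(3) x f by auto
    then have "proj A (k x e) = x" "proj A (k' x e) = x" using e by (auto simp: stalk_def)
    moreover have "inj_on (proj A) (push A B h W)"
      using compact_section_push[OF E, of f k W] h fk(1) W by (simp add: compact_section_def)
    ultimately show ?thesis using 1 by (metis inj_onD)
  qed
  note k = this
  have "k x = k' x" if x: "x \<in> topspace (base A)" for x
  proof (rule extensionalityI[of _ "stalk B (f x)"])
    have "k x \<in> stalk B (f x) \<rightarrow>\<^sub>E stalk A x" "k' x \<in> stalk B (f x) \<rightarrow>\<^sub>E stalk A x"
      using fk(3) fk'(3) x f by auto
    then show "k x \<in> extensional (stalk B (f x))" "k' x \<in> extensional (stalk B (f x))"
      by (auto simp: PiE_def)
  qed (use k x in auto)
  then have "k = k'"
    using fk(3) fk'(3) by (intro extensionalityI[of k "topspace (base A)"]) (auto simp: PiE_def)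
  then show ?thesis using f fk(1) fk'(1) by simp
qed

text \<open>The sections \<open>W\<close> with \<open>x\<close> in the domain of
  \<open>\<phi> W\<close> behave like an ultrafilter. Properness supplies one of them,
  \<open>W0\<close>; meets give the finite intersection property, so the compact domain of
  \<open>W0\<close> contains a point \<open>y\<close> common to all their domains; differences give
  the converse implication.\<close>

lemma proper_hom_base_point:
  assumes \<phi>: "\<phi> \<in> proper_skew_hom SB SA" and x: "x \<in> topspace (base A)"
  obtains y where "y \<in> topspace (base B)"
    "\<And>W. compact_section B W \<Longrightarrow> x \<in> proj A ` \<phi> W \<longleftrightarrow> y \<in> proj B ` W"
proof -
  have hom: "\<phi> \<in> skew_hom SB SA"
    and proper: "\<And>c. compact_section A c \<Longrightarrow>
      \<exists>W. compact_section B W \<and> {e \<in> c. proj A e \<in> proj A ` \<phi> W} = c"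
    using \<phi> by (simp_all add: Bex_def
        proper_skew_hom_iff[OF B.section_algebra.left_handed_skew_boolean_algebra_axioms
          A.section_algebra.left_handed_skew_boolean_algebra_axioms])
  note H = skew_homD[OF hom, simplified]
  obtain c where c: "compact_section A c" "x \<in> proj A ` c"
    using x by (rule A.compact_section_over)
  then obtain W0 where W0: "compact_section B W0" "x \<in> proj A ` \<phi> W0"
    using proper[OF c(1)] by blast
  define \<U> where "\<U> = {proj B ` W | W. compact_section B W \<and> x \<in> proj A ` \<phi> W}"
  have fin: "\<exists>W. compact_section B W \<and> x \<in> proj A ` \<phi> W \<and> proj B ` W \<subseteq> proj B ` W0 \<inter> \<Inter>\<F>"
    if "finite \<F>" "\<F> \<subseteq> \<U>" for \<F>
    using that
  proof (induction \<F> rule: finite_induct)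
    case empty
    then show ?case using W0 by auto
  next
    case (insert U \<F>)
    then obtain W V where W: "compact_section B W" "x \<in> proj A ` \<phi> W"
        "proj B ` W \<subseteq> proj B ` W0 \<inter> \<Inter>\<F>"
      and V: "compact_section B V" "x \<in> proj A ` \<phi> V" "U = proj B ` V"
      by (auto simp: \<U>_def)
    have "x \<in> proj A ` \<phi> {e \<in> W. proj B e \<in> proj B ` V}"
      using W V by (simp add: H image_section_meet)
    moreover have "proj B ` {e \<in> W. proj B e \<in> proj B ` V} \<subseteq> proj B ` W0 \<inter> \<Inter>(insert U \<F>)"
      using W V unfolding image_section_meet by auto
    ultimately show ?case using B.compact_section_meet[OF W(1) V(1)] by blast
  qed
  have "proj B ` W0 \<inter> \<Inter>\<U> \<noteq> {}"
  proof -
    have cl: "\<forall>C \<in> \<U>. closedin (base B) C" using B.compact_section_image by (auto simp: \<U>_def)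
    have fip: "proj B ` W0 \<inter> \<Inter>\<F> \<noteq> {}" if \<F>: "finite \<F>" "\<F> \<subseteq> \<U>" for \<F>
    proof -
      obtain W where W: "compact_section B W" "x \<in> proj A ` \<phi> W"
          "proj B ` W \<subseteq> proj B ` W0 \<inter> \<Inter>\<F>"
        using fin[OF \<F>] by blast
      \<comment> \<open>\<open>\<phi>\<close> sends the empty section to the empty section, whose
        domain does not contain \<open>x\<close>.\<close>
      have "W \<noteq> {}" using W(2) H(5) by auto
      then obtain e where "e \<in> W" by auto
      then have "proj B e \<in> proj B ` W0 \<inter> \<Inter>\<F>" using W(3) by (meson imageI subsetD)
      then show ?thesis by (metis empty_iff)
    qed
    have "compactin (base B) (proj B ` W0)" using B.compact_section_image(2)[OF W0(1)] .
    from mp[OF spec[OF conjunct2[OF iffD1[OF compactin_fip this]], of \<U>]]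
    show ?thesis using cl fip by simp
  qed
  then obtain y where y: "y \<in> proj B ` W0" "\<And>U. U \<in> \<U> \<Longrightarrow> y \<in> U" by blast
  have imp: "y \<in> proj B ` W" if "compact_section B W" "x \<in> proj A ` \<phi> W" for W
    using that y(2) by (auto simp: \<U>_def)
  have "x \<in> proj A ` \<phi> W" if W: "compact_section B W" "y \<in> proj B ` W" for W
  proof (rule ccontr)
    assume "x \<notin> proj A ` \<phi> W"
    \<comment> \<open>Outside the domain of \<open>\<phi> W\<close>, the point \<open>x\<close>
      belongs to the domain of the image of the difference of \<open>W0\<close> and
      \<open>W\<close>, which forces \<open>y\<close> out of the domain of \<open>W\<close>.\<close>
    then have "x \<in> proj A ` \<phi> {e \<in> W0. proj B e \<notin> proj B ` W}"
      using W0 W by (simp add: H image_section_diff)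
    then have "y \<in> proj B ` {e \<in> W0. proj B e \<notin> proj B ` W}"
      using imp B.compact_section_diff[OF W0(1) W(1)] by blast
    then show False using W unfolding image_section_diff by blast
  qed
  moreover have "y \<in> topspace (base B)"
    using y(1) B.compact_section_image(2)[OF W0(1)] compactin_subset_topspace by blast
  ultimately show thesis using that imp by blast
qed

text \<open>The base map comes from \<open>proper_hom_base_point\<close>. The value
  \<open>k x e\<close> is the point over \<open>x\<close> common to all \<open>\<phi> W\<close> with
  \<open>e\<close> in \<open>W\<close>: two such \<open>W\<close> contain a common smaller compact
  section through \<open>e\<close>, and \<open>\<phi>\<close> is monotone.\<close>

lemma push_surj:
  assumes \<phi>: "\<phi> \<in> proper_skew_hom SB SA"
  obtains h where "h \<in> etale_hom B A" "\<And>W. compact_section B W \<Longrightarrow> push A B h W = \<phi> W"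
proof -
  note E = B.etale A.etale
  have "\<phi> \<in> skew_hom SB SA" using \<phi> by (simp add: proper_skew_hom_def)
  note H = skew_homD[OF this, simplified]
  have "\<forall>x \<in> topspace (base A). \<exists>y. y \<in> topspace (base B) \<and>
      (\<forall>W. compact_section B W \<longrightarrow> (x \<in> proj A ` \<phi> W \<longleftrightarrow> y \<in> proj B ` W))"
    using proper_hom_base_point[OF \<phi>] by metis
  then obtain f0 where f0: "\<And>x. x \<in> topspace (base A) \<Longrightarrow> f0 x \<in> topspace (base B) \<and>
      (\<forall>W. compact_section B W \<longrightarrow> (x \<in> proj A ` \<phi> W \<longleftrightarrow> f0 x \<in> proj B ` W))"
    by metis
  define f where "f = restrict f0 (topspace (base A))"
  have f_top: "f x \<in> topspace (base B)" if "x \<in> topspace (base A)" for x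
    using f0 that by (simp add: f_def)
  have f_iff: "f x \<in> proj B ` W \<longleftrightarrow> x \<in> proj A ` \<phi> W"
    if "x \<in> topspace (base A)" "compact_section B W" for x W
    using f0 that by (simp add: f_def)
  have \<phi>_image: "{x \<in> topspace (base A). f x \<in> proj B ` W} = proj A ` \<phi> W"
    if W: "compact_section B W" for W
    using f_iff[OF _ W] A.compact_section_image(2)[OF H(1)[OF W]] compactin_subset_topspace by blast
  \<comment> \<open>Inclusion of sections is an equation of the algebra, \<open>V\<close> being the
    meet of \<open>W\<close> with \<open>V\<close>, and \<open>\<phi>\<close> preserves it.\<close>
  have mono: "\<phi> V \<subseteq> \<phi> W" if VW: "compact_section B V" "compact_section B W" "V \<subseteq> W" for V W
  proof -
    have "{e \<in> W. proj B e \<in> proj B ` V} = V"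
      using VW by (auto simp: compact_section_def inj_on_def)
    then have "\<phi> V = {e \<in> \<phi> W. proj A e \<in> proj A ` \<phi> V}" using H(2)[OF VW(2,1)] by simp
    then show ?thesis by blast
  qed
  have germ: "\<exists>a. a \<in> stalk A x \<and> (\<forall>W. compact_section B W \<and> e \<in> W \<longrightarrow> a \<in> \<phi> W)"
    if x: "x \<in> topspace (base A)" and e: "e \<in> stalk B (f x)" for x e
  proof -
    have pe: "proj B e = f x" "e \<in> topspace (total B)" using e by (auto simp: stalk_def)
    have pt: "\<exists>a. a \<in> \<phi> W \<and> proj A a = x" if W: "compact_section B W" "e \<in> W" for W
      using f_iff[OF x W(1)] W(2) pe by (metis (no_types, lifting) imageE imageI)
    obtain W0 where W0: "compact_section B W0" "e \<in> W0"
      using B.compact_section_nbhd[of "topspace (total B)" e] pe by auto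
    then obtain a where a: "a \<in> \<phi> W0" "proj A a = x" using pt by blast
    have "a \<in> \<phi> W" if W: "compact_section B W" "e \<in> W" for W
    proof -
      have "openin (total B) (W0 \<inter> W)" using W W0 by (auto simp: compact_section_def)
      then obtain V where V: "compact_section B V" "e \<in> V" "V \<subseteq> W0 \<inter> W"
        using B.compact_section_nbhd[of "W0 \<inter> W" e] W W0 by blast
      then obtain b where b: "b \<in> \<phi> V" "proj A b = x" using pt by blast
      have "b \<in> \<phi> W0" "b \<in> \<phi> W" using mono V W W0 b by blast+
      moreover have "inj_on (proj A) (\<phi> W0)" using H(1)[OF W0(1)] by (simp add: compact_section_def)
      ultimately have "a = b" using a b by (metis inj_onD)
      then show ?thesis using \<open>b \<in> \<phi> W\<close> by simp
    qed
    moreover have "a \<in> stalk A x"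
      using a A.compact_section_subset[OF H(1)[OF W0(1)]] by (auto simp: stalk_def)
    ultimately show ?thesis by blast
  qed
  define k where "k = (\<lambda>x \<in> topspace (base A). \<lambda>e \<in> stalk B (f x).
      SOME a. a \<in> stalk A x \<and> (\<forall>W. compact_section B W \<and> e \<in> W \<longrightarrow> a \<in> \<phi> W))"
  have k: "k x e \<in> stalk A x" "\<And>W. compact_section B W \<Longrightarrow> e \<in> W \<Longrightarrow> k x e \<in> \<phi> W"
    if "x \<in> topspace (base A)" "e \<in> stalk B (f x)" for x e
    using someI_ex[OF germ[OF that]] that by (auto simp: k_def)
  have push: "push A B (f, k) W = \<phi> W" if W: "compact_section B W" for W
  proof (intro equalityI subsetI)
    fix a assume "a \<in> push A B (f, k) W"
    then obtain x e where x: "x \<in> topspace (base A)" "e \<in> W" "proj B e = f x" "a = k x e"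
      by (auto simp: push_def)
    then have "e \<in> stalk B (f x)" using B.compact_section_subset[OF W] by (auto simp: stalk_def)
    then show "a \<in> \<phi> W" using k x W by simp
  next
    fix a assume a: "a \<in> \<phi> W"
    have \<phi>W: "compact_section A (\<phi> W)" using H(1) W by blast
    have x: "proj A a \<in> topspace (base A)" 
      using a A.compact_section_subset[OF \<phi>W] A.proj_in_base by blast
    then obtain e where e: "e \<in> W" "proj B e = f (proj A a)"
      using f_iff[OF x W] a by (metis (no_types, lifting) imageE imageI)
    then have st: "e \<in> stalk B (f (proj A a))"
      using B.compact_section_subset[OF W] by (auto simp: stalk_def)
    have "k (proj A a) e \<in> \<phi> W" "proj A (k (proj A a) e) = proj A a"
      using k[OF x st] W e by (auto simp: stalk_def)
    then have "k (proj A a) e = a" using \<phi>W a by (metis compact_section_def inj_onD)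
    then show "a \<in> push A B (f, k) W" using pushI[of "proj A a" A e W B f k] x e by simp
  qed
  have "openin (total A) (push A B (f, k) W)" if W: "open_section B W" for W
  proof -
    \<comment> \<open>Openness is known for compact sections, where \<open>push\<close> agrees with
      \<open>\<phi>\<close>; an arbitrary open section is the union of the compact ones inside
      it.\<close>
    let ?\<W> = "{V. compact_section B V \<and> V \<subseteq> W}"
    have "W = \<Union>?\<W>"
    proof (intro equalityI subsetI)
      fix e assume "e \<in> W"
      then show "e \<in> \<Union>?\<W>" using B.compact_section_nbhd[of W e] W by (auto simp: open_section_def)
    qed auto
    then have "push A B (f, k) W = (\<Union>V \<in> ?\<W>. push A B (f, k) V)" by (metis push_UN)
    also have "openin (total A) \<dots>"
      using H(1) by (intro openin_Union) (auto simp: push compact_section_def)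
    finally show ?thesis .
  qed
  moreover have "continuous_map (base A) (base B) f"
    unfolding continuous_map
  proof (intro conjI allI impI)
    show "f ` topspace (base A) \<subseteq> topspace (base B)" using f_top by blast
    fix U assume U: "openin (base B) U"
    show "openin (base A) {x \<in> topspace (base A). f x \<in> U}"
    proof (subst openin_subopen, intro ballI)
      fix x assume x: "x \<in> {x \<in> topspace (base A). f x \<in> U}"
      then obtain e where e: "e \<in> topspace (total B)" "proj B e = f x"
        using f_top B.stalk_nonempty[of "f x"] by blast
      \<comment> \<open>For a compact section \<open>W\<close> over \<open>U\<close>, the domain of
        \<open>\<phi> W\<close> is an open neighbourhood of \<open>x\<close> that \<open>f\<close>
        maps into \<open>U\<close>.\<close>
      then obtain W where W: "compact_section B W" "e \<in> W"
          "W \<subseteq> {e \<in> topspace (total B). proj B e \<in> U}"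
        using B.compact_section_nbhd[OF B.openin_vimage[OF U], of e] x by auto
      have "openin (base A) (proj A ` \<phi> W)" using H(1)[OF W(1)] A.compact_section_image by blast
      moreover have "x \<in> proj A ` \<phi> W" using W e x f_iff[of x W] by (metis (no_types, lifting) imageI mem_Collect_eq)
      moreover have "proj A ` \<phi> W \<subseteq> {x \<in> topspace (base A). f x \<in> U}"
        using W unfolding \<phi>_image[OF W(1), symmetric] by auto
      ultimately show "\<exists>T. openin (base A) T \<and> x \<in> T \<and> T \<subseteq> {x \<in> topspace (base A). f x \<in> U}"
        by blast
    qed
  qed
  note cont = this
  have "continuous_proper_map (base A) (base B) f"
    unfolding continuous_proper_map_def
  proof (intro conjI allI impI cont)
    fix K assume K: "compactin (base B) K"
    \<comment> \<open>The preimage of \<open>K\<close> is closed and contained in the compact domain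
      of \<open>\<phi> W\<close>.\<close>
    obtain W where W: "compact_section B W" "K \<subseteq> proj B ` W"
      using K by (rule B.compact_subset_section)
    have "closedin (base B) K" using K B.base_Hausdorff compactin_imp_closedin by blast
    then have "closedin (base A) {x \<in> topspace (base A). f x \<in> K}"
      using cont closedin_continuous_map_preimage by blast
    moreover have "compactin (base A) (proj A ` \<phi> W)"
      using H(1)[OF W(1)] A.compact_section_image by blast
    moreover have "{x \<in> topspace (base A). f x \<in> K} \<subseteq> proj A ` \<phi> W"
      using W unfolding \<phi>_image[OF W(1), symmetric] by auto
    ultimately show "compactin (base A) {x \<in> topspace (base A). f x \<in> K}"
      using closed_compactin by blast
  qed
  moreover have "k \<in> (\<Pi>\<^sub>E x \<in> topspace (base A). stalk B (f x) \<rightarrow>\<^sub>E stalk A x)"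
    using k(1) by (auto simp: PiE_iff k_def)
  ultimately have "(f, k) \<in> etale_hom B A"
    by (simp add: etale_hom_iff[OF E] f_def)
  then show thesis using that push by blast
qed

theorem push_bij:
  "bij_betw (\<lambda>h. restrict (push A B h) (carr SB)) (etale_hom B A) (proper_skew_hom SB SA)"
proof (rule bij_betw_imageI)
  show "inj_on (\<lambda>h. restrict (push A B h) (carr SB)) (etale_hom B A)"
  proof (rule inj_onI)
    fix h h' assume h: "h \<in> etale_hom B A" "h' \<in> etale_hom B A"
      and eq: "restrict (push A B h) (carr SB) = restrict (push A B h') (carr SB)"
    have "push A B h W = push A B h' W" if "compact_section B W" for W
      using fun_cong[OF eq, of W] that by simp
    then show "h = h'" using push_inj[OF h] by blast
  qed
  show "(\<lambda>h. restrict (push A B h) (carr SB)) ` etale_hom B A = proper_skew_hom SB SA"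
  proof (intro equalityI subsetI)
    fix \<phi> assume \<phi>: "\<phi> \<in> proper_skew_hom SB SA"
    then obtain h where h: "h \<in> etale_hom B A" "\<And>W. compact_section B W \<Longrightarrow> push A B h W = \<phi> W"
      using push_surj by blast
    have "\<phi> \<in> extensional (carr SB)"
      using \<phi> by (auto dest!: skew_hom_funcset simp: PiE_def)
    then have "restrict (push A B h) (carr SB) = \<phi>"
      using h(2) by (intro extensionalityI[of _ "carr SB"]) auto
    then show "\<phi> \<in> (\<lambda>h. restrict (push A B h) (carr SB)) ` etale_hom B A" using h(1) by blast
  qed (auto intro: push_proper_hom)
qed

end

section \<open>The spectrum of a left-handed skew Boolean algebra\<close>

context left_handed_skew_boolean_algebra
begin

text \<open>Being closed upwards for \<preceq>, such a set is a union of D-classes. These are the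
  proper filters of the maximal generalized Boolean algebra image, written as subsets of
  \<open>S\<close>.\<close>

definition proper_filter :: "'a set \<Rightarrow> bool" where
  "proper_filter F \<longleftrightarrow> F \<subseteq> carr S \<and> F \<noteq> {} \<and> \<zero> \<notin> F \<and>
     (\<forall>x \<in> F. \<forall>y \<in> carr S. x \<preceq> y \<longrightarrow> y \<in> F) \<and> (\<forall>x \<in> F. \<forall>y \<in> F. x \<sqinter> y \<in> F)"

definition ultra :: "'a set \<Rightarrow> bool" where
  "ultra P \<longleftrightarrow> proper_filter P \<and> (\<forall>x \<in> P. \<forall>y \<in> carr S. x \<sqinter> y \<in> P \<or> x \<ominus> y \<in> P)"

lemma proper_filterD:
  assumes "proper_filter F"
  shows "x \<in> F \<Longrightarrow> x \<in> carr S" "F \<noteq> {}" "\<zero> \<notin> F"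
    "x \<in> F \<Longrightarrow> y \<in> carr S \<Longrightarrow> x \<preceq> y \<Longrightarrow> y \<in> F"
    "x \<in> F \<Longrightarrow> y \<in> F \<Longrightarrow> x \<sqinter> y \<in> F"
  using assms by (auto simp: proper_filter_def)

lemma ultraD:
  assumes "ultra P"
  shows "proper_filter P" "x \<in> P \<Longrightarrow> x \<in> carr S" "P \<noteq> {}" "\<zero> \<notin> P"
    "x \<in> P \<Longrightarrow> y \<in> carr S \<Longrightarrow> x \<preceq> y \<Longrightarrow> y \<in> P"
    "x \<in> P \<Longrightarrow> y \<in> P \<Longrightarrow> x \<sqinter> y \<in> P"
    "x \<in> P \<Longrightarrow> y \<in> carr S \<Longrightarrow> x \<sqinter> y \<in> P \<or> x \<ominus> y \<in> P"
  using assms unfolding ultra_def proper_filter_def by blast+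

text \<open>Let \<open>G\<close> be generated by \<open>M\<close> and \<open>x \<sqinter> y\<close>.
  If \<open>G\<close> is proper, maximality puts \<open>x \<sqinter> y\<close> into
  \<open>M\<close>. If \<open>G\<close> contains zero, some \<open>p\<close> in \<open>M\<close> is
  disjoint from \<open>x \<sqinter> y\<close>; then
  \<open>p \<sqinter> x \<preceq> x \<ominus> y\<close> by \<open>preceq_diff\<close>, so
  \<open>x \<ominus> y\<close> is in \<open>M\<close>.\<close>

lemma maximal_filter_ultra:
  assumes M: "proper_filter M" and max: "\<And>G. proper_filter G \<Longrightarrow> M \<subseteq> G \<Longrightarrow> G = M"
  shows "ultra M"
  unfolding ultra_def
proof (intro conjI M ballI)
  fix x y assume x: "x \<in> M" and y [simp]: "y \<in> carr S"
  have [simp]: "p \<in> carr S" if "p \<in> M" for p using M that by (rule proper_filterD)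
  have [simp]: "x \<in> carr S" using x by simp
  show "x \<sqinter> y \<in> M \<or> x \<ominus> y \<in> M"
  proof (rule disjCI)
    assume nd: "x \<ominus> y \<notin> M"
    define G where "G = {s \<in> carr S. \<exists>p \<in> M. p \<sqinter> (x \<sqinter> y) \<preceq> s}"
    have sub: "M \<subseteq> G"
    proof
      fix s assume s: "s \<in> M"
      then have "s \<sqinter> (x \<sqinter> y) \<preceq> s" by (intro meet_preceq1) auto
      then show "s \<in> G" using s proper_filterD(1)[OF M s] unfolding G_def by blast
    qed
    have xy: "x \<sqinter> y \<in> G" using x by (auto simp: G_def)
    have "proper_filter G"
      unfolding proper_filter_def
    proof (intro conjI ballI impI)
      show "G \<subseteq> carr S" by (auto simp: G_def)
      show "G \<noteq> {}" using xy by blast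
      show "\<zero> \<notin> G"
      proof
        assume "\<zero> \<in> G"
        then obtain p where p: "p \<in> M" "p \<sqinter> (x \<sqinter> y) = \<zero>" by (auto simp: G_def)
        have "p \<sqinter> x \<in> M" using M p x by (intro proper_filterD(5))
        moreover have "p \<sqinter> x \<preceq> x \<ominus> y"
        proof (rule preceq_diff)
          show "p \<sqinter> x \<sqinter> y = \<zero>" using p x by (simp add: meet_assoc)
        qed (use p x in auto)
        ultimately have "x \<ominus> y \<in> M" using proper_filterD(4)[OF M, of "p \<sqinter> x" "x \<ominus> y"] by simp
        then show False using nd by blast
      qed
      show "t \<in> G" if st: "s \<in> G" "t \<in> carr S" "s \<preceq> t" for s t
      proof -
        obtain p where p: "p \<in> M" "p \<sqinter> (x \<sqinter> y) \<preceq> s" "s \<in> carr S" using st by (auto simp: G_def)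
        then have "p \<sqinter> (x \<sqinter> y) \<preceq> t"
          using preceq_trans[of "p \<sqinter> (x \<sqinter> y)" s t] st by simp
        then show ?thesis using p st by (auto simp: G_def)
      qed
      show "s \<sqinter> t \<in> G" if st: "s \<in> G" "t \<in> G" for s t
      proof -
        obtain p q where p: "p \<in> M" "p \<sqinter> (x \<sqinter> y) \<preceq> s" "s \<in> carr S"
          and q: "q \<in> M" "q \<sqinter> (x \<sqinter> y) \<preceq> t" "t \<in> carr S" using st by (auto simp: G_def)
        define z where "z = x \<sqinter> y"
        have [simp]: "z \<in> carr S" by (simp add: z_def)
        have "(p \<sqinter> z) \<sqinter> (q \<sqinter> z) = p \<sqinter> z \<sqinter> q \<sqinter> z"
          using p q meet_assoc[of "p \<sqinter> z" q z] by simp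
        also have "\<dots> = p \<sqinter> z \<sqinter> q"
          using p q meet_right_commute[of "p \<sqinter> z" q z] by simp
        also have "\<dots> = p \<sqinter> q \<sqinter> z" using p q by (intro meet_right_commute) auto
        finally have "p \<sqinter> q \<sqinter> (x \<sqinter> y) \<preceq> s \<sqinter> t"
          using meet_preceq_mono[OF p(2) q(2)] p q by (simp add: z_def)
        moreover have "p \<sqinter> q \<in> M" using M p q by (intro proper_filterD(5))
        ultimately show ?thesis using p q by (auto simp: G_def)
      qed
    qed
    then have "G = M" using max sub by blast
    then show "x \<sqinter> y \<in> M" using xy by simp
  qed
qed

lemma filter_extends:
  assumes F: "proper_filter F"
  obtains P where "ultra P" "F \<subseteq> P"
proof -
  let ?A = "{G. proper_filter G \<and> F \<subseteq> G}"
  have "\<exists>M \<in> ?A. \<forall>X \<in> ?A. M \<subseteq> X \<longrightarrow> X = M"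
  proof (rule subset_Zorn_nonempty)
    show "?A \<noteq> {}" using F by blast
    fix \<C> assume ne: "\<C> \<noteq> {}" and chain: "subset.chain ?A \<C>"
    have pf: "proper_filter G" "F \<subseteq> G" if "G \<in> \<C>" for G
      using that chain by (auto simp: subset.chain_def)
    have cmp: "G \<subseteq> H \<or> H \<subseteq> G" if "G \<in> \<C>" "H \<in> \<C>" for G H
      using that chain by (simp add: subset_chain_def)
    have "proper_filter (\<Union>\<C>)"
      unfolding proper_filter_def
    proof (intro conjI ballI impI)
      show "\<Union>\<C> \<subseteq> carr S" "\<zero> \<notin> \<Union>\<C>" using pf(1) proper_filterD by blast+
      show "\<Union>\<C> \<noteq> {}" using ne pf(1) proper_filterD(2) by blast
      show "y \<in> \<Union>\<C>" if "x \<in> \<Union>\<C>" "y \<in> carr S" "x \<preceq> y" for x y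
        using that pf(1) proper_filterD(4) by blast
      show "x \<sqinter> y \<in> \<Union>\<C>" if xy: "x \<in> \<Union>\<C>" "y \<in> \<Union>\<C>" for x y
      proof -
        obtain G H where G: "G \<in> \<C>" "x \<in> G" "H \<in> \<C>" "y \<in> H" using xy by blast
        then consider "x \<in> H" | "y \<in> G" using cmp by blast
        then show ?thesis using G pf(1) proper_filterD(5) by cases blast+
      qed
    qed
    then show "\<Union>\<C> \<in> ?A" using ne pf(2) by auto
  qed
  then obtain M where M: "M \<in> ?A" and max: "\<forall>X \<in> ?A. M \<subseteq> X \<longrightarrow> X = M" by (elim bexE)
  have "ultra M"
  proof (rule maximal_filter_ultra)
    fix G assume G: "proper_filter G" "M \<subseteq> G"
    then have "G \<in> ?A" using M by auto
    then show "G = M" using max G(2) by simp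
  qed (use M in simp)
  then show thesis using that M by simp
qed

definition points :: "'a \<Rightarrow> 'a set set" where
  "points a = {P. ultra P \<and> a \<in> P}"

lemma points_iff: "P \<in> points a \<longleftrightarrow> ultra P \<and> a \<in> P"
  by (simp add: points_def)

lemma points_zero [simp]: "points \<zero> = {}"
  by (auto simp: points_def dest: ultraD(4))

lemma points_mono:
  assumes "a \<preceq> b" "b \<in> carr S"
  shows "points a \<subseteq> points b"
  using assms ultraD(5) by (auto simp: points_def)

lemma points_meet:
  assumes "a \<in> carr S" "b \<in> carr S"
  shows "points (a \<sqinter> b) = points a \<inter> points b"
  using points_mono[of "a \<sqinter> b" a] points_mono[of "a \<sqinter> b" b] assms ultraD(6)
  by (auto simp: points_iff)

lemma points_diff:
  assumes "a \<in> carr S" "b \<in> carr S"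
  shows "points (a \<ominus> b) = points a - points b"
proof -
  have "points (a \<ominus> b) \<subseteq> points a" using assms by (intro points_mono) (auto simp: diff_le)
  moreover have "points (a \<ominus> b) \<inter> points b = {}"
    using assms by (simp flip: points_meet add: diff_meet)
  moreover have "P \<in> points (a \<ominus> b)" if "P \<in> points a - points b" for P
  proof -
    have P: "ultra P" "a \<in> P" "b \<notin> P" using that by (auto simp: points_iff)
    have "a \<sqinter> b \<notin> P" using ultraD(5)[OF P(1), of "a \<sqinter> b" b] P(3) assms by auto
    then show ?thesis using ultraD(7)[OF P(1,2) assms(2)] P(1) by (simp add: points_iff)
  qed
  ultimately show ?thesis by blast
qed

text \<open>The part of \<open>a \<squnion> b\<close> outside \<open>a\<close> is below
  \<open>b\<close> by \<open>preceq_join_cases\<close>; on points this says that ultrafilters are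
  prime.\<close>

lemma points_join:
  assumes [simp]: "a \<in> carr S" "b \<in> carr S"
  shows "points (a \<squnion> b) = points a \<union> points b"
proof -
  have "(a \<squnion> b) \<ominus> a \<preceq> b"
    by (rule preceq_join_cases[of _ a]) (auto simp: diff_meet diff_le)
  then have "points (a \<squnion> b) - points a \<subseteq> points b"
    using points_mono by (simp flip: points_diff)
  moreover have "points a \<subseteq> points (a \<squnion> b)" "points b \<subseteq> points (a \<squnion> b)"
    using points_mono[OF preceq_join1[of a b]] points_mono[OF preceq_join2[of a b]] by simp_all
  ultimately show ?thesis by blast
qed

text \<open>If \<open>a \<preceq> b\<close> fails, then \<open>a \<ominus> b\<close> is nonzero, and
  an ultrafilter through it contains \<open>a\<close> but not \<open>b\<close>.\<close>

lemma points_subset_iff: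
  assumes [simp]: "a \<in> carr S" "b \<in> carr S"
  shows "points a \<subseteq> points b \<longleftrightarrow> a \<preceq> b"
proof
  assume sub: "points a \<subseteq> points b"
  show "a \<preceq> b"
  proof (rule ccontr)
    assume "\<not> a \<preceq> b"
    then have ne: "a \<ominus> b \<noteq> \<zero>" using diff_eq_zero_imp_preceq[of a b] by auto
    let ?F = "{s \<in> carr S. a \<ominus> b \<preceq> s}"
    have "proper_filter ?F"
      unfolding proper_filter_def
    proof (intro conjI ballI impI)
      have "a \<ominus> b \<in> ?F" by simp
      then show "?F \<noteq> {}" by blast
      show "\<zero> \<notin> ?F" using ne by auto
      show "y \<in> ?F" if "x \<in> ?F" "y \<in> carr S" "x \<preceq> y" for x y
        using that preceq_trans[of "a \<ominus> b" x y] by simp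
      show "x \<sqinter> y \<in> ?F" if "x \<in> ?F" "y \<in> ?F" for x y
        using that by (simp flip: meet_assoc)
    qed auto
    then obtain P where P: "ultra P" "?F \<subseteq> P" by (rule filter_extends)
    then have "P \<in> points (a \<ominus> b)" by (auto simp: points_iff)
    then show False using sub by (auto simp: points_diff)
  qed
qed (simp add: points_mono)

text \<open>Equal point sets only mean that \<open>x\<close> and \<open>y\<close> are D-related;
  since meets commute below \<open>z\<close>, this already forces equality.\<close>

lemma down_set_eqI:
  assumes "x \<in> down_set S z" "y \<in> down_set S z" "z \<in> carr S" "points x = points y"
  shows "x = y"
proof -
  have xy: "x \<in> carr S" "y \<in> carr S" using assms(1,2) by (auto simp: down_set_iff)
  then have "x \<preceq> y" "y \<preceq> x" using points_subset_iff assms(4) by blast+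
  then show ?thesis using down_set_commute(1)[OF assms(3,1,2)] by simp
qed

text \<open>Both sides lie below \<open>q\<close>, so the identity can be checked on points, where
  it is distributivity of sets.\<close>

lemma meet_join_distrib:
  assumes "q \<in> carr S" "a \<in> carr S" "b \<in> carr S"
  shows "q \<sqinter> (a \<squnion> b) = (q \<sqinter> a) \<squnion> (q \<sqinter> b)"
proof (rule down_set_eqI[of _ q])
  show "q \<sqinter> (a \<squnion> b) \<in> down_set S q" using assms by (intro meet_in_down_set) auto
  show "(q \<sqinter> a) \<squnion> (q \<sqinter> b) \<in> down_set S q"
    using assms by (intro down_set_closed(2) meet_in_down_set) auto
  show "points (q \<sqinter> (a \<squnion> b)) = points ((q \<sqinter> a) \<squnion> (q \<sqinter> b))"
    using assms by (auto simp: points_meet points_join)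
qed (use assms in auto)

text \<open>Compactness of \<open>points a\<close>: a property that is stable under joins and holds locally on
  \<open>points a\<close> holds on all of it.\<close>

lemma points_compact:
  assumes a [simp]: "a \<in> carr S" and zero: "Q \<zero>"
    and join: "\<And>x y. x \<in> carr S \<Longrightarrow> y \<in> carr S \<Longrightarrow> Q x \<Longrightarrow> Q y \<Longrightarrow> Q (x \<squnion> y)"
    and cover: "\<And>P. P \<in> points a \<Longrightarrow> \<exists>b \<in> P. Q b"
  obtains c where "c \<in> carr S" "Q c" "a \<preceq> c"
proof (rule ccontr)
  assume nt: "\<not> thesis"
  note main = that
  have none: "\<not> a \<preceq> c" if "c \<in> carr S" "Q c" for c using main[of c] that nt by blast
  \<comment> \<open>If no \<open>c\<close> worked, the differences \<open>a \<ominus> c\<close> with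
    \<open>Q c\<close> would generate a proper filter, joins of such \<open>c\<close> providing the
    meets. An ultrafilter above it lies in \<open>points a\<close> but contains no \<open>b\<close>
    with \<open>Q b\<close>, contrary to \<open>cover\<close>.\<close>
  let ?F = "{s \<in> carr S. \<exists>c \<in> carr S. Q c \<and> a \<ominus> c \<preceq> s}"
  have diff: "a \<ominus> c \<in> ?F" if "c \<in> carr S" "Q c" for c using that by auto
  have "proper_filter ?F"
    unfolding proper_filter_def
  proof (intro conjI ballI impI)
    show "?F \<noteq> {}" using diff[OF zero_closed zero] by blast
    show "\<zero> \<notin> ?F"
    proof
      assume "\<zero> \<in> ?F"
      then obtain c where "c \<in> carr S" "Q c" "a \<ominus> c = \<zero>" by auto
      then show False using none diff_eq_zero_imp_preceq[of a c] by simp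
    qed
    show "y \<in> ?F" if xy: "x \<in> ?F" "y \<in> carr S" "x \<preceq> y" for x y
    proof -
      obtain c where "c \<in> carr S" "Q c" "a \<ominus> c \<preceq> x" using xy by blast
      moreover from this have "a \<ominus> c \<preceq> y" using xy preceq_trans[of "a \<ominus> c" x y] by simp
      ultimately show ?thesis using xy by blast
    qed
    show "x \<sqinter> y \<in> ?F" if xy: "x \<in> ?F" "y \<in> ?F" for x y
    proof -
      obtain c d where c: "c \<in> carr S" "Q c" "a \<ominus> c \<preceq> x" and d: "d \<in> carr S" "Q d" "a \<ominus> d \<preceq> y"
        using xy by blast
      have [simp]: "x \<in> carr S" "y \<in> carr S" using xy by auto
      have "points (a \<ominus> c) \<subseteq> points x" "points (a \<ominus> d) \<subseteq> points y"
        using c d by (simp_all add: points_subset_iff)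
      then have "points (a \<ominus> (c \<squnion> d)) \<subseteq> points (x \<sqinter> y)"
        using c d by (auto simp: points_diff points_join points_meet)
      then have "a \<ominus> (c \<squnion> d) \<preceq> x \<sqinter> y" using c d by (simp add: points_subset_iff)
      then show ?thesis using join c d by (auto intro!: bexI[of _ "c \<squnion> d"])
    qed
  qed auto
  then obtain P where P: "ultra P" "?F \<subseteq> P" by (rule filter_extends)
  have Pd: "P \<in> points (a \<ominus> c)" if "c \<in> carr S" "Q c" for c
    using diff[OF that] P by (auto simp: points_iff)
  then have "P \<in> points a" using Pd[OF zero_closed zero] by (simp add: points_diff)
  then obtain b where b: "b \<in> P" "Q b" using cover by blast
  then have "b \<in> carr S" using P ultraD(2) by blast
  then have "P \<notin> points b" using Pd[of b] b by (simp add: points_diff)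
  then show False using P b by (simp add: points_iff)
qed

text \<open>A meet on the right restricts the domain, so
  \<open>b \<sqinter> p = a \<sqinter> p\<close> says that \<open>a\<close> and \<open>b\<close>
  coincide on \<open>p\<close>. For an ultrafilter \<open>P\<close> containing \<open>a\<close>, all
  members of the germ lie in \<open>P\<close>, by \<open>germ_subset\<close>.\<close>

definition germ :: "'a set \<Rightarrow> 'a \<Rightarrow> 'a set" where
  "germ P a = {b \<in> carr S. \<exists>p \<in> P. b \<sqinter> p = a \<sqinter> p}"

definition germs :: "'a \<Rightarrow> 'a set set" where
  "germs a = (\<lambda>P. germ P a) ` points a"

text \<open>The upward closure of a germ is the ultrafilter at which it was taken, by
  \<open>germ_base_germ\<close>. A germ therefore carries its base point with it and need not be
  paired with it.\<close>

definition germ_base :: "'a set \<Rightarrow> 'a set" where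
  "germ_base G = {x \<in> carr S. \<exists>g \<in> G. g \<preceq> x}"

definition spectrum :: "('a set, 'a set) etale" where
  "spectrum =
     \<lparr>total = topology (arbitrary union_of (\<lambda>U. U \<in> germs ` carr S)),
      base = topology (arbitrary union_of (\<lambda>U. U \<in> points ` carr S)),
      proj = germ_base\<rparr>"

lemma germ_self: "ultra P \<Longrightarrow> a \<in> P \<Longrightarrow> a \<in> germ P a"
  using ultraD(2) by (auto simp: germ_def)

lemma germ_subset:
  assumes P: "ultra P" and a: "a \<in> P" and b: "b \<in> germ P a"
  shows "b \<in> P"
proof -
  obtain p where p: "p \<in> P" "b \<sqinter> p = a \<sqinter> p" "b \<in> carr S" using b by (auto simp: germ_def)
  then have "b \<sqinter> p \<in> P" using ultraD(6)[OF P a p(1)] by simp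
  moreover have "b \<sqinter> p \<preceq> b"
    using p ultraD(2)[OF P] by (intro meet_preceq1) auto
  ultimately show ?thesis using ultraD(5)[OF P] p by blast
qed

lemma germ_eqI:
  assumes P: "ultra P" and a: "a \<in> P" and b: "b \<in> germ P a"
  shows "germ P b = germ P a"
proof -
  have trans: "c \<in> germ P a" if c: "c \<in> germ P b" and b: "b \<in> germ P a"
    and ab: "a \<in> carr S" for a b c
  proof -
    obtain p where p: "p \<in> P" "b \<sqinter> p = a \<sqinter> p" "b \<in> carr S" using b by (auto simp: germ_def)
    obtain q where q: "q \<in> P" "c \<sqinter> q = b \<sqinter> q" "c \<in> carr S" using c by (auto simp: germ_def)
    have [simp]: "p \<in> carr S" "q \<in> carr S" using p q ultraD(2)[OF P] by auto
    \<comment> \<open>Both agreements hold on \<open>q \<sqinter> p\<close>, which is again a member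
      of \<open>P\<close>; right commutation reorders the restrictions.\<close>
    have "c \<sqinter> (q \<sqinter> p) = b \<sqinter> q \<sqinter> p" using p q by (simp flip: meet_assoc)
    also have "\<dots> = a \<sqinter> p \<sqinter> q" using p q by (simp add: meet_right_commute[of b])
    also have "\<dots> = a \<sqinter> (q \<sqinter> p)"
      using ab meet_right_commute[of a p q] meet_assoc[of a q p] by simp
    finally show ?thesis using p q ultraD(6)[OF P] by (auto simp: germ_def)
  qed
  have "b \<in> carr S" "a \<in> carr S" using germ_subset[OF assms] a ultraD(2)[OF P] by auto
  moreover have "a \<in> germ P b" using b \<open>a \<in> carr S\<close> by (auto simp: germ_def) metis
  ultimately show ?thesis using trans b by blast
qed

lemma germ_eq_below:
  assumes P: "ultra P" and c: "c \<in> P" and a: "a \<in> carr S" "a \<sqinter> c = c"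
  shows "germ P c = germ P a"
proof -
  have "c \<in> carr S" using P c ultraD(2) by blast
  then have "a \<in> germ P c" using a c by (auto simp: germ_def intro!: bexI[of _ c])
  then show ?thesis using germ_eqI[OF P c] by blast
qed

text \<open>For \<open>x\<close> in \<open>P\<close>, the element \<open>a \<sqinter> x\<close>
  belongs to the germ of \<open>a\<close> and satisfies
  \<open>a \<sqinter> x \<preceq> x\<close>.\<close>

lemma germ_base_germ [simp]:
  assumes P: "ultra P" and a: "a \<in> P"
  shows "germ_base (germ P a) = P"
proof (intro equalityI subsetI)
  fix x assume "x \<in> germ_base (germ P a)"
  then show "x \<in> P"
    using germ_subset[OF P a] ultraD(5)[OF P] by (auto simp: germ_base_def)
next
  fix x assume x: "x \<in> P"
  have [simp]: "x \<in> carr S" "a \<in> carr S" using x a ultraD(2)[OF P] by auto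
  have "a \<sqinter> x \<in> germ P a" using x by (auto simp: germ_def intro!: bexI[of _ x])
  moreover have "a \<sqinter> x \<preceq> x" by (rule meet_right_same) auto
  ultimately show "x \<in> germ_base (germ P a)" unfolding germ_base_def using \<open>x \<in> carr S\<close> by blast
qed

lemma germ_base_image: "germ_base ` germs a = points a"
  by (auto simp: germs_def points_iff image_image)

lemma germ_base_in_points: "G \<in> germs a \<Longrightarrow> germ_base G \<in> points a"
  by (simp add: imageI flip: germ_base_image)

lemma germs_iff:
  assumes "P \<in> points b"
  shows "germ P b \<in> germs a \<longleftrightarrow> a \<in> germ P b"
proof
  assume "germ P b \<in> germs a"
  then obtain Q where Q: "germ P b = germ Q a" "Q \<in> points a" by (auto simp: germs_def)
  then show "a \<in> germ P b" using germ_self by (simp add: points_iff)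
next
  assume a: "a \<in> germ P b"
  have P: "ultra P" "b \<in> P" using assms by (auto simp: points_iff)
  have "germ P a = germ P b" "a \<in> P" using germ_eqI[OF P a] germ_subset[OF P a] by auto
  then show "germ P b \<in> germs a" using P(1) by (auto simp: germs_def points_iff)
qed

lemma inj_on_germ_base: "inj_on germ_base (germs a)"
  by (auto simp: inj_on_def germs_def points_iff)

text \<open>By left-handedness \<open>a \<sqinter> c = c\<close> says that \<open>c\<close> is below
  \<open>a\<close> in the natural order, that is, \<open>c\<close> is a restriction of
  \<open>a\<close>. The formulas for meet, difference and join are all reduced to this case.\<close>

lemma germs_below:
  assumes a: "a \<in> carr S" "c \<in> carr S" "a \<sqinter> c = c"
  shows "germs c = {G \<in> germs a. germ_base G \<in> points c}"
proof (intro equalityI subsetI)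
  fix G assume "G \<in> germs c"
  then obtain P where P: "ultra P" "c \<in> P" "G = germ P c" by (auto simp: germs_def points_iff)
  have "c \<preceq> a" using a meet_preceq1[of a c] by simp
  then have "a \<in> P" using ultraD(5)[OF P(1,2)] a by blast
  then show "G \<in> {G \<in> germs a. germ_base G \<in> points c}"
    using P germ_eq_below[OF P(1,2) a(1,3)] by (auto simp: germs_def points_iff)
next
  fix G assume "G \<in> {G \<in> germs a. germ_base G \<in> points c}"
  then obtain P where P: "ultra P" "a \<in> P" "G = germ P a" "c \<in> P"
    by (auto simp: germs_def points_iff)
  then show "G \<in> germs c"
    using germ_eq_below[OF P(1,4) a(1,3)] by (auto simp: germs_def points_iff)
qed

lemma germs_meet:
  assumes "a \<in> carr S" "b \<in> carr S"
  shows "germs (a \<sqinter> b) = {G \<in> germs a. germ_base G \<in> germ_base ` germs b}"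
proof -
  show ?thesis
    using germ_base_in_points[of _ a] assms germs_below[of a "a \<sqinter> b"] by (auto simp: germ_base_image points_meet)
qed

lemma germs_diff:
  assumes "a \<in> carr S" "b \<in> carr S"
  shows "germs (a \<ominus> b) = {G \<in> germs a. germ_base G \<notin> germ_base ` germs b}"
proof -
  show ?thesis
    using germ_base_in_points[of _ a] assms germs_below[of a "a \<ominus> b"] by (auto simp: germ_base_image points_diff diff_le)
qed

text \<open>The restriction of \<open>a \<squnion> b\<close> to the complement of \<open>b\<close> is \<open>a \<ominus> b\<close>, because
  \<open>a \<ominus> b\<close> and \<open>b\<close> are orthogonal, hence commute by symmetry, and so
  \<open>a \<squnion> b = (a \<sqinter> b) \<squnion> b \<squnion> (a \<ominus> b) = (a \<ominus> b) \<squnion> b = b \<squnion> (a \<ominus> b)\<close>.\<close>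

lemma join_meet_diff:
  assumes [simp]: "a \<in> carr S" "b \<in> carr S"
  shows "(a \<squnion> b) \<sqinter> (a \<ominus> b) = a \<ominus> b"
proof -
  have comm: "(a \<ominus> b) \<squnion> b = b \<squnion> (a \<ominus> b)"
    by (subst symmetric) (auto simp: diff_meet)
  have "a \<squnion> b = (a \<sqinter> b) \<squnion> ((a \<ominus> b) \<squnion> b)"
    using meet_join_diff[of a b] by (simp flip: join_assoc)
  also have "\<dots> = ((a \<sqinter> b) \<squnion> b) \<squnion> (a \<ominus> b)" by (simp add: comm join_assoc)
  also have "(a \<sqinter> b) \<squnion> b = b" by (rule preceq_join_eq) auto
  finally show ?thesis by (simp add: join_meet_right)
qed

text \<open>Both \<open>b\<close> and \<open>a \<ominus> b\<close> are restrictions of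
  \<open>a \<squnion> b\<close>, and their points exhaust those of
  \<open>a \<squnion> b\<close>.\<close>

lemma germs_join:
  assumes [simp]: "a \<in> carr S" "b \<in> carr S"
  shows "germs (a \<squnion> b) = germs b \<union> {G \<in> germs a. germ_base G \<notin> germ_base ` germs b}"
proof -
  have b: "germs b = {G \<in> germs (a \<squnion> b). germ_base G \<in> points b}"
    by (rule germs_below) (auto simp: join_meet_right)
  have d: "germs (a \<ominus> b) = {G \<in> germs (a \<squnion> b). germ_base G \<in> points (a \<ominus> b)}"
    by (rule germs_below) (auto simp: join_meet_diff)
  have "germ_base G \<in> points a \<union> points b" if "G \<in> germs (a \<squnion> b)" for G
    using germ_base_in_points[OF that] by (simp add: points_join)
  then have "germs (a \<squnion> b) = germs b \<union> germs (a \<ominus> b)"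
    unfolding b d by (auto simp: points_diff)
  then show ?thesis by (simp add: germs_diff)
qed

text \<open>Equal germs at \<open>P\<close> mean agreement on some \<open>p\<close> in
  \<open>P\<close>, so \<open>a \<sqinter> p\<close> is a common restriction. The intersection
  itself need not be of the form \<open>germs c\<close>, so the base property is obtained
  pointwise.\<close>

lemma germs_Int:
  assumes "a \<in> carr S" "b \<in> carr S" "G \<in> germs a \<inter> germs b"
  obtains c where "c \<in> carr S" "G \<in> germs c" "germs c \<subseteq> germs a \<inter> germs b"
proof -
  obtain P where P: "ultra P" "a \<in> P" "G = germ P a"
    using assms(3) by (auto simp: germs_def points_iff)
  then have "b \<in> germ P a" using germs_iff[of P a b] assms(3) by (auto simp: points_iff)
  then obtain p where p: "p \<in> P" "b \<sqinter> p = a \<sqinter> p" by (auto simp: germ_def)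
  have [simp]: "p \<in> carr S" using p P ultraD(2) by blast
  have "germs (a \<sqinter> p) \<subseteq> germs a" using germs_below[of a "a \<sqinter> p"] assms by auto
  moreover have "b \<sqinter> (a \<sqinter> p) = a \<sqinter> p" using meet_meet_same[of b p] p assms by simp
  then have "germs (a \<sqinter> p) \<subseteq> germs b" using germs_below[of b "a \<sqinter> p"] assms by auto
  moreover have "a \<sqinter> p \<in> P" using P p ultraD(6) by blast
  then have "G \<in> germs (a \<sqinter> p)"
    using P assms germ_eq_below[OF P(1), of "a \<sqinter> p" a] by (auto simp: germs_def points_iff)
  ultimately show thesis using that[of "a \<sqinter> p"] assms by auto
qed

lemma spectrum_simps [simp]: "proj spectrum = germ_base"
  by (simp add: spectrum_def)

section \<open>Topology of the spectrum\<close>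

lemma openin_base_spectrum:
  "openin (base spectrum) = arbitrary union_of (\<lambda>U. U \<in> points ` carr S)"
proof -
  have "istopology (arbitrary union_of (\<lambda>U. U \<in> points ` carr S))"
  proof (rule istopology_base)
    fix U V assume "U \<in> points ` carr S" "V \<in> points ` carr S"
    then show "U \<inter> V \<in> points ` carr S" by (auto simp flip: points_meet)
  qed
  then show ?thesis by (simp add: spectrum_def topology_inverse')
qed

lemma openin_total_spectrum:
  "openin (total spectrum) = arbitrary union_of (\<lambda>U. U \<in> germs ` carr S)"
proof -
  have "istopology (arbitrary union_of (\<lambda>U. U \<in> germs ` carr S))"
    unfolding istopology_base_eq
  proof (intro allI impI)
    fix U V assume "U \<in> germs ` carr S \<and> V \<in> germs ` carr S"
    then obtain a b where ab: "a \<in> carr S" "b \<in> carr S" "U = germs a" "V = germs b" by blast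
    show "(arbitrary union_of (\<lambda>U. U \<in> germs ` carr S)) (U \<inter> V)"
      unfolding arbitrary_union_of_alt
    proof
      fix G assume "G \<in> U \<inter> V"
      then obtain c where "c \<in> carr S" "G \<in> germs c" "germs c \<subseteq> germs a \<inter> germs b"
        using germs_Int ab by metis
      then show "\<exists>W. W \<in> germs ` carr S \<and> G \<in> W \<and> W \<subseteq> U \<inter> V" using ab by blast
    qed
  qed
  then show ?thesis by (simp add: spectrum_def topology_inverse')
qed

lemma openin_base_iff:
  "openin (base spectrum) U \<longleftrightarrow> (\<forall>P \<in> U. \<exists>a \<in> carr S. P \<in> points a \<and> points a \<subseteq> U)"
  unfolding openin_base_spectrum arbitrary_union_of_alt by blast

lemma openin_total_iff:
  "openin (total spectrum) U \<longleftrightarrow> (\<forall>G \<in> U. \<exists>a \<in> carr S. G \<in> germs a \<and> germs a \<subseteq> U)"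
  unfolding openin_total_spectrum arbitrary_union_of_alt by blast

lemma openin_points: "a \<in> carr S \<Longrightarrow> openin (base spectrum) (points a)"
  by (auto simp: openin_base_iff)

lemma openin_germs: "a \<in> carr S \<Longrightarrow> openin (total spectrum) (germs a)"
  by (auto simp: openin_total_iff)

lemma topspace_base_spectrum: "topspace (base spectrum) = {P. ultra P}"
proof (intro equalityI subsetI)
  fix P assume "P \<in> topspace (base spectrum)"
  then show "P \<in> {P. ultra P}"
    using openin_topspace[of "base spectrum"] unfolding openin_base_iff by (auto simp: points_iff)
next
  fix P assume "P \<in> {P. ultra P}"
  then obtain a where "a \<in> P" "ultra P" using ultraD(3) by blast
  then have "P \<in> points a" "a \<in> carr S" using ultraD(2) by (auto simp: points_iff)
  then show "P \<in> topspace (base spectrum)" using openin_points openin_subset by blast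
qed

lemma topspace_total_spectrum: "topspace (total spectrum) = (\<Union>a \<in> carr S. germs a)"
proof (intro equalityI subsetI)
  fix G assume "G \<in> topspace (total spectrum)"
  then show "G \<in> (\<Union>a \<in> carr S. germs a)"
    using openin_topspace[of "total spectrum"] unfolding openin_total_iff by auto
next
  fix G assume "G \<in> (\<Union>a \<in> carr S. germs a)"
  then show "G \<in> topspace (total spectrum)" using openin_germs openin_subset by blast
qed

lemma compactin_points:
  assumes a: "a \<in> carr S"
  shows "compactin (base spectrum) (points a)"
  unfolding compactin_def
proof (intro conjI allI impI)
  show "points a \<subseteq> topspace (base spectrum)"
    using openin_points[OF a] openin_subset by blast
  fix \<U> assume U: "Ball \<U> (openin (base spectrum)) \<and> points a \<subseteq> \<Union>\<U>"
  \<comment> \<open>Having a finite subcover is stable under joins by \<open>points_join\<close> and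
    holds near each point, so \<open>points_compact\<close> applies.\<close>
  define Q where "Q c \<longleftrightarrow> (\<exists>\<F>. finite \<F> \<and> \<F> \<subseteq> \<U> \<and> points c \<subseteq> \<Union>\<F>)" for c
  obtain c where c: "c \<in> carr S" "Q c" "a \<preceq> c"
  proof (rule points_compact[OF a, of Q])
    show "Q \<zero>" by (auto simp: Q_def)
    fix x y assume xy: "x \<in> carr S" "y \<in> carr S" "Q x" "Q y"
    then obtain \<F> \<G> where "finite \<F>" "\<F> \<subseteq> \<U>" "points x \<subseteq> \<Union>\<F>" "finite \<G>" "\<G> \<subseteq> \<U>" "points y \<subseteq> \<Union>\<G>"
      by (auto simp: Q_def)
    then show "Q (x \<squnion> y)"
      unfolding Q_def points_join[OF xy(1,2)] by (intro exI[of _ "\<F> \<union> \<G>"]) auto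
  next
    fix P assume "P \<in> points a"
    then obtain V where V: "V \<in> \<U>" "P \<in> V" using U by blast
    then obtain b where "b \<in> carr S" "P \<in> points b" "points b \<subseteq> V"
      using U unfolding openin_base_iff by blast
    then show "\<exists>b \<in> P. Q b" using V by (auto simp: Q_def points_iff intro!: bexI[of _ b] exI[of _ "{V}"])
  qed
  obtain \<F> where \<F>: "finite \<F>" "\<F> \<subseteq> \<U>" "points c \<subseteq> \<Union>\<F>" using c(2) unfolding Q_def by auto
  moreover have "points a \<subseteq> \<Union>\<F>" using points_mono[OF c(3,1)] \<F>(3) by (rule subset_trans)
  ultimately show "\<exists>\<F>. finite \<F> \<and> \<F> \<subseteq> \<U> \<and> points a \<subseteq> \<Union>\<F>" by auto
qed

text \<open>If \<open>a\<close> is in \<open>P\<close> but not in \<open>Q\<close>, and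
  \<open>b\<close> is any member of \<open>Q\<close>, then \<open>a\<close> and
  \<open>b \<ominus> a\<close> give disjoint neighbourhoods.\<close>

lemma Hausdorff_spectrum: "Hausdorff_space (base spectrum)"
  unfolding Hausdorff_space_def topspace_base_spectrum
proof (intro allI impI)
  have sep: "\<exists>U V. openin (base spectrum) U \<and> openin (base spectrum) V \<and> P \<in> U \<and> Q \<in> V \<and> disjnt U V"
    if P: "ultra P" "ultra Q" "a \<in> P" "a \<notin> Q" for P Q a
  proof -
    obtain b where b: "b \<in> Q" using ultraD(3)[OF P(2)] by blast
    have ab: "a \<in> carr S" "b \<in> carr S" using P b ultraD(2) by blast+
    have "Q \<in> points (b \<ominus> a)" using ab P b by (simp add: points_diff points_iff)
    moreover have "disjnt (points a) (points (b \<ominus> a))"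
      using ab by (auto simp: points_diff disjnt_def)
    ultimately show ?thesis
      using P ab openin_points[of a] openin_points[of "b \<ominus> a"]
      by (intro exI[of _ "points a"] exI[of _ "points (b \<ominus> a)"]) (auto simp: points_iff)
  qed
  fix P Q assume PQ: "P \<in> {P. ultra P} \<and> Q \<in> {P. ultra P} \<and> P \<noteq> Q"
  then consider a where "a \<in> P" "a \<notin> Q" | a where "a \<in> Q" "a \<notin> P" by blast
  then show "\<exists>U V. openin (base spectrum) U \<and> openin (base spectrum) V \<and> P \<in> U \<and> Q \<in> V \<and> disjnt U V"
  proof cases
    case (1 a) then show ?thesis using sep[of P Q a] PQ by simp
  next
    case (2 a)
    then have "\<exists>V U. openin (base spectrum) V \<and> openin (base spectrum) U \<and> Q \<in> V \<and> P \<in> U \<and> disjnt V U"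
      using sep[of Q P a] PQ by simp
    then show ?thesis by (metis disjnt_sym)
  qed
qed

lemma closedin_points: "a \<in> carr S \<Longrightarrow> closedin (base spectrum) (points a)"
  using compactin_points Hausdorff_spectrum compactin_imp_closedin by blast

lemma locally_compact_boolean_spectrum: "locally_compact_boolean_space (base spectrum)"
  unfolding locally_compact_boolean_space_def
proof (intro conjI Hausdorff_spectrum)
  show "locally_compact_space (base spectrum)"
    unfolding locally_compact_space_def
  proof
    fix P assume "P \<in> topspace (base spectrum)"
    then obtain a where "a \<in> carr S" "P \<in> points a"
      using openin_topspace[of "base spectrum"] unfolding openin_base_iff by blast
    then show "\<exists>U K. openin (base spectrum) U \<and> compactin (base spectrum) K \<and> P \<in> U \<and> U \<subseteq> K"
      using openin_points compactin_points by blast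
  qed
  show "openin (base spectrum)
      = arbitrary union_of (\<lambda>U. openin (base spectrum) U \<and> closedin (base spectrum) U)"
    unfolding openin_topology_base_unique
    using openin_points closedin_points openin_base_iff by (metis (no_types, lifting))
qed

lemma continuous_germ_base: "continuous_map (total spectrum) (base spectrum) germ_base"
  unfolding continuous_map
proof (intro conjI allI impI)
  have "germ_base ` topspace (total spectrum) = (\<Union>a \<in> carr S. points a)"
    by (simp add: topspace_total_spectrum image_UN germ_base_image)
  then show "germ_base ` topspace (total spectrum) \<subseteq> topspace (base spectrum)"
    by (auto simp: topspace_base_spectrum points_iff)
  fix U assume U: "openin (base spectrum) U"
  show "openin (total spectrum) {G \<in> topspace (total spectrum). germ_base G \<in> U}"
    unfolding openin_total_iff
  proof
    fix G assume "G \<in> {G \<in> topspace (total spectrum). germ_base G \<in> U}"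
    then obtain a where a: "a \<in> carr S" "G \<in> germs a" "germ_base G \<in> U"
      by (auto simp: topspace_total_spectrum)
    then obtain b where b: "b \<in> carr S" "germ_base G \<in> points b" "points b \<subseteq> U"
      using U unfolding openin_base_iff by blast
    have "germs (a \<sqinter> b) = {G \<in> germs a. germ_base G \<in> points b}"
      using germs_meet[OF a(1) b(1)] by (simp add: germ_base_image)
    then show "\<exists>c \<in> carr S. G \<in> germs c \<and> germs c \<subseteq> {G \<in> topspace (total spectrum). germ_base G \<in> U}"
      using a b by (intro bexI[of _ "a \<sqinter> b"]) (auto simp: topspace_total_spectrum)
  qed
qed

lemma open_map_germ_base:
  assumes "openin (total spectrum) U"
  shows "openin (base spectrum) (germ_base ` U)"
  unfolding openin_base_iff
proof
  fix P assume "P \<in> germ_base ` U"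
  then obtain G where G: "G \<in> U" "P = germ_base G" by blast
  then obtain a where "a \<in> carr S" "G \<in> germs a" "germs a \<subseteq> U"
    using assms unfolding openin_total_iff by blast
  then show "\<exists>a \<in> carr S. P \<in> points a \<and> points a \<subseteq> germ_base ` U"
    using G unfolding germ_base_image[symmetric] by blast
qed

text \<open>The sheets are the sets \<open>germs a\<close>: on each of them the projection is a
  continuous open bijection onto \<open>points a\<close>.\<close>

lemma etale_spectrum: "etale_space spectrum"
  unfolding etale_space_def local_homeomorphism_def spectrum_simps
proof (intro conjI continuous_germ_base ballI)
  fix G assume "G \<in> topspace (total spectrum)"
  then obtain a where a: "a \<in> carr S" "G \<in> germs a" by (auto simp: topspace_total_spectrum)
  have top: "topspace (subtopology (total spectrum) (germs a)) = germs a"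
    "topspace (subtopology (base spectrum) (points a)) = points a"
    using openin_subset[OF openin_germs[OF a(1)]] openin_subset[OF openin_points[OF a(1)]]
    by (simp_all add: inf.absorb2)
  have "homeomorphic_map (subtopology (total spectrum) (germs a))
      (subtopology (base spectrum) (points a)) germ_base"
  proof (rule bijective_open_imp_homeomorphic_map)
    show "continuous_map (subtopology (total spectrum) (germs a))
        (subtopology (base spectrum) (points a)) germ_base"
      using continuous_map_from_subtopology[OF continuous_germ_base] germ_base_in_points top
      by (simp add: continuous_map_in_subtopology Pi_iff)
    show "open_map (subtopology (total spectrum) (germs a))
        (subtopology (base spectrum) (points a)) germ_base"
      unfolding open_map_def
      using open_map_germ_base germ_base_image[of a] openin_germs[OF a(1)] openin_points[OF a(1)]
      by (auto simp: openin_open_subtopology)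
  qed (simp_all only: top germ_base_image inj_on_germ_base)
  then show "\<exists>U. openin (total spectrum) U \<and> G \<in> U \<and> openin (base spectrum) (germ_base ` U) \<and>
      homeomorphic_map (subtopology (total spectrum) U) (subtopology (base spectrum) (germ_base ` U)) germ_base"
    using a openin_germs[OF a(1)] openin_points[OF a(1)]
    by (intro exI[of _ "germs a"]) (simp add: germ_base_image)
next
  have "topspace (base spectrum) = (\<Union>a \<in> carr S. points a)"
    using ultraD(2,3) by (fastforce simp: topspace_base_spectrum points_iff)
  then show "germ_base ` topspace (total spectrum) = topspace (base spectrum)"
    by (simp add: topspace_total_spectrum image_UN germ_base_image)
qed

lemma boolean_etale_spectrum: "boolean_etale spectrum"
  by unfold_locales (simp_all add: etale_spectrum locally_compact_boolean_spectrum)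

section \<open>The sections of the spectrum\<close>

lemma compact_section_germs: "a \<in> carr S \<Longrightarrow> compact_section spectrum (germs a)"
  by (simp add: etale.compact_section_iff[OF etale.intro[OF etale_spectrum]] open_section_def openin_germs inj_on_germ_base
      germ_base_image compactin_points)

text \<open>Equal germs mean that \<open>a\<close> and \<open>b\<close> agree on a member of each
  ultrafilter in \<open>points a\<close>. The property
  \<open>a \<sqinter> c = b \<sqinter> c\<close> is stable under joins by distributivity, so
  compactness gives one such \<open>c\<close> with \<open>a \<preceq> c\<close>. As
  \<open>b \<preceq> a\<close>, the two meets are \<open>a\<close> and \<open>b\<close>
  themselves.\<close>

lemma germs_inj:
  assumes [simp]: "a \<in> carr S" "b \<in> carr S" and eq: "germs a = germs b"
  shows "a = b"
proof -
  obtain c where c: "c \<in> carr S" "a \<sqinter> c = b \<sqinter> c" "a \<preceq> c"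
  proof (rule points_compact[of a "\<lambda>c. a \<sqinter> c = b \<sqinter> c"])
    fix P assume P: "P \<in> points a"
    then have "germ P a \<in> germs b" unfolding eq[symmetric] by (auto simp: germs_def)
    then have "b \<in> germ P a" using germs_iff[OF P] by blast
    then show "\<exists>p \<in> P. a \<sqinter> p = b \<sqinter> p" by (auto simp: germ_def) metis
  qed (auto simp: meet_join_distrib)
  have "points a = points b" using eq germ_base_image by metis
  then have "b \<preceq> a" using points_subset_iff[of b a] by simp
  then have "b \<preceq> c" using c preceq_trans[of b a c] by simp
  then show ?thesis using c by simp
qed

text \<open>By compactness \<open>W\<close> is a finite union of sets \<open>germs a\<close>.
  Joining these elements realises the union: \<open>W\<close> has at most one point in each stalk,
  so over a common domain their germs agree and the join overwrites nothing.\<close>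

lemma germs_surj:
  assumes W: "compact_section spectrum W"
  obtains a where "a \<in> carr S" "germs a = W"
proof -
  let ?\<B> = "germs ` {a \<in> carr S. germs a \<subseteq> W}"
  have open_W: "openin (total spectrum) W" and inj: "inj_on germ_base W"
    and cpt: "compactin (total spectrum) W"
    using W by (auto simp: compact_section_def)
  have "\<exists>\<F>. finite \<F> \<and> \<F> \<subseteq> ?\<B> \<and> W \<subseteq> \<Union>\<F>"
  proof (rule compactinD[OF cpt])
    show "\<And>U. U \<in> ?\<B> \<Longrightarrow> openin (total spectrum) U" using openin_germs by auto
    show "W \<subseteq> \<Union>?\<B>" using open_W unfolding openin_total_iff by blast
  qed
  then obtain \<F> where \<F>: "finite \<F>" "\<F> \<subseteq> ?\<B>" "W \<subseteq> \<Union>\<F>" by blast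
  have "\<exists>a \<in> carr S. germs a = \<Union>\<F>" if "finite \<F>" "\<F> \<subseteq> ?\<B>" for \<F>
    using that
  proof (induction \<F> rule: finite_induct)
    case empty
    have "germs \<zero> = {}" by (simp add: germs_def)
    then show ?case by auto
  next
    case (insert U \<F>)
    then obtain a b where a: "a \<in> carr S" "germs a = \<Union>\<F>" and b: "b \<in> carr S" "germs b = U" "U \<subseteq> W"
      by auto
    have "germs a \<subseteq> W" "germs b \<subseteq> W" using a b insert.prems by auto
    have "germs (a \<squnion> b) = germs b \<union> germs a"
    proof -
      have "G \<in> germs b" if G: "G \<in> germs a" "germ_base G \<in> germ_base ` germs b" for G
      proof -
        obtain H where H: "H \<in> germs b" "germ_base G = germ_base H" using G(2) by blast
        then have "G = H"
          using inj G(1) \<open>germs a \<subseteq> W\<close> \<open>germs b \<subseteq> W\<close> by (meson inj_onD subsetD)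
        then show ?thesis using H by simp
      qed
      then show ?thesis unfolding germs_join[OF a(1) b(1)] by blast
    qed
    then show ?case using a b by (intro bexI[of _ "a \<squnion> b"]) auto
  qed
  from this[OF \<F>(1,2)] obtain a where "a \<in> carr S" "germs a = \<Union>\<F>" by blast
  moreover have "\<Union>\<F> = W" using \<F> by blast
  ultimately show thesis using that by simp
qed

theorem germs_iso:
  "restrict germs (carr S) \<in> skew_hom S (section_algebra spectrum)"
  "bij_betw (restrict germs (carr S)) (carr S) (carr (section_algebra spectrum))"
proof -
  show "restrict germs (carr S) \<in> skew_hom S (section_algebra spectrum)"
    by (simp add: skew_hom_def compact_section_germs germs_meet germs_join germs_diff)
      (simp add: germs_def)
  have "inj_on (restrict germs (carr S)) (carr S)" using germs_inj by (auto simp: inj_on_def)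
  moreover have "restrict germs (carr S) ` carr S = carr (section_algebra spectrum)"
  proof (intro equalityI subsetI)
    fix W assume "W \<in> carr (section_algebra spectrum)"
    then obtain a where "a \<in> carr S" "germs a = W" using germs_surj by auto
    then show "W \<in> restrict germs (carr S) ` carr S" by force
  qed (auto simp: compact_section_germs)
  ultimately show "bij_betw (restrict germs (carr S)) (carr S) (carr (section_algebra spectrum))"
    by (simp add: bij_betw_def)
qed

end

section \<open>Smallness and the equivalence\<close>

text \<open>Since \<open>B \<times> B \<lesssim> B\<close>, lists of each fixed length are no more
  numerous than \<open>B\<close>, and there are only countably many lengths.\<close>

lemma lists_lepoll:
  assumes "infinite B"
  shows "lists B \<lesssim> B"
proof -
  have BB: "B \<times> B \<lesssim> B"
    using card_of_Times_same_infinite[OF assms] by (simp add: eqpoll_imp_lepoll eqpoll_iff_card_of_ordIso)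
  have len: "{xs \<in> lists B. length xs = n} \<lesssim> B" for n
  proof (induction n)
    case 0
    have "{xs \<in> lists B. length xs = 0} = {[]}" by auto
    then show ?case using finite_lepoll_infinite[OF assms, of "{[]}"] by simp
  next
    case (Suc n)
    have "{xs \<in> lists B. length xs = Suc n}
        \<subseteq> (\<lambda>(x, xs). x # xs) ` (B \<times> {xs \<in> lists B. length xs = n})"
      by (auto simp: length_Suc_conv image_iff)
    then have "{xs \<in> lists B. length xs = Suc n} \<lesssim> B \<times> {xs \<in> lists B. length xs = n}"
      by (rule subset_image_lepoll)
    also have "\<dots> \<lesssim> B \<times> B" using Suc by (intro times_lepoll_mono) auto
    also note BB
    finally show ?case .
  qed
  then obtain g where g: "\<And>n. {xs \<in> lists B. length xs = n} \<subseteq> g n ` B"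
    unfolding lepoll_iff by metis
  have "lists B \<subseteq> (\<lambda>(n, b). g n b) ` ((UNIV :: nat set) \<times> B)"
  proof
    fix xs assume "xs \<in> lists B"
    then obtain b where "b \<in> B" "xs = g (length xs) b" using g by blast
    then have "(length xs, b) \<in> (UNIV :: nat set) \<times> B" "xs = (\<lambda>(n, b). g n b) (length xs, b)" by auto
    then show "xs \<in> (\<lambda>(n, b). g n b) ` ((UNIV :: nat set) \<times> B)" by (rule rev_image_eqI)
  qed
  then have "lists B \<lesssim> (UNIV :: nat set) \<times> B" by (rule subset_image_lepoll)
  also have "\<dots> \<lesssim> B \<times> B"
    using assms by (intro times_lepoll_mono) (auto simp: infinite_le_lepoll)
  also note BB
  finally show ?thesis .
qed

lemma Fpow_lepoll:
  assumes "infinite B"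
  shows "Fpow B \<lesssim> B"
proof -
  have "Fpow B \<subseteq> set ` lists B"
  proof
    fix F assume "F \<in> Fpow B"
    then have F: "finite F" "F \<subseteq> B" by (auto simp: Fpow_def)
    then obtain xs where "set xs = F" using finite_list by blast
    then show "F \<in> set ` lists B" using F by (auto simp: lists_eq_set)
  qed
  then have "Fpow B \<lesssim> lists B" by (rule subset_image_lepoll)
  also have "\<dots> \<lesssim> B" using assms by (rule lists_lepoll)
  finally show ?thesis .
qed

lemma compact_open_finite_union:
  assumes base: "openin X = arbitrary union_of (\<lambda>U. U \<in> \<B>)"
    and W: "openin X W" "compactin X W"
  shows "W \<in> Union ` Fpow \<B>"
proof -
  have "(arbitrary union_of (\<lambda>U. U \<in> \<B>)) W" using W(1) base by simp
  then obtain \<U> where U: "\<U> \<subseteq> \<B>" "\<Union>\<U> = W" by (auto simp: union_of_def)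
  have "openin X U" if "U \<in> \<U>" for U
    using that U(1) unfolding base by (auto intro: union_of_inc simp: arbitrary_def)
  then obtain \<F> where "finite \<F>" "\<F> \<subseteq> \<U>" "W \<subseteq> \<Union>\<F>"
    using compactinD[OF W(2), of \<U>] U(2) by auto
  then have "\<F> \<in> Fpow \<B>" "W = \<Union>\<F>" using U by (auto simp: Fpow_def)
  then show ?thesis by blast
qed

text \<open>Compact sections are finite unions of basic sets, and an infinite base has no more
  finite subsets than members. For a finite base the count can grow: the one-point space over itself
  has a base with one member but two compact sections. This case relies on the universe being
  infinite.\<close>

lemma section_algebra_small:
  assumes inf: "infinite (UNIV :: 'u set)" and small: "small_base TYPE('u) (total A)"
  shows "carr (section_algebra A) \<prec> (UNIV :: 'u set)"
proof -
  obtain \<B> where \<B>: "\<B> \<prec> (UNIV :: 'u set)" "openin (total A) = arbitrary union_of (\<lambda>U. U \<in> \<B>)"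
    using small unfolding small_base_def by blast
  have sub: "carr (section_algebra A) \<subseteq> Union ` Fpow \<B>"
    using compact_open_finite_union[OF \<B>(2)] by (auto simp: compact_section_def)
  show ?thesis
  proof (cases "finite \<B>")
    case True
    then have "finite (Fpow \<B>)" by (auto simp: Fpow_def)
    then have "finite (carr (section_algebra A))" using sub finite_subset by blast
    then show ?thesis using inf by (intro finite_lesspoll_infinite) auto
  next
    case False
    have "carr (section_algebra A) \<lesssim> Fpow \<B>" using sub by (rule subset_image_lepoll)
    also have "\<dots> \<lesssim> \<B>" using False by (rule Fpow_lepoll)
    finally show ?thesis using \<B>(1) by (rule lesspoll_trans1)
  qed
qed

lemma (in left_handed_skew_boolean_algebra) small_base_spectrum:
  assumes "carr S \<prec> (UNIV :: 'u set)"
  shows "small_base TYPE('u) (base spectrum)" "small_base TYPE('u) (total spectrum)"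
  unfolding small_base_def
  using openin_base_spectrum openin_total_spectrum
    lesspoll_trans1[OF image_lepoll assms] by blast+

section \<open>The section functor\<close>

definition encode :: "('e, 'x) etale \<Rightarrow> 'e set \<Rightarrow> 'u" where
  "encode A = (SOME \<iota>. inj_on \<iota> (carr (section_algebra A)))"

lemma inj_on_encode:
  assumes "infinite (UNIV :: 'u set)" "small_base TYPE('u) (total A)"
  shows "inj_on (encode A :: _ \<Rightarrow> 'u) (carr (section_algebra A))"
proof -
  have "\<exists>\<iota> :: _ \<Rightarrow> 'u. inj_on \<iota> (carr (section_algebra A))"
    using section_algebra_small[OF assms] by (auto simp: lesspoll_def lepoll_def)
  then show ?thesis unfolding encode_def by (rule someI_ex)
qed

text \<open>A morphism decodes an element to a section, pushes it and encodes the result.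
  Restricting to the carrier makes the map extensional, as membership in \<open>skew_hom\<close>
  demands.\<close>

definition sections_functor ::
  "(('u set, 'u set) etale, ('u set \<Rightarrow> 'u set) \<times> ('u set \<Rightarrow> 'u set \<Rightarrow> 'u set),
    'u skew_alg, 'u \<Rightarrow> 'u) prefunctor" where
  "sections_functor =
     \<lparr>omap = (\<lambda>A. transport (encode A) (section_algebra A)),
      mmap = (\<lambda>B A h. \<lambda>u \<in> encode B ` carr (section_algebra B).
        encode A (push A B h (inv_into (carr (section_algebra B)) (encode B) u)))\<rparr>"

text \<open>Conjugation by the inverse isomorphisms undoes it. It carries \<open>push_bij\<close>
  over to the transported algebras.\<close>

lemma proper_skew_hom_conj:
  assumes LH: "left_handed_skew_boolean_algebra S1" "left_handed_skew_boolean_algebra S2"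
    "left_handed_skew_boolean_algebra T1" "left_handed_skew_boolean_algebra T2"
    and a: "a \<in> skew_hom S1 T1" "bij_betw a (carr S1) (carr T1)"
    and b: "b \<in> skew_hom S2 T2" "bij_betw b (carr S2) (carr T2)"
  shows "bij_betw (\<lambda>\<phi>. \<lambda>u \<in> carr T1. b (\<phi> (inv_into (carr S1) a u)))
    (proper_skew_hom S1 S2) (proper_skew_hom T1 T2)"
proof -
  define a' where "a' = restrict (inv_into (carr S1) a) (carr T1)"
  define b' where "b' = restrict (inv_into (carr S2) b) (carr T2)"
  have hom: "a \<in> proper_skew_hom S1 T1" "a' \<in> proper_skew_hom T1 S1"
    "b \<in> proper_skew_hom S2 T2" "b' \<in> proper_skew_hom T2 S2"
    using a b LH inv_skew_hom[OF LH(1) a] inv_skew_hom[OF LH(2) b]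
      bij_betw_inv_into[OF a(2)] bij_betw_inv_into[OF b(2)]
    by (auto simp: a'_def b'_def bij_betw_def intro!: surj_imp_proper_skew_hom)
  have inv: "a' (a x) = x" "a x \<in> carr T1" if "x \<in> carr S1" for x
    using that a(2) by (auto simp: a'_def bij_betw_def)
  have inv': "a (a' x) = x" "a' x \<in> carr S1" if "x \<in> carr T1" for x
    using that bij_betw_inv_into_right[OF a(2)] bij_betw_inv_into[OF a(2)]
    by (auto simp: a'_def bij_betw_def)
  have invb: "b' (b x) = x" "b x \<in> carr T2" if "x \<in> carr S2" for x
    using that b(2) by (auto simp: b'_def bij_betw_def)
  have invb': "b (b' x) = x" "b' x \<in> carr S2" if "x \<in> carr T2" for x
    using that bij_betw_inv_into_right[OF b(2)] bij_betw_inv_into[OF b(2)]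
    by (auto simp: b'_def bij_betw_def)
  have eq: "(\<lambda>u \<in> carr T1. b (\<phi> (inv_into (carr S1) a u)))
      = compose (carr T1) (compose (carr S1) b \<phi>) a'" for \<phi>
    using inv' by (auto simp: compose_def a'_def fun_eq_iff)
  show ?thesis
    unfolding eq
  proof (rule bij_betw_byWitness[where f' = "\<lambda>\<psi>. compose (carr S1) (compose (carr T1) b' \<psi>) a"])
    show "\<forall>\<phi> \<in> proper_skew_hom S1 S2.
        compose (carr S1) (compose (carr T1) b' (compose (carr T1) (compose (carr S1) b \<phi>) a')) a = \<phi>"
    proof
      fix \<phi> assume "\<phi> \<in> proper_skew_hom S1 S2"
      then have "\<phi> \<in> carr S1 \<rightarrow>\<^sub>E carr S2" by (rule skew_hom_funcset)
      then show "compose (carr S1) (compose (carr T1) b' (compose (carr T1) (compose (carr S1) b \<phi>) a')) a = \<phi>"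
        by (intro extensionalityI[of _ "carr S1"])
          (auto simp: compose_def inv invb PiE_def Pi_iff)
    qed
    show "\<forall>\<psi> \<in> proper_skew_hom T1 T2.
        compose (carr T1) (compose (carr S1) b (compose (carr S1) (compose (carr T1) b' \<psi>) a)) a' = \<psi>"
    proof
      fix \<psi> assume "\<psi> \<in> proper_skew_hom T1 T2"
      then have "\<psi> \<in> carr T1 \<rightarrow>\<^sub>E carr T2" by (rule skew_hom_funcset)
      then show "compose (carr T1) (compose (carr S1) b (compose (carr S1) (compose (carr T1) b' \<psi>) a)) a' = \<psi>"
        by (intro extensionalityI[of _ "carr T1"])
          (auto simp: compose_def inv' invb' PiE_def Pi_iff)
    qed
    show "(\<lambda>\<phi>. compose (carr T1) (compose (carr S1) b \<phi>) a') ` proper_skew_hom S1 S2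
        \<subseteq> proper_skew_hom T1 T2"
      using compose_proper_skew_hom[OF LH(3,1,4) hom(2)]
        compose_proper_skew_hom[OF LH(1,2,4) _ hom(3)] by blast
    show "(\<lambda>\<psi>. compose (carr S1) (compose (carr T1) b' \<psi>) a) ` proper_skew_hom T1 T2
        \<subseteq> proper_skew_hom S1 S2"
      using compose_proper_skew_hom[OF LH(1,3,2) hom(1)]
        compose_proper_skew_hom[OF LH(3,4,2) _ hom(4)] by blast
  qed
qed

lemma iso_in_LSBA:
  assumes LH: "left_handed_skew_boolean_algebra S" "left_handed_skew_boolean_algebra T"
    and f: "f \<in> skew_hom S T" "bij_betw f (carr S) (carr T)"
  shows "iso_in LSBA S T f"
proof -
  let ?g = "restrict (inv_into (carr S) f) (carr T)"
  have "f \<in> proper_skew_hom S T"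
    using f LH by (auto simp: bij_betw_def intro: surj_imp_proper_skew_hom)
  moreover have "?g \<in> proper_skew_hom T S"
    using LH inv_skew_hom[OF LH(1) f] bij_betw_inv_into[OF f(2)]
    by (auto simp: bij_betw_def intro!: surj_imp_proper_skew_hom)
  moreover have "compose (carr S) ?g f = (\<lambda>x \<in> carr S. x)"
    using f(2) by (auto simp: compose_def bij_betw_def fun_eq_iff)
  moreover have "compose (carr T) f ?g = (\<lambda>x \<in> carr T. x)"
    using bij_betw_inv_into_right[OF f(2)] by (auto simp: compose_def fun_eq_iff)
  ultimately show ?thesis unfolding iso_in_def by auto
qed

lemma compose_skew_hom_bij:
  assumes "left_handed_skew_boolean_algebra S"
    and "f \<in> skew_hom S T" "bij_betw f (carr S) (carr T)"
    and "g \<in> skew_hom T R" "bij_betw g (carr T) (carr R)"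
  shows "compose (carr S) g f \<in> skew_hom S R" "bij_betw (compose (carr S) g f) (carr S) (carr R)"
proof -
  show "compose (carr S) g f \<in> skew_hom S R" using assms by (intro compose_skew_hom)
  have "bij_betw (g \<circ> f) (carr S) (carr R)" using assms by (intro bij_betw_trans)
  then show "bij_betw (compose (carr S) g f) (carr S) (carr R)"
    by (rule bij_betw_cong[THEN iffD1, rotated]) (simp add: compose_def)
qed

locale universe =
  fixes U :: "'u itself"
  assumes infinite_universe: "infinite (UNIV :: 'u set)"
begin

abbreviation "EC \<equiv> (ESLCBS :: (('u set, 'u set) etale,
       ('u set \<Rightarrow> 'u set) \<times> ('u set \<Rightarrow> 'u set \<Rightarrow> 'u set)) precategory)"
abbreviation "AC \<equiv> (LSBA :: ('u skew_alg, 'u \<Rightarrow> 'u) precategory)"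
abbreviation "enc \<equiv> (encode :: ('u set, 'u set) etale \<Rightarrow> 'u set set \<Rightarrow> 'u)"

lemma boolean_etale_Obj: "A \<in> Obj EC \<Longrightarrow> boolean_etale A"
  by (simp add: boolean_etale_def etale_def boolean_etale_axioms_def)

lemma transported_Obj:
  assumes A: "A \<in> Obj EC"
  shows "transported_algebra (section_algebra A) (enc A)"
proof -
  interpret boolean_etale A using A by (rule boolean_etale_Obj)
  show ?thesis
    using A inj_on_encode[OF infinite_universe, of A] by unfold_locales simp
qed

lemma omap_carr: "A \<in> Obj EC \<Longrightarrow> carr (omap sections_functor A) = enc A ` carr (section_algebra A)"
  using transported_algebra.T_simps(1)[OF transported_Obj] by (simp add: sections_functor_def)

lemma mmap_encode:
  assumes "B \<in> Obj EC" "compact_section B W"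
  shows "mmap sections_functor B A h (enc B W) = enc A (push A B h W)"
  using transported_algebra.inj[OF transported_Obj[OF assms(1)]] assms(2)
  by (simp add: sections_functor_def inv_into_f_f)

lemma mmap_extensional:
  assumes "B \<in> Obj EC"
  shows "mmap sections_functor B A h \<in> extensional (carr (omap sections_functor B))"
  by (simp only: omap_carr[OF assms]) (simp add: sections_functor_def)

lemma omap_left_handed:
  assumes "A \<in> Obj EC"
  shows "left_handed_skew_boolean_algebra (omap sections_functor A)"
  using transported_algebra.left_handed_skew_boolean_algebra_T[OF transported_Obj[OF assms]]
  by (simp add: sections_functor_def)

lemma mmap_bij_betw:
  assumes B: "B \<in> Obj EC" and A: "A \<in> Obj EC"
  shows "bij_betw (mmap sections_functor B A) (etale_hom B A)
    (proper_skew_hom (omap sections_functor B) (omap sections_functor A))"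
proof -
  interpret B: boolean_etale B using B by (rule boolean_etale_Obj)
  interpret A: boolean_etale A using A by (rule boolean_etale_Obj)
  interpret boolean_etale_pair B A ..
  interpret TB: transported_algebra "section_algebra B" "enc B" using B by (rule transported_Obj)
  interpret TA: transported_algebra "section_algebra A" "enc A" using A by (rule transported_Obj)
  let ?conj = "\<lambda>\<phi>. \<lambda>u \<in> carr TB.T. restrict (enc A) (carr SA)
      (\<phi> (inv_into (carr SB) (restrict (enc B) (carr SB)) u))"
  have "bij_betw ?conj (proper_skew_hom SB SA) (proper_skew_hom TB.T TA.T)"
    by (rule proper_skew_hom_conj) (rule B.section_algebra.left_handed_skew_boolean_algebra_axioms
      A.section_algebra.left_handed_skew_boolean_algebra_axioms
      TB.left_handed_skew_boolean_algebra_T TA.left_handed_skew_boolean_algebra_T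
      TB.transport_hom TA.transport_hom TB.transport_bij TA.transport_bij)+
  with push_bij have "bij_betw (?conj \<circ> (\<lambda>h. restrict (push A B h) (carr SB)))
      (etale_hom B A) (proper_skew_hom TB.T TA.T)"
    by (rule bij_betw_trans)
  moreover have "(?conj \<circ> (\<lambda>h. restrict (push A B h) (carr SB))) h = mmap sections_functor B A h"
    if h: "h \<in> etale_hom B A" for h
  proof (rule extensionalityI[of _ "carr TB.T"])
    show "mmap sections_functor B A h \<in> extensional (carr TB.T)"
      using mmap_extensional[OF B] by (simp add: sections_functor_def)
    fix u assume "u \<in> carr TB.T"
    then obtain W where W: "compact_section B W" "u = enc B W" by auto
    have "inv_into (carr SB) (restrict (enc B) (carr SB)) u = W"
      using TB.transport_bij W inv_into_f_f[of "restrict (enc B) (carr SB)" "carr SB" W]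
      by (simp add: bij_betw_def)
    moreover have "compact_section A (push A B h W)"
      using compact_section_push[OF B.etale A.etale, of "fst h" "snd h" W] h W by simp
    ultimately show "(?conj \<circ> (\<lambda>h. restrict (push A B h) (carr SB))) h u = mmap sections_functor B A h u"
      using W mmap_encode[OF B W(1)] by simp
  qed simp
  ultimately have "bij_betw (mmap sections_functor B A) (etale_hom B A) (proper_skew_hom TB.T TA.T)"
    by (subst bij_betw_cong[of _ _ "?conj \<circ> (\<lambda>h. restrict (push A B h) (carr SB))"]) auto
  then show ?thesis by (simp add: sections_functor_def)
qed

text \<open>The isomorphism is \<open>germs\<close> followed by the encoding of the sections of the
  spectrum.\<close>

lemma spectrum_essentially_surjective:
  assumes S: "S \<in> Obj AC"
  shows "\<exists>A \<in> Obj EC. \<exists>h. iso_in AC S (omap sections_functor A) h"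
proof -
  interpret S: left_handed_skew_boolean_algebra S using S by simp
  let ?A = "S.spectrum"
  have "carr S \<prec> (UNIV :: 'u set)" using S by simp
  note small = S.small_base_spectrum[OF this]
  have A: "?A \<in> Obj EC"
    using S.etale_spectrum S.locally_compact_boolean_spectrum small by simp
  interpret A: boolean_etale ?A by (rule S.boolean_etale_spectrum)
  interpret T: transported_algebra "section_algebra ?A" "enc ?A" using A by (rule transported_Obj)
  have "iso_in AC S T.T (compose (carr S) (restrict (enc ?A) (carr (section_algebra ?A)))
      (restrict S.germs (carr S)))"
    using compose_skew_hom_bij[OF S.left_handed_skew_boolean_algebra_axioms S.germs_iso
        T.transport_hom T.transport_bij]
    by (intro iso_in_LSBA S.left_handed_skew_boolean_algebra_axioms
        T.left_handed_skew_boolean_algebra_T)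
  then show ?thesis using A by (auto simp: sections_functor_def)
qed

lemma fully_faithful_sections_functor:
  "fully_faithful_surjective_functor EC AC sections_functor"
proof (intro fully_faithful_surjective_functor.intro category_functor.intro
    category_ESLCBS category_LSBA)
  show "fully_faithful_surjective_functor_axioms EC AC sections_functor"
  proof
    show "bij_betw (mmap sections_functor a b) (Hom EC a b)
        (Hom AC (omap sections_functor a) (omap sections_functor b))"
      if "a \<in> Obj EC" "b \<in> Obj EC" for a b
      using mmap_bij_betw[OF that] by simp
  qed (rule spectrum_essentially_surjective)
  show "category_functor_axioms EC AC sections_functor"
  proof
    fix A assume A: "A \<in> Obj EC"
    interpret A: boolean_etale A using A by (rule boolean_etale_Obj)
    interpret T: transported_algebra "section_algebra A" "enc A" using A by (rule transported_Obj)
    have "carr (omap sections_functor A) \<lesssim> carr (section_algebra A)"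
      unfolding omap_carr[OF A] by (rule image_lepoll)
    also have "\<dots> \<prec> (UNIV :: 'u set)"
      using A by (intro section_algebra_small infinite_universe) simp
    finally show "omap sections_functor A \<in> Obj AC" using omap_left_handed[OF A] by simp
    show "mmap sections_functor A A (Idt EC A) = Idt AC (omap sections_functor A)"
    proof (rule extensionalityI[of _ "carr (omap sections_functor A)"])
      fix u assume "u \<in> carr (omap sections_functor A)"
      then obtain W where W: "compact_section A W" "u = enc A W" by (auto simp: omap_carr[OF A])
      then show "mmap sections_functor A A (Idt EC A) u = Idt AC (omap sections_functor A) u"
        using A mmap_encode[OF A W(1)] omap_carr[OF A]
        by (simp add: etale_hom_id[OF A.etale] A.compact_section_subset)
    qed (use mmap_extensional[OF A] in auto)
  next
    fix B A h assume "B \<in> Obj EC" "A \<in> Obj EC" "h \<in> Hom EC B A"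
    then show "mmap sections_functor B A h \<in> Hom AC (omap sections_functor B) (omap sections_functor A)"
      using mmap_bij_betw[of B A] by (auto simp: bij_betw_def)
  next
    fix B A C h g assume B: "B \<in> Obj EC" and A: "A \<in> Obj EC" and C: "C \<in> Obj EC"
      and h: "h \<in> Hom EC B A" and g: "g \<in> Hom EC A C"
    interpret B: boolean_etale B using B by (rule boolean_etale_Obj)
    interpret A: boolean_etale A using A by (rule boolean_etale_Obj)
    interpret C: boolean_etale C using C by (rule boolean_etale_Obj)
    show "mmap sections_functor B C (Cmp EC B A C g h)
        = Cmp AC (omap sections_functor B) (omap sections_functor A) (omap sections_functor C)
            (mmap sections_functor A C g) (mmap sections_functor B A h)"
    proof (rule extensionalityI[of _ "carr (omap sections_functor B)"])
      fix u assume u: "u \<in> carr (omap sections_functor B)"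
      then obtain W where W: "compact_section B W" "u = enc B W" by (auto simp: omap_carr[OF B])
      obtain f k e l where fk: "h = (f, k)" "g = (e, l)" by (cases h; cases g)
      have "compact_section A (push A B h W)"
        using compact_section_push[OF B.etale A.etale, of f k W] h W fk by simp
      then have "mmap sections_functor A C g (mmap sections_functor B A h u)
          = enc C (push C A g (push A B h W))"
        by (simp add: W(2) mmap_encode[OF B W(1)] mmap_encode[OF A])
      also have "push C A g (push A B h W) = push C B (Cmp EC B A C g h) W"
        using etale_hom_compose(1)[OF B.etale A.etale C.etale, of f k e l W] h g fk
          B.compact_section_subset[OF W(1)] by simp
      also have "enc C \<dots> = mmap sections_functor B C (Cmp EC B A C g h) u"
        by (simp only: W(2) mmap_encode[OF B W(1)])
      finally show "mmap sections_functor B C (Cmp EC B A C g h) u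
        = Cmp AC (omap sections_functor B) (omap sections_functor A) (omap sections_functor C)
            (mmap sections_functor A C g) (mmap sections_functor B A h) u"
        using u by (simp add: compose_def)
    qed (use mmap_extensional[OF B] in auto)
  qed
qed

end

theorem theorem1:
  assumes "infinite (UNIV :: 'u set)"
  shows "equivalent_categories
    (ESLCBS :: (('u set, 'u set) etale,
       ('u set \<Rightarrow> 'u set) \<times> ('u set \<Rightarrow> 'u set \<Rightarrow> 'u set)) precategory)
    (LSBA :: ('u skew_alg, 'u \<Rightarrow> 'u) precategory)"
proof -
  interpret universe "TYPE('u)" using assms by unfold_locales
  show ?thesis
    using fully_faithful_sections_functor by (rule fully_faithful_surjective_functor.equivalent)
qed

end
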